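(* Let $(M,E)$ be a Finsler manifold and let $V$ be a vertical vector field on $TM$. Then the Ehresmann connection generated by the semispray $$\overset{V}{S}:=S_0+2V+2\,(d_{[J,V]}E)^{\#}$$ is just the $[J,V]$-Ehresmann connection $\mathbf{h}_{[J,V]}$. Furthermore, if $V$ is a vertical vector field homogeneous of degree $2$ (i.e. $[C,V]=V$), then the semispray $\overset{V}{S}$ is a spray.
   Context: $M$ is a connected smooth $n$-dimensional manifold (Hausdorff, with a countable base), $TM$ its tangent manifold, $\overset{\circ}{T}M\subset TM$ the open submanifold of nonzero tangent vectors. $C$ is the Liouville vector field on $TM$ and $J$ is the vertical endomorphism of $TM$ (the vector $1$-form whose image and kernel are both the module of vertical vector fields, with $[J,J]=0$ and $[J,C]=J$). A vector $1$-form on $TM$ is a $(1,1)$ tensor field. For a vector $1$-form $K$ and a function $\varphi$ on $TM$, $d_K\varphi:=d\varphi\circ K$. For a vector field $Y$ on $TM$, $[K,Y]$ is the vector $1$-form (Frölicher-Nijenhuis bracket) given by $[K,Y]X=[KX,Y]-K[X,Y]$. A vector $1$-form $L$ is semibasic if $L\circ J=0$ and $J\circ L=0$; for $V$ vertical, $[J,V]$ is semibasic. A semispray over $M$ is a vector field $S$ on $TM$ of class $C^1$, smooth on $\overset{\circ}{T}M$, with $JS=C$. A semispray $S$ is a spray if it is homogeneous of degree $2$, i.e. $[C,S]=S$. An Ehresmann connection over $M$ is a vector $1$-form $\mathbf{h}$ on $TM$ (smooth, in general, only over $\overset{\circ}{T}M$) with $\mathbf{h}^2=\mathbf{h}$ whose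 kernel is the module of vertical vector fields. The Ehresmann connection generated by a semispray $S$ is $\frac12(\mathrm{id}+[J,S])$, where $\mathrm{id}$ is the identity on vector fields on $TM$. A Finsler manifold $(M,E)$ is given by an energy function $E:TM\to\mathbb{R}$ with $E(0)=0$, $E>0$ on $\overset{\circ}{T}M$, $E$ of class $C^1$ on $TM$ and smooth on $\overset{\circ}{T}M$, $E$ positively homogeneous of degree $2$ ($CE=2E$), and the fundamental $2$-form $\omega:=d\,d_JE$ nondegenerate. For a $1$-form $\beta$ on $TM$, $\beta^{\#}$ is the unique vector field on $TM$ (smooth, in general, only on $\overset{\circ}{T}M$) with $i_{\beta^{\#}}\omega=\beta$. The canonical spray is $S_0:=-(dE)^{\#}$ over $\overset{\circ}{T}M$, $S_0(0):=0$, and the Berwald connection is $\mathbf{h}_0:=\frac12(\mathrm{id}+[J,S_0])$. For a semibasic vector $1$-form $L$ on $TM$, the $L$-Ehresmann connection is $\mathbf{h}_L:=\mathbf{h}_0+L+[J,(d_LE)^{\#}]$.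
   Formalization: For general V the field S^V need not be C^1 at zero vectors (Randers norms, V linear in the fibres), so it is shown to be a semispray except for C^1 there; the two connections are equated over nonzero tangent vectors; the spray claim is in full. *)

theory Defs
  imports "HOL-Analysis.Analysis"
begin

section \<open>Manifolds given by an atlas\<close>

fun Ck_on :: "nat \<Rightarrow> ('a::euclidean_space \<Rightarrow> 'b::real_normed_vector) \<Rightarrow> 'a set \<Rightarrow> bool" where
  "Ck_on 0 f U \<longleftrightarrow> continuous_on U f"
| "Ck_on (Suc k) f U \<longleftrightarrow>
     (\<forall>x\<in>U. f differentiable (at x)) \<and> (\<forall>v. Ck_on k (\<lambda>x. frechet_derivative f (at x) v) U)"

text \<open>A chart is a pair of its domain and its coordinate map; the values of the map outside the
  domain are irrelevant. The dimension of the manifold is \<open>DIM('e)\<close>.\<close>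

type_synonym ('p, 'e) chart = "'p set \<times> ('p \<Rightarrow> 'e)"

definition chart_inv :: "('p, 'e) chart \<Rightarrow> 'e \<Rightarrow> 'p" where
  "chart_inv c = inv_into (fst c) (snd c)"

definition carrier :: "('p, 'e) chart set \<Rightarrow> 'p set" where
  "carrier A = (\<Union>c\<in>A. fst c)"

definition smooth_atlas :: "('p, 'e::euclidean_space) chart set \<Rightarrow> bool" where
  "smooth_atlas A \<longleftrightarrow>
     (\<forall>c\<in>A. inj_on (snd c) (fst c)) \<and>
     (\<forall>c\<in>A. \<forall>d\<in>A. open (snd c ` (fst c \<inter> fst d)) \<and>
        (\<forall>k. Ck_on k (snd d \<circ> chart_inv c) (snd c ` (fst c \<inter> fst d))))"

definition atlas_topology :: "('p, 'e::euclidean_space) chart set \<Rightarrow> 'p topology" where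
  "atlas_topology A =
     topology (\<lambda>W. W \<subseteq> carrier A \<and> (\<forall>c\<in>A. open (snd c ` (fst c \<inter> W))))"

lemma openin_atlas_topology:
  assumes "smooth_atlas A"
  shows "openin (atlas_topology A) W \<longleftrightarrow>
    W \<subseteq> carrier A \<and> (\<forall>c\<in>A. open (snd c ` (fst c \<inter> W)))"
proof -
  have "istopology (\<lambda>W. W \<subseteq> carrier A \<and> (\<forall>c\<in>A. open (snd c ` (fst c \<inter> W))))"
    unfolding istopology_def
  proof (intro conjI allI impI ballI; (elim conjE)?)
    fix S T c
    assume S: "\<forall>c\<in>A. open (snd c ` (fst c \<inter> S))" and T: "\<forall>c\<in>A. open (snd c ` (fst c \<inter> T))"
      and c: "c \<in> A"
    have "inj_on (snd c) (fst c)"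
      using assms c by (simp add: smooth_atlas_def)
    then have "snd c ` (fst c \<inter> (S \<inter> T)) = snd c ` (fst c \<inter> S) \<inter> snd c ` (fst c \<inter> T)"
      by (auto simp: inj_on_def)
    then show "open (snd c ` (fst c \<inter> (S \<inter> T)))"
      using S T c by (simp add: open_Int)
  next
    fix K c
    assume K: "\<forall>W\<in>K. W \<subseteq> carrier A \<and> (\<forall>c\<in>A. open (snd c ` (fst c \<inter> W)))" and c: "c \<in> A"
    have "snd c ` (fst c \<inter> \<Union>K) = (\<Union>W\<in>K. snd c ` (fst c \<inter> W))"
      by auto
    then show "open (snd c ` (fst c \<inter> \<Union>K))"
      using K c by auto
  qed auto
  then show ?thesis
    unfolding atlas_topology_def by (simp add: topology_inverse')
qed

definition smooth_manifold :: "('p, 'e::euclidean_space) chart set \<Rightarrow> bool" where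
  "smooth_manifold A \<longleftrightarrow>
     smooth_atlas A \<and> Hausdorff_space (atlas_topology A) \<and> second_countable (atlas_topology A)"

definition Ck_fun ::
    "('p, 'e::euclidean_space) chart set \<Rightarrow> nat \<Rightarrow> 'p set \<Rightarrow> ('p \<Rightarrow> 'b::real_normed_vector) \<Rightarrow> bool" where
  "Ck_fun A k W f \<longleftrightarrow> (\<forall>c\<in>A. Ck_on k (f \<circ> chart_inv c) (snd c ` (fst c \<inter> W)))"

section \<open>Tangent vectors and the tangent manifold\<close>

text \<open>A tangent vector at \<open>p\<close> is the family of its components in all charts around \<open>p\<close>, related by
  the derivatives of the coordinate changes. To make the family unique it is \<open>0\<close> at all other
  indices.\<close>

type_synonym ('p, 'e) tvec = "('p, 'e) chart \<Rightarrow> 'e"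

definition tangent_space ::
    "('p, 'e::euclidean_space) chart set \<Rightarrow> 'p \<Rightarrow> ('p, 'e) tvec set" where
  "tangent_space A p =
     {v. (\<forall>c. \<not> (c \<in> A \<and> p \<in> fst c) \<longrightarrow> v c = 0) \<and>
         (\<forall>c\<in>A. \<forall>d\<in>A. p \<in> fst c \<inter> fst d \<longrightarrow>
            v d = frechet_derivative (snd d \<circ> chart_inv c) (at (snd c p)) (v c))}"

type_synonym ('p, 'e) tpoint = "'p \<times> ('p, 'e) tvec"

definition TM :: "('p, 'e::euclidean_space) chart set \<Rightarrow> ('p, 'e) tpoint set" where
  "TM A = {q. fst q \<in> carrier A \<and> snd q \<in> tangent_space A (fst q)}"

definition slit_TM :: "('p, 'e::euclidean_space) chart set \<Rightarrow> ('p, 'e) tpoint set" where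
  "slit_TM A = {q \<in> TM A. snd q \<noteq> (\<lambda>_. 0)}"

definition tangent_chart ::
    "('p, 'e::euclidean_space) chart set \<Rightarrow> ('p, 'e) chart \<Rightarrow> (('p, 'e) tpoint, 'e \<times> 'e) chart" where
  "tangent_chart A c = ({q \<in> TM A. fst q \<in> fst c}, \<lambda>q. (snd c (fst q), snd q c))"

definition tangent_atlas ::
    "('p, 'e::euclidean_space) chart set \<Rightarrow> (('p, 'e) tpoint, 'e \<times> 'e) chart set" where
  "tangent_atlas A = tangent_chart A ` A"

section \<open>Differentials, vector fields, Lie bracket\<close>

definition chart_at :: "('p, 'e) chart set \<Rightarrow> 'p \<Rightarrow> ('p, 'e) chart" where
  "chart_at A p = (SOME c. c \<in> A \<and> p \<in> fst c)"

text \<open>The value does not depend on the chart, by the transformation rule in \<open>tangent_space\<close>.\<close>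

definition differential ::
    "('p, 'e::euclidean_space) chart set \<Rightarrow> ('p \<Rightarrow> 'b::real_normed_vector) \<Rightarrow> 'p \<Rightarrow> ('p, 'e) tvec \<Rightarrow> 'b" where
  "differential A f p v = (let c = chart_at A p in
     frechet_derivative (f \<circ> chart_inv c) (at (snd c p)) (v c))"

definition tangent_map ::
    "('p, 'e::euclidean_space) chart set \<Rightarrow> ('q, 'f::euclidean_space) chart set \<Rightarrow> ('p \<Rightarrow> 'q) \<Rightarrow>
     'p \<Rightarrow> ('p, 'e) tvec \<Rightarrow> ('q, 'f) tvec" where
  "tangent_map A B f p v =
     (\<lambda>d. if d \<in> B \<and> f p \<in> fst d then differential A (snd d \<circ> f) p v else 0)"

type_synonym ('p, 'e) vfield = "'p \<Rightarrow> ('p, 'e) tvec"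

definition Ck_vfield ::
    "('p, 'e::euclidean_space) chart set \<Rightarrow> nat \<Rightarrow> 'p set \<Rightarrow> ('p, 'e) vfield \<Rightarrow> bool" where
  "Ck_vfield A k W X \<longleftrightarrow>
     (\<forall>p\<in>W. X p \<in> tangent_space A p) \<and> (\<forall>c\<in>A. Ck_fun {c} k W (\<lambda>p. X p c))"

definition smooth_vfield ::
    "('p, 'e::euclidean_space) chart set \<Rightarrow> 'p set \<Rightarrow> ('p, 'e) vfield \<Rightarrow> bool" where
  "smooth_vfield A W X \<longleftrightarrow> (\<forall>k. Ck_vfield A k W X)"

definition local_extension ::
    "('p, 'e::euclidean_space) chart set \<Rightarrow> 'p \<Rightarrow> ('p, 'e) tvec \<Rightarrow> ('p, 'e) vfield \<Rightarrow> bool" where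
  "local_extension A p v X \<longleftrightarrow>
     (\<exists>W. openin (atlas_topology A) W \<and> p \<in> W \<and> smooth_vfield A W X) \<and> X p = v"

text \<open>\<open>[X,Y]\<^sup>i = X\<^sup>j \<partial>\<^sub>j Y\<^sup>i - Y\<^sup>j \<partial>\<^sub>j X\<^sup>i\<close> in every chart, so that \<open>[X,Y] f = X (Y f) - Y (X f)\<close>.\<close>

definition lie_bracket ::
    "('p, 'e::euclidean_space) chart set \<Rightarrow> ('p, 'e) vfield \<Rightarrow> ('p, 'e) vfield \<Rightarrow> ('p, 'e) vfield" where
  "lie_bracket A X Y p = (\<lambda>c. if c \<in> A \<and> p \<in> fst c
     then frechet_derivative (\<lambda>x. Y (chart_inv c x) c) (at (snd c p)) (X p c)
        - frechet_derivative (\<lambda>x. X (chart_inv c x) c) (at (snd c p)) (Y p c)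
     else 0)"

section \<open>Forms and vector 1-forms\<close>

type_synonym ('p, 'e) form1 = "'p \<Rightarrow> ('p, 'e) tvec \<Rightarrow> real"
type_synonym ('p, 'e) form2 = "'p \<Rightarrow> ('p, 'e) tvec \<Rightarrow> ('p, 'e) tvec \<Rightarrow> real"
type_synonym ('p, 'e) vform1 = "'p \<Rightarrow> ('p, 'e) tvec \<Rightarrow> ('p, 'e) tvec"

definition d_K ::
    "('p, 'e::euclidean_space) chart set \<Rightarrow> ('p, 'e) vform1 \<Rightarrow> ('p \<Rightarrow> real) \<Rightarrow> ('p, 'e) form1" where
  "d_K A K f p v = differential A f p (K p v)"

text \<open>The next two tensors are given by their values on vector fields,
  \<open>d\<beta>(X,Y) = X(\<beta> Y) - Y(\<beta> X) - \<beta>[X,Y]\<close> and \<open>[K,Y]X = [KX,Y] - K[X,Y]\<close>.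
  As the right-hand sides are tensorial, their values at \<open>p\<close> depend on the argument fields only
  through the vectors at \<open>p\<close>.\<close>

definition ext_deriv ::
    "('p, 'e::euclidean_space) chart set \<Rightarrow> ('p, 'e) form1 \<Rightarrow> ('p, 'e) form2" where
  "ext_deriv A \<beta> p v w = (THE r. \<forall>X Y. local_extension A p v X \<and> local_extension A p w Y \<longrightarrow>
     r = differential A (\<lambda>q. \<beta> q (Y q)) p (X p) - differential A (\<lambda>q. \<beta> q (X q)) p (Y p)
         - \<beta> p (lie_bracket A X Y p))"

definition fn_bracket ::
    "('p, 'e::euclidean_space) chart set \<Rightarrow> ('p, 'e) vform1 \<Rightarrow> ('p, 'e) vfield \<Rightarrow> ('p, 'e) vform1" where
  "fn_bracket A K Y p v = (THE w. \<forall>X. local_extension A p v X \<longrightarrow>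
     w = (\<lambda>c. lie_bracket A (\<lambda>q. K q (X q)) Y p c - K p (lie_bracket A X Y p) c))"

section \<open>The canonical objects of the tangent manifold\<close>

text \<open>In all that follows \<open>A\<close> is an atlas of \<open>M\<close>, and fields and forms live on \<open>TM\<close>. The vertical
  lift of \<open>v\<close> to \<open>q\<close> is the velocity at \<open>0\<close> of the curve \<open>t \<mapsto> q + t v\<close> in the fibre of \<open>q\<close>.\<close>

definition vertical_lift ::
    "('p, 'e::euclidean_space) chart set \<Rightarrow> ('p, 'e) tpoint \<Rightarrow> ('p, 'e) tvec \<Rightarrow>
     (('p, 'e) tpoint, 'e \<times> 'e) tvec" where
  "vertical_lift A q v = (\<lambda>d. if d \<in> tangent_atlas A \<and> q \<in> fst d
     then vector_derivative (\<lambda>t. snd d (fst q, \<lambda>c. snd q c + t *\<^sub>R v c)) (at 0) else 0)"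

definition liouville ::
    "('p, 'e::euclidean_space) chart set \<Rightarrow> (('p, 'e) tpoint, 'e \<times> 'e) vfield" where
  "liouville A q = vertical_lift A q (snd q)"

text \<open>\<open>J u\<close> is the vertical lift of the projection of \<open>u\<close> to \<open>M\<close>; in tangent charts
  \<open>J (a, b) = (0, a)\<close>.\<close>

definition vertical_endo ::
    "('p, 'e::euclidean_space) chart set \<Rightarrow> (('p, 'e) tpoint, 'e \<times> 'e) vform1" where
  "vertical_endo A q u = vertical_lift A q (tangent_map (tangent_atlas A) A fst q u)"

text \<open>The regularity is that of a semispray; fields smooth on all of \<open>TM\<close> are included. A field
  that is homogeneous of degree 2 and smooth also at the zero vectors would be quadratic on each
  fibre.\<close>

definition vertical_field ::
    "('p, 'e::euclidean_space) chart set \<Rightarrow> (('p, 'e) tpoint, 'e \<times> 'e) vfield \<Rightarrow> bool" where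
  "vertical_field A V \<longleftrightarrow>
     Ck_vfield (tangent_atlas A) 1 (TM A) V \<and>
     smooth_vfield (tangent_atlas A) (slit_TM A) V \<and>
     (\<forall>q\<in>TM A. tangent_map (tangent_atlas A) A fst q (V q) = (\<lambda>_. 0))"

definition homogeneous2 ::
    "('p, 'e::euclidean_space) chart set \<Rightarrow> (('p, 'e) tpoint, 'e \<times> 'e) vfield \<Rightarrow> bool" where
  "homogeneous2 A X \<longleftrightarrow>
     (\<forall>q\<in>TM A. lie_bracket (tangent_atlas A) (liouville A) X q = X q)"

text \<open>Everything required of a semispray except the \<open>C\<^sup>1\<close> property at the zero vectors. The
  field \<open>V_semispray A E V\<close> below has this property for every vertical \<open>V\<close>, but it need not be
  \<open>C\<^sup>1\<close> at the zero vectors: take a Randers norm on the plane and \<open>V\<close> with components linear in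
  the fibre coordinates.\<close>

definition slit_semispray ::
    "('p, 'e::euclidean_space) chart set \<Rightarrow> (('p, 'e) tpoint, 'e \<times> 'e) vfield \<Rightarrow> bool" where
  "slit_semispray A S \<longleftrightarrow>
     (\<forall>q\<in>TM A. S q \<in> tangent_space (tangent_atlas A) q) \<and>
     smooth_vfield (tangent_atlas A) (slit_TM A) S \<and>
     (\<forall>q\<in>TM A. vertical_endo A q (S q) = liouville A q)"

definition semispray ::
    "('p, 'e::euclidean_space) chart set \<Rightarrow> (('p, 'e) tpoint, 'e \<times> 'e) vfield \<Rightarrow> bool" where
  "semispray A S \<longleftrightarrow> Ck_vfield (tangent_atlas A) 1 (TM A) S \<and> slit_semispray A S"

definition spray ::
    "('p, 'e::euclidean_space) chart set \<Rightarrow> (('p, 'e) tpoint, 'e \<times> 'e) vfield \<Rightarrow> bool" where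
  "spray A S \<longleftrightarrow> semispray A S \<and> homogeneous2 A S"

definition ehresmann_generated ::
    "('p, 'e::euclidean_space) chart set \<Rightarrow> (('p, 'e) tpoint, 'e \<times> 'e) vfield \<Rightarrow>
     (('p, 'e) tpoint, 'e \<times> 'e) vform1" where
  "ehresmann_generated A S q u =
     (\<lambda>d. (1/2) *\<^sub>R (u d + fn_bracket (tangent_atlas A) (vertical_endo A) S q u d))"

section \<open>Finsler manifolds\<close>

definition fundamental_form ::
    "('p, 'e::euclidean_space) chart set \<Rightarrow> (('p, 'e) tpoint \<Rightarrow> real) \<Rightarrow>
     (('p, 'e) tpoint, 'e \<times> 'e) form2" where
  "fundamental_form A E =
     ext_deriv (tangent_atlas A) (d_K (tangent_atlas A) (vertical_endo A) E)"

definition finsler_energy ::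
    "('p, 'e::euclidean_space) chart set \<Rightarrow> (('p, 'e) tpoint \<Rightarrow> real) \<Rightarrow> bool" where
  "finsler_energy A E \<longleftrightarrow>
     (\<forall>p\<in>carrier A. E (p, \<lambda>_. 0) = 0) \<and>
     (\<forall>q\<in>slit_TM A. E q > 0) \<and>
     Ck_fun (tangent_atlas A) 1 (TM A) E \<and>
     (\<forall>k. Ck_fun (tangent_atlas A) k (slit_TM A) E) \<and>
     (\<forall>q\<in>TM A. differential (tangent_atlas A) E q (liouville A q) = 2 * E q) \<and>
     (\<forall>q\<in>slit_TM A. \<forall>u\<in>tangent_space (tangent_atlas A) q.
        (\<forall>w\<in>tangent_space (tangent_atlas A) q. fundamental_form A E q u w = 0) \<longrightarrow> u = (\<lambda>_. 0))"

text \<open>On the zero section, where the fundamental form need not exist, the field \<open>\<beta>\<^sup>#\<close> is set to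
  \<open>0\<close>; this is also the value required of the canonical spray there.\<close>

definition sharp ::
    "('p, 'e::euclidean_space) chart set \<Rightarrow> (('p, 'e) tpoint \<Rightarrow> real) \<Rightarrow>
     (('p, 'e) tpoint, 'e \<times> 'e) form1 \<Rightarrow> (('p, 'e) tpoint, 'e \<times> 'e) vfield" where
  "sharp A E \<beta> q = (if q \<in> slit_TM A
     then (THE u. u \<in> tangent_space (tangent_atlas A) q \<and>
             (\<forall>w\<in>tangent_space (tangent_atlas A) q. fundamental_form A E q u w = \<beta> q w))
     else (\<lambda>_. 0))"

definition canonical_spray ::
    "('p, 'e::euclidean_space) chart set \<Rightarrow> (('p, 'e) tpoint \<Rightarrow> real) \<Rightarrow>
     (('p, 'e) tpoint, 'e \<times> 'e) vfield" where
  "canonical_spray A E q = (\<lambda>d. - sharp A E (differential (tangent_atlas A) E) q d)"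

definition berwald_connection ::
    "('p, 'e::euclidean_space) chart set \<Rightarrow> (('p, 'e) tpoint \<Rightarrow> real) \<Rightarrow>
     (('p, 'e) tpoint, 'e \<times> 'e) vform1" where
  "berwald_connection A E = ehresmann_generated A (canonical_spray A E)"

definition L_ehresmann ::
    "('p, 'e::euclidean_space) chart set \<Rightarrow> (('p, 'e) tpoint \<Rightarrow> real) \<Rightarrow>
     (('p, 'e) tpoint, 'e \<times> 'e) vform1 \<Rightarrow> (('p, 'e) tpoint, 'e \<times> 'e) vform1" where
  "L_ehresmann A E L q u = (\<lambda>d. berwald_connection A E q u d + L q u d
     + fn_bracket (tangent_atlas A) (vertical_endo A) (sharp A E (d_K (tangent_atlas A) L E)) q u d)"

definition J_bracket ::
    "('p, 'e::euclidean_space) chart set \<Rightarrow> (('p, 'e) tpoint, 'e \<times> 'e) vfield \<Rightarrow>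
     (('p, 'e) tpoint, 'e \<times> 'e) vform1" where
  "J_bracket A V = fn_bracket (tangent_atlas A) (vertical_endo A) V"

definition V_semispray ::
    "('p, 'e::euclidean_space) chart set \<Rightarrow> (('p, 'e) tpoint \<Rightarrow> real) \<Rightarrow>
     (('p, 'e) tpoint, 'e \<times> 'e) vfield \<Rightarrow> (('p, 'e) tpoint, 'e \<times> 'e) vfield" where
  "V_semispray A E V q = (\<lambda>d. canonical_spray A E q d + 2 *\<^sub>R V q d
     + 2 *\<^sub>R sharp A E (d_K (tangent_atlas A) (J_bracket A V) E) q d)"

end

theory Submission
  imports Defs
begin

text \<open>All objects are read in the charts \<open>(x, y)\<close> of the tangent manifold that come from charts of
  the base. There \<open>J (a, b) = (0, a)\<close>, the Liouville field is \<open>(0, y)\<close>, and for every differentiable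
  field \<open>Y\<close> the bracket with \<open>J\<close> is \<open>[J, Y] u = DY (J u) - J (DY u)\<close>
  (lemma \<open>fn_bracket_vertical_endo\<close>). The bracket is linear in \<open>Y\<close>, so the first claim is the identity
  \<open>(id + [J, S0 + 2 V + 2 W]) / 2 = (id + [J, S0]) / 2 + [J, V] + [J, W]\<close> with \<open>W = (d\<^bsub>[J,V]\<^esub>E)\<^sup>#\<close>
  (lemma \<open>V_semispray_ehresmann\<close>). What has to be justified is that every term is defined, that is,
  that \<open>S0\<close> and \<open>W\<close> are smooth away from the zero section, and that the values do not depend on
  charts or on auxiliary extensions. Independence of the extensions comes from the fact that the Lie
  bracket of two fields is again a tangent vector, which is the symmetry of the second derivative of
  the coordinate changes.

  In a chart the fundamental form is \<open>\<omega> (u, w) = D\<^sup>2E (u, J w) - D\<^sup>2E (w, J u)\<close> (lemma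
  \<open>fundamental_form_chart\<close>). Hence \<open>\<beta>\<^sup>#\<close> is the solution of a linear system with smooth coefficients
  and is smooth when \<open>\<beta>\<close> is (lemma \<open>Ck_on_linear_system\<close>). Inserting vertical vectors into \<open>\<omega>\<close> shows
  that \<open>\<beta>\<^sup>#\<close> is vertical when \<open>\<beta>\<close> vanishes on vertical vectors; this applies to \<open>W\<close>. For \<open>\<beta> = dE\<close>
  Euler's relation turns the same computation into \<open>J S0 = C\<close>. So \<open>J (S0 + 2 V + 2 W) = C\<close>.

  For the last claim let \<open>m\<^sub>t (x, y) = (x, t y)\<close> with \<open>t > 0\<close>. Homogeneity of degree 2 of a field \<open>X\<close>
  means \<open>X (m\<^sub>t z) = t m\<^sub>t (X z)\<close>. From \<open>E (m\<^sub>t z) = t\<^sup>2 E z\<close> one gets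
  \<open>\<omega> (m\<^sub>t u, m\<^sub>t w) = t \<omega> (u, w)\<close>, and if \<open>V\<close> is homogeneous then both \<open>dE\<close> and \<open>d\<^bsub>[J,V]\<^esub>E\<close> scale by
  \<open>t\<^sup>2\<close>. As the linear system has only one solution, \<open>S0\<close> and \<open>W\<close> scale like \<open>V\<close>. Finally a map that
  is homogeneous of degree 2 in \<open>y\<close> and smooth for \<open>y \<noteq> 0\<close> is \<open>C\<^sup>1\<close> at \<open>y = 0\<close>, because it is
  \<open>O(|y|\<^sup>2)\<close> and its derivative is \<open>O(|y|)\<close> (lemma \<open>homogeneous_Ck_1_at_zero\<close>); this gives the
  regularity of the spray on the whole tangent manifold.\<close>

section \<open>Derivatives\<close>

abbreviation D :: "('a::real_normed_vector \<Rightarrow> 'b::real_normed_vector) \<Rightarrow> 'a \<Rightarrow> 'a \<Rightarrow> 'b" where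
  "D f x \<equiv> frechet_derivative f (at x)"

lemma D_works: "f differentiable (at x) \<Longrightarrow> (f has_derivative D f x) (at x)"
  by (simp add: frechet_derivative_works)

lemma D_eq: "(f has_derivative f') (at x) \<Longrightarrow> D f x = f'"
  by (rule frechet_derivative_at[symmetric])

text \<open>The choice hidden in \<open>frechet_derivative\<close> sees only the set of derivatives at \<open>x\<close>, so equality near
  \<open>x\<close> is enough, even where no derivative exists.\<close>

lemma D_cong:
  assumes "open U" "x \<in> U" "\<And>z. z \<in> U \<Longrightarrow> f z = g z"
  shows "D f x = D g x"
proof -
  have "(f has_derivative f') (at x) \<longleftrightarrow> (g has_derivative f') (at x)" for f'
    using assms has_derivative_transform_within_open[of f f' x UNIV U g]
      has_derivative_transform_within_open[of g f' x UNIV U f] by auto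
  then show ?thesis
    by (simp add: frechet_derivative_def)
qed

lemma differentiable_cong_open:
  assumes "open U" "x \<in> U" "\<And>z. z \<in> U \<Longrightarrow> f z = g z" "f differentiable (at x)"
  shows "g differentiable (at x)"
  using assms has_derivative_transform_within_open[of f _ x UNIV U g]
  unfolding differentiable_def by blast

lemma linear_D: "f differentiable (at x) \<Longrightarrow> linear (D f x)"
  by (rule linear_frechet_derivative)

lemma D_comp:
  assumes "f differentiable (at x)" "g differentiable (at (f x))"
  shows "D (\<lambda>x. g (f x)) x = (\<lambda>v. D g (f x) (D f x v))"
  using has_derivative_compose[OF D_works[OF assms(1)] D_works[OF assms(2)]]
  by (rule D_eq)

lemma differentiable_comp:
  assumes "f differentiable (at x)" "g differentiable (at (f x))"
  shows "(\<lambda>x. g (f x)) differentiable (at x)"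
  using has_derivative_compose[OF D_works[OF assms(1)] D_works[OF assms(2)]]
  by (rule differentiableI)

lemma D_add: "f differentiable (at x) \<Longrightarrow> g differentiable (at x)
   \<Longrightarrow> D (\<lambda>x. f x + g x) x = (\<lambda>v. D f x v + D g x v)"
  by (intro D_eq has_derivative_add D_works)

lemma D_bounded_linear:
  assumes "bounded_linear L" "f differentiable (at x)"
  shows "D (\<lambda>x. L (f x)) x = (\<lambda>v. L (D f x v))"
  by (intro D_eq bounded_linear.has_derivative[OF assms(1)] D_works assms)

lemma differentiable_bounded_linear:
  assumes "bounded_linear L" "f differentiable (at x)"
  shows "(\<lambda>x. L (f x)) differentiable (at x)"
  using bounded_linear.has_derivative[OF assms(1) D_works[OF assms(2)]] by (rule differentiableI)

section \<open>Maps of class \<open>C\<^sup>k\<close>\<close>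

text \<open>Both the differentiability and the values of \<open>D f\<close> at a point depend on a neighbourhood, hence the
  assumption that \<open>U\<close> is open. The lemma is used to pass from the derivative of a composite map to
  the formula for it.\<close>

lemma Ck_on_cong:
  assumes "open U" "\<And>x. x \<in> U \<Longrightarrow> f x = g x"
  shows "Ck_on k f U \<longleftrightarrow> Ck_on k g U"
  using assms(2)
proof (induction k arbitrary: f g)
  case 0
  then show ?case by (auto cong: continuous_on_cong)
next
  case (Suc k)
  have "f differentiable (at x) \<longleftrightarrow> g differentiable (at x)" if "x \<in> U" for x
    using differentiable_cong_open[OF assms(1) that, of f g]
      differentiable_cong_open[OF assms(1) that, of g f] Suc.prems by auto
  moreover have "Ck_on k (\<lambda>x. D f x v) U \<longleftrightarrow> Ck_on k (\<lambda>x. D g x v) U" for v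
    by (intro Suc.IH) (simp add: D_cong[OF assms(1) _ Suc.prems])
  ultimately show ?case by simp
qed

lemma Ck_on_continuous_on: "Ck_on k f U \<Longrightarrow> continuous_on U f"
proof (cases k)
  case (Suc j)
  moreover assume "Ck_on k f U"
  ultimately show ?thesis
    by (intro continuous_at_imp_continuous_on ballI differentiable_imp_continuous_within) simp
qed simp

lemma Ck_on_Suc_imp: "Ck_on (Suc k) f U \<Longrightarrow> Ck_on k f U"
proof (induction k arbitrary: f)
  case 0
  show ?case using Ck_on_continuous_on[OF 0] by simp
next
  case (Suc k)
  then show ?case by (metis Ck_on.simps(2))
qed

lemma Ck_on_differentiable: "Ck_on (Suc k) f U \<Longrightarrow> x \<in> U \<Longrightarrow> f differentiable (at x)"
  by simp

lemma Ck_on_D: "Ck_on (Suc k) f U \<Longrightarrow> Ck_on k (\<lambda>x. D f x v) U"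
  by simp

lemma Ck_on_const [simp]: "Ck_on k (\<lambda>_. c) U"
  by (induction k arbitrary: c) auto

lemma Ck_on_bounded_linear:
  assumes "bounded_linear L" "open U" "Ck_on k f U"
  shows "Ck_on k (\<lambda>x. L (f x)) U"
  using assms(3)
proof (induction k arbitrary: f)
  case 0
  then show ?case
    using assms(1) by (simp add: bounded_linear.continuous_on)
next
  case (Suc k)
  have "Ck_on k (\<lambda>x. D (\<lambda>x. L (f x)) x v) U \<longleftrightarrow> Ck_on k (\<lambda>x. L (D f x v)) U" for v
    using Suc.prems by (intro Ck_on_cong[OF assms(2)]) (simp add: D_bounded_linear[OF assms(1)])
  then show ?case
    using Suc by (simp add: differentiable_bounded_linear[OF assms(1)])
qed

lemma Ck_on_add:
  assumes "open U" "Ck_on k f U" "Ck_on k g U"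
  shows "Ck_on k (\<lambda>x. f x + g x) U"
  using assms(2,3)
proof (induction k arbitrary: f g)
  case 0
  then show ?case by (simp add: continuous_on_add)
next
  case (Suc k)
  have "Ck_on k (\<lambda>x. D (\<lambda>x. f x + g x) x v) U \<longleftrightarrow> Ck_on k (\<lambda>x. D f x v + D g x v) U" for v
    using Suc.prems by (intro Ck_on_cong[OF assms(1)]) (simp add: D_add)
  then show ?case
    using Suc by (simp add: differentiable_add)
qed

lemma Ck_on_sum:
  assumes "open U" "finite I" "\<And>i. i \<in> I \<Longrightarrow> Ck_on k (f i) U"
  shows "Ck_on k (\<lambda>x. \<Sum>i\<in>I. f i x) U"
  using assms(2,3) by (induction I rule: finite_induct) (auto intro!: Ck_on_add assms(1))

lemma Ck_on_bilinear:
  assumes "bounded_bilinear h" "open U" "Ck_on k f U" "Ck_on k g U"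
  shows "Ck_on k (\<lambda>x. h (f x) (g x)) U"
  using assms(3,4)
proof (induction k arbitrary: f g)
  case 0
  then show ?case
    using assms(1) by (simp add: bounded_bilinear.continuous_on)
next
  case (Suc k)
  have d: "((\<lambda>x. h (f x) (g x)) has_derivative (\<lambda>v. h (f x) (D g x v) + h (D f x v) (g x))) (at x)"
    if "x \<in> U" for x
    using Suc.prems that by (intro bounded_bilinear.FDERIV[OF assms(1)] D_works) auto
  have "Ck_on k (\<lambda>x. D (\<lambda>x. h (f x) (g x)) x v) U
    \<longleftrightarrow> Ck_on k (\<lambda>x. h (f x) (D g x v) + h (D f x v) (g x)) U" for v
    by (intro Ck_on_cong[OF assms(2)]) (simp add: D_eq[OF d])
  moreover have "Ck_on k (\<lambda>x. h (f x) (D g x v) + h (D f x v) (g x)) U" for v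
    using Suc.prems Suc.prems[THEN Ck_on_Suc_imp] by (intro Ck_on_add assms(2) Suc.IH) simp_all
  ultimately show ?case
    using d by (auto intro: differentiableI)
qed

lemma Ck_on_scaleR:
  "open U \<Longrightarrow> Ck_on k f U \<Longrightarrow> Ck_on k g U \<Longrightarrow> Ck_on k (\<lambda>x. f x *\<^sub>R g x) U"
  by (rule Ck_on_bilinear[OF bounded_bilinear_scaleR])

lemma Ck_on_inner_const: "open U \<Longrightarrow> Ck_on k f U \<Longrightarrow> Ck_on k (\<lambda>x. f x \<bullet> i) U"
  by (rule Ck_on_bounded_linear[OF bounded_linear_inner_left])

lemma Ck_on_Pair:
  assumes "open U" "Ck_on k f U" "Ck_on k g U"
  shows "Ck_on k (\<lambda>x. (f x, g x)) U"
proof -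
  have "Ck_on k (\<lambda>x. (f x, 0) + (0, g x)) U"
    by (intro Ck_on_add Ck_on_bounded_linear[of "\<lambda>a. (a, 0)"] Ck_on_bounded_linear[of "\<lambda>a. (0, a)"]
        assms bounded_linear_Pair bounded_linear_ident bounded_linear_zero)
  then show ?thesis by simp
qed

lemma Ck_on_ident: "open U \<Longrightarrow> Ck_on k (\<lambda>x. x) U"
  by (cases k) (auto simp: continuous_on_id)

lemma Ck_on_linear:
  fixes L :: "'a::euclidean_space \<Rightarrow> 'b::real_normed_vector"
  assumes "open U" "linear L" shows "Ck_on k L U"
  using Ck_on_bounded_linear[of L U k "\<lambda>x. x"] assms Ck_on_ident linear_conv_bounded_linear by blast

lemma linear_expand:
  fixes L :: "'a::euclidean_space \<Rightarrow> 'b::real_vector"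
  assumes "linear L" shows "L u = (\<Sum>i\<in>Basis. (u \<bullet> i) *\<^sub>R L i)"
  using assms by (metis (no_types, lifting) euclidean_representation linear_scale linear_sum sum.cong)

text \<open>A family of linear maps is of class \<open>C\<^sup>k\<close> if it is so pointwise, because in coordinates
  \<open>B x u = \<Sum>i. (u \<bullet> i) B x i\<close> involves finitely many vectors only. This makes it possible to avoid
  spaces of bounded linear maps throughout.\<close>

lemma Ck_on_linear_apply:
  fixes B :: "'a::euclidean_space \<Rightarrow> 'b::euclidean_space \<Rightarrow> 'c::real_normed_vector"
  assumes "open U" "\<And>x. x \<in> U \<Longrightarrow> linear (B x)" "\<And>v. Ck_on k (\<lambda>x. B x v) U" "Ck_on k f U"
  shows "Ck_on k (\<lambda>x. B x (f x)) U"
proof -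
  have "Ck_on k (\<lambda>x. \<Sum>i\<in>Basis. (f x \<bullet> i) *\<^sub>R B x i) U"
    by (intro Ck_on_sum Ck_on_scaleR Ck_on_inner_const assms) auto
  then show ?thesis
    using Ck_on_cong[OF assms(1), of "\<lambda>x. B x (f x)" "\<lambda>x. \<Sum>i\<in>Basis. (f x \<bullet> i) *\<^sub>R B x i" k]
      linear_expand[OF assms(2)] by blast
qed

text \<open>The product rule for \<open>B x (f x)\<close>; the first summand differentiates \<open>B\<close> with the argument frozen
  at \<open>f x\<close>.\<close>

lemma has_derivative_linear_apply:
  fixes B :: "'a::euclidean_space \<Rightarrow> 'b::euclidean_space \<Rightarrow> 'c::real_normed_vector"
  assumes "open U" "x \<in> U" "\<And>x. x \<in> U \<Longrightarrow> linear (B x)"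
    "\<And>v. (\<lambda>x. B x v) differentiable (at x)" "f differentiable (at x)"
  shows "((\<lambda>x. B x (f x)) has_derivative (\<lambda>h. D (\<lambda>z. B z (f x)) x h + B x (D f x h))) (at x)"
proof -
  have lin: "B z u = (\<Sum>i\<in>Basis. (u \<bullet> i) *\<^sub>R B z i)" if "z \<in> U" for z u
    by (rule linear_expand[OF assms(3)[OF that]])
  have D1: "D (\<lambda>z. B z u) x h = (\<Sum>i\<in>Basis. (u \<bullet> i) *\<^sub>R D (\<lambda>z. B z i) x h)" for u h
  proof -
    have "((\<lambda>z. \<Sum>i\<in>Basis. (u \<bullet> i) *\<^sub>R B z i) has_derivative
       (\<lambda>h. \<Sum>i\<in>Basis. (u \<bullet> i) *\<^sub>R D (\<lambda>z. B z i) x h)) (at x)"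
      by (intro has_derivative_sum has_derivative_scaleR_right D_works assms)
    then show ?thesis
      using D_cong[OF assms(1,2), of "\<lambda>z. B z u" "\<lambda>z. \<Sum>i\<in>Basis. (u \<bullet> i) *\<^sub>R B z i"] lin
      by (metis (no_types, lifting) D_eq)
  qed
  have "((\<lambda>z. \<Sum>i\<in>Basis. (f z \<bullet> i) *\<^sub>R B z i) has_derivative
       (\<lambda>h. \<Sum>i\<in>Basis. (f x \<bullet> i) *\<^sub>R D (\<lambda>z. B z i) x h + (D f x h \<bullet> i) *\<^sub>R B x i)) (at x)"
    by (intro has_derivative_sum has_derivative_scaleR has_derivative_inner_left D_works assms)
  then have "((\<lambda>z. \<Sum>i\<in>Basis. (f z \<bullet> i) *\<^sub>R B z i) has_derivative
      (\<lambda>h. D (\<lambda>z. B z (f x)) x h + B x (D f x h))) (at x)"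
    unfolding D1[of "f x"] lin[OF assms(2), of "D f x h" for h] sum.distrib .
  then show ?thesis
    by (rule has_derivative_transform_within_open[OF _ assms(1,2)]) (rule lin[symmetric])
qed

lemma Ck_on_compose:
  fixes f :: "'a::euclidean_space \<Rightarrow> 'b::euclidean_space" and g :: "'b \<Rightarrow> 'c::real_normed_vector"
  assumes "open U" "open V" "f ` U \<subseteq> V" "Ck_on k f U" "Ck_on k g V"
  shows "Ck_on k (\<lambda>x. g (f x)) U"
  using assms(4,5)
proof (induction k arbitrary: g)
  case 0
  then show ?case using assms(3) by (auto intro: continuous_on_compose2)
next
  case (Suc k)
  have df: "f differentiable (at x)" "g differentiable (at (f x))" if "x \<in> U" for x
    using Suc.prems assms(3) that by auto
  have "Ck_on k (\<lambda>x. D (\<lambda>x. g (f x)) x v) U \<longleftrightarrow> Ck_on k (\<lambda>x. D g (f x) (D f x v)) U" for v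
    by (intro Ck_on_cong assms) (simp add: D_comp df)
  moreover have "Ck_on k (\<lambda>x. D g (f x) (D f x v)) U" for v
    using Suc.prems Suc.IH[of "\<lambda>x. D g x w" for w] Suc.prems[THEN Ck_on_Suc_imp]
    by (intro Ck_on_linear_apply[of U "\<lambda>x. D g (f x)" k "\<lambda>x. D f x v"] assms(1)) (simp_all add: linear_D df)
  ultimately show ?case
    using df by (auto intro: differentiable_comp)
qed

section \<open>Linear systems\<close>

text \<open>The solution of \<open>B x (u x) = b x\<close> inherits continuity and differentiability from the data. With a
  left inverse \<open>P\<close> of \<open>B x0\<close> the system reads
  \<open>u x - u x0 = P ((b x - b x0) - (B x - B x0) (u x))\<close>. As \<open>B x - B x0\<close> is small, its contribution is
  absorbed on the left, which gives continuity. Then \<open>(B x - B x0) (u x)\<close> is a sum of products of a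
  continuous function and a differentiable one that vanishes at \<open>x0\<close>, and such a product is
  differentiable at \<open>x0\<close>.\<close>

lemma linear_system_solution:
  fixes B :: "'a::euclidean_space \<Rightarrow> 'b::euclidean_space \<Rightarrow> 'b" and u :: "'a \<Rightarrow> 'b"
  assumes "open U" "x0 \<in> U" "\<And>x. x \<in> U \<Longrightarrow> linear (B x)" "inj (B x0)"
    and sys: "\<And>x. x \<in> U \<Longrightarrow> B x (u x) = b x"
    and cB: "\<And>v. continuous (at x0) (\<lambda>x. B x v)" and cb: "continuous (at x0) b"
  shows "continuous (at x0) u"
    and "\<lbrakk>\<And>v. (\<lambda>x. B x v) differentiable (at x0); b differentiable (at x0)\<rbrakk> \<Longrightarrow>
      \<exists>P. linear P \<and> (\<forall>w. P (B x0 w) = w) \<and>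
        (u has_derivative (\<lambda>h. P (D b x0 h - D (\<lambda>x. B x (u x0)) x0 h))) (at x0)"
proof -
  obtain P where P: "linear P" "\<And>w. P (B x0 w) = w"
    using linear_injective_left_inverse[OF assms(3)[OF assms(2)] assms(4)] by (metis comp_apply id_apply)
  have bP: "bounded_linear P"
    using P(1) linear_conv_bounded_linear by blast
  obtain K where K: "K > 0" "\<And>w. norm (P w) \<le> K * norm w"
    using bounded_linear.pos_bounded[OF bP] by (metis mult.commute)
  \<comment> \<open>A bound for the operator norm of \<open>B x - B x0\<close>.\<close>
  define e where "e x = (\<Sum>i\<in>Basis. norm (B x i - B x0 i))" for x
  have diff: "B x w - B x0 w = (\<Sum>i\<in>Basis. (w \<bullet> i) *\<^sub>R (B x i - B x0 i))" if "x \<in> U" for x w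
    using linear_expand[OF assms(3)[OF that], of w] linear_expand[OF assms(3)[OF assms(2)], of w]
    by (simp add: scaleR_diff_right sum_subtractf)
  have eB: "norm (B x w - B x0 w) \<le> e x * norm w" if "x \<in> U" for x w
    unfolding diff[OF that, of w] e_def sum_distrib_right
    by (rule sum_norm_le) (metis Basis_le_norm mult.commute mult_left_mono norm_ge_zero norm_scaleR)
  have eq: "u x - u x0 = P ((b x - b x0) - (B x (u x) - B x0 (u x)))" if "x \<in> U" for x
  proof -
    have "(b x - b x0) - (B x (u x) - B x0 (u x)) = B x0 (u x) - B x0 (u x0)"
      using sys[OF that] sys[OF assms(2)] by simp
    then have "P ((b x - b x0) - (B x (u x) - B x0 (u x))) = P (B x0 (u x) - B x0 (u x0))"
      by (rule arg_cong)
    then show ?thesis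
      by (simp only: linear_diff[OF P(1), of "B x0 (u x)"] P(2))
  qed
  have e0: "(e \<longlongrightarrow> 0) (at x0)"
  proof -
    have "(e \<longlongrightarrow> (\<Sum>i\<in>(Basis::'b set). norm (B x0 i - B x0 i))) (at x0)"
      unfolding e_def using cB by (intro tendsto_intros) (simp add: continuous_at)
    then show ?thesis by simp
  qed
  have evU: "\<forall>\<^sub>F x in at x0. x \<in> U"
    using assms(1,2) eventually_at_topological by blast
  have bd: "\<forall>\<^sub>F x in at x0. norm (u x - u x0) \<le> 2 * K * (norm (b x - b x0) + e x * norm (u x0))"
  proof -
    have "\<forall>\<^sub>F x in at x0. e x < 1 / (2 * K)"
      using e0 K(1) by (intro order_tendstoD) auto
    with evU show ?thesis
    proof eventually_elim
      case (elim x)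
      have "norm (u x) \<le> norm (u x - u x0) + norm (u x0)"
        by (metis diff_add_cancel norm_triangle_ineq)
      have "e x \<ge> 0" by (simp add: e_def sum_nonneg)
      have "norm (u x - u x0) \<le> K * (norm (b x - b x0) + e x * norm (u x))"
      proof -
        have "norm ((b x - b x0) - (B x (u x) - B x0 (u x))) \<le> norm (b x - b x0) + e x * norm (u x)"
          using eB[OF elim(1), of "u x"] norm_triangle_ineq4[of "b x - b x0" "B x (u x) - B x0 (u x)"] by linarith
        then show ?thesis
          using K(2)[of "(b x - b x0) - (B x (u x) - B x0 (u x))"] K(1) eq[OF elim(1)]
          by (metis mult_le_cancel_left_pos order_trans)
      qed
      also have "\<dots> \<le> K * (norm (b x - b x0) + e x * (norm (u x - u x0) + norm (u x0)))"
        using K(1) \<open>e x \<ge> 0\<close> \<open>norm (u x) \<le> _\<close> by (intro mult_left_mono add_left_mono) auto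
      also have "\<dots> = K * e x * norm (u x - u x0) + K * (norm (b x - b x0) + e x * norm (u x0))"
        by (simp add: algebra_simps)
      also have "K * e x * norm (u x - u x0) \<le> 1/2 * norm (u x - u x0)"
        using elim(2) K(1) by (intro mult_right_mono) (auto simp: field_simps)
      finally show ?case by simp
    qed
  qed
  have "((\<lambda>x. u x - u x0) \<longlongrightarrow> 0) (at x0)"
  proof (rule Lim_null_comparison[OF bd])
    have "((\<lambda>x. 2 * K * (norm (b x - b x0) + e x * norm (u x0))) \<longlongrightarrow>
       2 * K * (norm (b x0 - b x0) + 0 * norm (u x0))) (at x0)"
      using cb by (intro tendsto_intros e0) (simp add: continuous_at)
    then show "((\<lambda>x. 2 * K * (norm (b x - b x0) + e x * norm (u x0))) \<longlongrightarrow> 0) (at x0)" by simp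
  qed
  then show cu: "continuous (at x0) u"
    by (simp add: continuous_at LIM_zero_iff)
  assume dB: "\<And>v. (\<lambda>x. B x v) differentiable (at x0)" and db: "b differentiable (at x0)"
  have D1: "D (\<lambda>x. B x w) x0 h = (\<Sum>i\<in>Basis. (w \<bullet> i) *\<^sub>R D (\<lambda>x. B x i) x0 h)" for w h
  proof -
    have "((\<lambda>z. \<Sum>i\<in>Basis. (w \<bullet> i) *\<^sub>R B z i) has_derivative
       (\<lambda>h. \<Sum>i\<in>Basis. (w \<bullet> i) *\<^sub>R D (\<lambda>z. B z i) x0 h)) (at x0)"
      by (intro has_derivative_sum has_derivative_scaleR_right D_works dB)
    then show ?thesis
      using D_cong[OF assms(1,2), of "\<lambda>z. B z w" "\<lambda>z. \<Sum>i\<in>Basis. (w \<bullet> i) *\<^sub>R B z i"]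
        linear_expand[OF assms(3)] by (metis (no_types, lifting) D_eq)
  qed
  \<comment> \<open>At a zero of the second factor, continuity of the first one suffices.\<close>
  have prod: "((\<lambda>x. c x *\<^sub>R (f x - f x0)) has_derivative (\<lambda>h. c x0 *\<^sub>R D f x0 h)) (at x0)"
    if c: "continuous (at x0) c" and f: "f differentiable (at x0)" for c :: "'a \<Rightarrow> real" and f :: "'a \<Rightarrow> 'b"
  proof -
    obtain L where L: "L > 0" "\<And>h. norm (D f x0 h) \<le> L * norm h"
      using bounded_linear.pos_bounded[OF has_derivative_bounded_linear[OF D_works[OF f]]] by (metis mult.commute)
    have f1: "((\<lambda>x. (f x - f x0 - D f x0 (x - x0)) /\<^sub>R norm (x - x0)) \<longlongrightarrow> 0) (at x0)"
      using D_works[OF f] by (simp add: has_derivative_at_within)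
    have "((\<lambda>x. c x *\<^sub>R ((f x - f x0 - D f x0 (x - x0)) /\<^sub>R norm (x - x0))
        + (c x - c x0) *\<^sub>R (D f x0 (x - x0) /\<^sub>R norm (x - x0))) \<longlongrightarrow> c x0 *\<^sub>R 0 + 0) (at x0)"
    proof (intro tendsto_add tendsto_scaleR f1)
      show "(c \<longlongrightarrow> c x0) (at x0)" using c by (simp add: continuous_at)
      then have c0: "((\<lambda>x. L * \<bar>c x - c x0\<bar>) \<longlongrightarrow> 0) (at x0)"
        by (intro tendsto_mult_right_zero tendsto_rabs_zero) (simp add: LIM_zero_iff)
      show "((\<lambda>x. (c x - c x0) *\<^sub>R (D f x0 (x - x0) /\<^sub>R norm (x - x0))) \<longlongrightarrow> 0) (at x0)"
      proof (rule Lim_null_comparison[OF _ c0], rule always_eventually, rule allI)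
        fix x
        have "norm (D f x0 (x - x0) /\<^sub>R norm (x - x0)) \<le> L"
          using L(2)[of "x - x0"] L(1) by (cases "x = x0") (auto simp: divide_simps)
        then show "norm ((c x - c x0) *\<^sub>R (D f x0 (x - x0) /\<^sub>R norm (x - x0))) \<le> L * \<bar>c x - c x0\<bar>"
          unfolding norm_scaleR[of "c x - c x0"] mult.commute[of L] by (rule mult_left_mono) simp
      qed
    qed
    then have "((\<lambda>x. (c x *\<^sub>R (f x - f x0) - c x0 *\<^sub>R (f x0 - f x0) - c x0 *\<^sub>R D f x0 (x - x0)) /\<^sub>R norm (x - x0)) \<longlongrightarrow> c x0 *\<^sub>R 0 + 0) (at x0)"
      by (rule tendsto_cong[THEN iffD1, rotated]) (auto simp: algebra_simps)
    then show ?thesis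
      using bounded_linear_const_scaleR[OF has_derivative_bounded_linear[OF D_works[OF f]], of "c x0"]
      by (simp add: has_derivative_at_within)
  qed
  have "((\<lambda>x. \<Sum>i\<in>Basis. (u x \<bullet> i) *\<^sub>R (B x i - B x0 i)) has_derivative
     (\<lambda>h. D (\<lambda>x. B x (u x0)) x0 h)) (at x0)"
    unfolding D1[of "u x0"] by (intro has_derivative_sum prod dB continuous_inner cu continuous_const)
  then have "((\<lambda>x. B x (u x) - B x0 (u x)) has_derivative (\<lambda>h. D (\<lambda>x. B x (u x0)) x0 h)) (at x0)"
    by (rule has_derivative_transform_within_open[OF _ assms(1,2)]) (rule diff[symmetric])
  then have "((\<lambda>x. (b x - b x0) - (B x (u x) - B x0 (u x))) has_derivative
     (\<lambda>h. (D b x0 h - 0) - D (\<lambda>x. B x (u x0)) x0 h)) (at x0)"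
    by (intro has_derivative_diff D_works db has_derivative_const)
  then have "((\<lambda>x. u x0 + P ((b x - b x0) - (B x (u x) - B x0 (u x)))) has_derivative
     (\<lambda>h. 0 + P ((D b x0 h - 0) - D (\<lambda>x. B x (u x0)) x0 h))) (at x0)"
    by (intro has_derivative_add has_derivative_const bounded_linear.has_derivative[OF bP])
  then have "(u has_derivative (\<lambda>h. 0 + P ((D b x0 h - 0) - D (\<lambda>x. B x (u x0)) x0 h))) (at x0)"
    by (rule has_derivative_transform_within_open[OF _ assms(1,2)]) (simp flip: eq)
  then show "\<exists>P. linear P \<and> (\<forall>w. P (B x0 w) = w) \<and>
        (u has_derivative (\<lambda>h. P (D b x0 h - D (\<lambda>x. B x (u x0)) x0 h))) (at x0)"
    using P by auto
qed

text \<open>Induction on \<open>k\<close>: differentiating the system shows that \<open>D u x h\<close> solves a system with the same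
  \<open>B\<close> and the right-hand side \<open>D b x h - (D B x h) (u x)\<close>, which is one order less regular.\<close>

lemma Ck_on_linear_system:
  fixes B :: "'a::euclidean_space \<Rightarrow> 'b::euclidean_space \<Rightarrow> 'b" and u :: "'a \<Rightarrow> 'b"
  assumes "open U" and lin: "\<And>x. x \<in> U \<Longrightarrow> linear (B x)" and inj: "\<And>x. x \<in> U \<Longrightarrow> inj (B x)"
    and "\<And>x. x \<in> U \<Longrightarrow> B x (u x) = b x" "\<And>v. Ck_on k (\<lambda>x. B x v) U" "Ck_on k b U"
  shows "Ck_on k u U"
  using assms(4-6)
proof (induction k arbitrary: u b)
  case 0
  have "continuous (at x) u" if "x \<in> U" for x
    using 0 that assms(1)
    by (intro linear_system_solution(1)[OF assms(1) that, of B u b] lin inj)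
      (auto simp: continuous_on_eq_continuous_at)
  then show ?case by (simp add: continuous_at_imp_continuous_on)
next
  case (Suc k)
  have d: "\<exists>P. linear P \<and> (\<forall>w. P (B x w) = w) \<and>
        (u has_derivative (\<lambda>h. P (D b x h - D (\<lambda>z. B z (u x)) x h))) (at x)" if "x \<in> U" for x
    using Suc.prems that
    by (intro linear_system_solution(2)[OF assms(1) that] lin inj)
      (auto intro: differentiable_imp_continuous_within)
  have du: "u differentiable (at x)" if "x \<in> U" for x
    using d[OF that] by (auto intro: differentiableI)
  have eq: "B x (D u x h) = D b x h - D (\<lambda>z. B z (u x)) x h" if x: "x \<in> U" for x h
  proof -
    obtain P where P: "\<And>w. P (B x w) = w" "D u x = (\<lambda>h. P (D b x h - D (\<lambda>z. B z (u x)) x h))"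
      using d[OF x] D_eq[of u _ x] by metis
    then show ?thesis
      using linear_injective_imp_surjective[OF lin[OF x] inj[OF x]] by (metis surjD)
  qed
  have low: "Ck_on k u U"
    using Suc.prems by (intro Suc.IH[of u b]) (auto simp del: Ck_on.simps dest: Ck_on_Suc_imp)
  have "Ck_on k (\<lambda>x. D u x h) U" for h
  proof (rule Suc.IH[OF eq])
    show "Ck_on k (\<lambda>x. B x v) U" for v by (rule Ck_on_Suc_imp[OF Suc.prems(2)])
    have l: "linear (\<lambda>w. D (\<lambda>z. B z w) x h)" if "x \<in> U" for x
    proof -
      have B: "(\<lambda>x. B x w) differentiable (at x)" for w
        using Suc.prems(2) that by simp
      have 1: "D (\<lambda>z. B z (w + w')) x = D (\<lambda>z. B z w + B z w') x" for w w'
        by (rule D_cong[OF assms(1) that]) (simp add: lin linear_add)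
      have 2: "D (\<lambda>z. B z (c *\<^sub>R w)) x = D (\<lambda>z. c *\<^sub>R B z w) x" for w c
        by (rule D_cong[OF assms(1) that]) (simp add: lin linear_scale)
      show ?thesis
        by (intro linearI) (simp_all add: 1 2 B D_add D_bounded_linear[OF bounded_linear_scaleR_right])
    qed
    have "Ck_on k (\<lambda>x. D (\<lambda>z. B z (u x)) x h) U"
      using Suc.prems(2) by (intro Ck_on_linear_apply[of U "\<lambda>x w. D (\<lambda>z. B z w) x h" k u] assms(1) l low) auto
    then have "Ck_on k (\<lambda>x. - D (\<lambda>z. B z (u x)) x h) U"
      by (rule Ck_on_bounded_linear[OF bounded_linear_minus[OF bounded_linear_ident] assms(1)])
    then have "Ck_on k (\<lambda>x. D b x h + - D (\<lambda>z. B z (u x)) x h) U"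
      using Suc.prems(3) by (intro Ck_on_add assms(1)) auto
    then show "Ck_on k (\<lambda>x. D b x h - D (\<lambda>z. B z (u x)) x h) U"
      by simp
  qed
  then show ?case using du by simp
qed

section \<open>Symmetry of second derivatives\<close>

text \<open>The mean value theorem, used first along \<open>u\<close> for the increment along \<open>v\<close> and then along \<open>v\<close>, writes the
  second difference through the mixed derivative at some point of the parallelogram.\<close>

lemma second_difference:
  fixes f :: "'a::euclidean_space \<Rightarrow> real"
  assumes "open U" "Ck_on 2 f U" "h > 0"
    and in_U: "\<And>s t. \<lbrakk>0 \<le> s; s \<le> h; 0 \<le> t; t \<le> h\<rbrakk> \<Longrightarrow> x + s *\<^sub>R u + t *\<^sub>R v \<in> U"
  shows "\<exists>s t. 0 \<le> s \<and> s \<le> h \<and> 0 \<le> t \<and> t \<le> h \<and>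
    f (x + h *\<^sub>R u + h *\<^sub>R v) - f (x + h *\<^sub>R u) - f (x + h *\<^sub>R v) + f x
      = h * h * D (\<lambda>z. D f z u) (x + s *\<^sub>R u + t *\<^sub>R v) v"
proof -
  have C1: "f differentiable (at z)" "(\<lambda>z. D f z u) differentiable (at z)" if "z \<in> U" for z
    using assms(2) that by (auto simp: numeral_2_eq_2)
  have ray: "((\<lambda>s. g (a + s *\<^sub>R w)) has_real_derivative D g (a + s *\<^sub>R w) w) (at s)"
    if "g differentiable (at (a + s *\<^sub>R w))" for g :: "'a \<Rightarrow> real" and a w s
  proof -
    have "((\<lambda>s. g (a + s *\<^sub>R w)) has_derivative (\<lambda>r. D g (a + s *\<^sub>R w) (0 + r *\<^sub>R w))) (at s)"
      by (rule has_derivative_compose[of "\<lambda>s. a + s *\<^sub>R w" _ s UNIV g, OF _ D_works[OF that]])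
        (intro has_derivative_add has_derivative_const has_derivative_scaleR_left has_derivative_ident)
    then show ?thesis
      by (simp add: has_field_derivative_def linear_scale[OF linear_D[OF that]] mult_commute_abs)
  qed
  define g where "g s = f (x + h *\<^sub>R v + s *\<^sub>R u) - f (x + s *\<^sub>R u)" for s
  have "\<exists>s>0. s < h \<and> g h - g 0 = (h - 0) * (D f (x + h *\<^sub>R v + s *\<^sub>R u) u - D f (x + s *\<^sub>R u) u)"
  proof (rule MVT2[OF assms(3)])
    fix s assume s: "0 \<le> s" "s \<le> h"
    have "x + s *\<^sub>R u + h *\<^sub>R v \<in> U" "x + s *\<^sub>R u + 0 *\<^sub>R v \<in> U"
      using s assms(3) by (intro in_U; simp)+
    then show "(g has_real_derivative D f (x + h *\<^sub>R v + s *\<^sub>R u) u - D f (x + s *\<^sub>R u) u) (at s)"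
      unfolding g_def by (intro DERIV_diff ray C1) (simp_all add: algebra_simps)
  qed
  then obtain s where s: "0 < s" "s < h"
    "g h - g 0 = h * (D f (x + s *\<^sub>R u + h *\<^sub>R v) u - D f (x + s *\<^sub>R u + 0 *\<^sub>R v) u)"
    by (auto simp: add.commute add.left_commute)
  have "\<exists>t>0. t < h \<and> D f (x + s *\<^sub>R u + h *\<^sub>R v) u - D f (x + s *\<^sub>R u + 0 *\<^sub>R v) u
      = (h - 0) * D (\<lambda>z. D f z u) (x + s *\<^sub>R u + t *\<^sub>R v) v"
    using s by (intro MVT2[OF assms(3), of "\<lambda>t. D f (x + s *\<^sub>R u + t *\<^sub>R v) u"] ray C1 in_U) auto
  then obtain t where "0 < t" "t < h" "g h - g 0 = h * (h * D (\<lambda>z. D f z u) (x + s *\<^sub>R u + t *\<^sub>R v) v)"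
    using s(3) by auto
  then show ?thesis
    using s(1,2) by (intro exI[of _ s] exI[of _ t]) (auto simp: g_def algebra_simps)
qed

text \<open>The second difference does not change when \<open>u\<close> and \<open>v\<close> are exchanged, so the two mixed derivatives
  agree at points arbitrarily close to \<open>x\<close>, and they are continuous.\<close>

lemma second_derivative_symmetric_real:
  fixes f :: "'a::euclidean_space \<Rightarrow> real"
  assumes "open U" "Ck_on 2 f U" "x \<in> U"
  shows "D (\<lambda>z. D f z u) x v = D (\<lambda>z. D f z v) x u"
proof -
  have cont: "continuous (at x) (\<lambda>z. D (\<lambda>z. D f z a) z b)" for a b
    using assms by (auto simp: numeral_2_eq_2 continuous_on_eq_continuous_at)
  have "\<bar>D (\<lambda>z. D f z u) x v - D (\<lambda>z. D f z v) x u\<bar> \<le> 2 * e" if "e > 0" for e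
  proof -
    obtain d1 where d1: "d1 > 0" "\<And>z. dist z x < d1 \<Longrightarrow> dist (D (\<lambda>z. D f z u) z v) (D (\<lambda>z. D f z u) x v) < e"
      using cont[of u v] \<open>e > 0\<close> unfolding continuous_at_eps_delta by blast
    obtain d2 where d2: "d2 > 0" "\<And>z. dist z x < d2 \<Longrightarrow> dist (D (\<lambda>z. D f z v) z u) (D (\<lambda>z. D f z v) x u) < e"
      using cont[of v u] \<open>e > 0\<close> unfolding continuous_at_eps_delta by blast
    obtain d3 where d3: "d3 > 0" "ball x d3 \<subseteq> U"
      using assms open_contains_ball by blast
    define d where "d = min d1 (min d2 d3)"
    define n where "n = norm u + norm v + 1"
    define h where "h = d / (2 * n)"
    have d: "d > 0" using d1 d2 d3 by (simp add: d_def)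
    have n0: "n > 0" unfolding n_def by (intro add_nonneg_pos add_nonneg_nonneg) auto
    have h: "h > 0" using d n0 by (simp add: h_def)
    have close: "dist (x + s *\<^sub>R a + t *\<^sub>R b) x < d"
      if "0 \<le> s" "s \<le> h" "0 \<le> t" "t \<le> h" "norm a + norm b = norm u + norm v" for s t a b
    proof -
      have "norm (s *\<^sub>R a + t *\<^sub>R b) \<le> s * norm a + t * norm b"
        using that by (metis abs_of_nonneg norm_scaleR norm_triangle_ineq)
      also have "\<dots> \<le> h * norm a + h * norm b"
        using that by (intro add_mono mult_right_mono) auto
      also have "\<dots> = h * (norm u + norm v)"
        using that(5) by (simp flip: distrib_left)
      also have "\<dots> \<le> h * n"
        using h by (intro mult_left_mono) (auto simp: n_def)
      also have "\<dots> = d / 2" using n0 by (simp add: h_def)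
      also have "\<dots> < d" using d by simp
      finally show ?thesis by (simp add: dist_norm add.assoc)
    qed
    have inU: "x + s *\<^sub>R a + t *\<^sub>R b \<in> U"
      if "0 \<le> s" "s \<le> h" "0 \<le> t" "t \<le> h" "norm a + norm b = norm u + norm v" for s t a b
      using close[OF that] d3(2) by (auto simp: d_def dist_commute subset_eq)
    obtain s t where st: "0 \<le> s" "s \<le> h" "0 \<le> t" "t \<le> h"
      "f (x + h *\<^sub>R u + h *\<^sub>R v) - f (x + h *\<^sub>R u) - f (x + h *\<^sub>R v) + f x
        = h * h * D (\<lambda>z. D f z u) (x + s *\<^sub>R u + t *\<^sub>R v) v"
      using second_difference[OF assms(1,2) h, of x u v] inU by auto
    obtain s' t' where st': "0 \<le> s'" "s' \<le> h" "0 \<le> t'" "t' \<le> h"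
      "f (x + h *\<^sub>R v + h *\<^sub>R u) - f (x + h *\<^sub>R v) - f (x + h *\<^sub>R u) + f x
        = h * h * D (\<lambda>z. D f z v) (x + s' *\<^sub>R v + t' *\<^sub>R u) u"
      using second_difference[OF assms(1,2) h, of x v u] inU[of _ _ v u] by (auto simp: add.commute)
    have "h * h * D (\<lambda>z. D f z u) (x + s *\<^sub>R u + t *\<^sub>R v) v
        = h * h * D (\<lambda>z. D f z v) (x + s' *\<^sub>R v + t' *\<^sub>R u) u"
      unfolding st(5)[symmetric] st'(5)[symmetric] by (simp add: algebra_simps)
    then have eq: "D (\<lambda>z. D f z u) (x + s *\<^sub>R u + t *\<^sub>R v) v
        = D (\<lambda>z. D f z v) (x + s' *\<^sub>R v + t' *\<^sub>R u) u"
      using h by simp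
    have "dist (x + s *\<^sub>R u + t *\<^sub>R v) x < d1" "dist (x + s' *\<^sub>R v + t' *\<^sub>R u) x < d2"
      using close[OF st(1-4), of u v] close[OF st'(1-4), of v u] by (auto simp: d_def)
    then have "\<bar>D (\<lambda>z. D f z u) (x + s *\<^sub>R u + t *\<^sub>R v) v - D (\<lambda>z. D f z u) x v\<bar> < e"
      "\<bar>D (\<lambda>z. D f z v) (x + s' *\<^sub>R v + t' *\<^sub>R u) u - D (\<lambda>z. D f z v) x u\<bar> < e"
      using d1(2) d2(2) by (auto simp: dist_real_def)
    then show ?thesis using eq by linarith
  qed
  from this[of "\<bar>D (\<lambda>z. D f z u) x v - D (\<lambda>z. D f z v) x u\<bar> / 4"] show ?thesis
    by (cases "D (\<lambda>z. D f z u) x v = D (\<lambda>z. D f z v) x u") auto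
qed

lemma second_derivative_symmetric:
  fixes f :: "'a::euclidean_space \<Rightarrow> 'b::euclidean_space"
  assumes "open U" "Ck_on 2 f U" "x \<in> U"
  shows "D (\<lambda>z. D f z u) x v = D (\<lambda>z. D f z v) x u"
proof (rule euclidean_eqI)
  fix i :: 'b assume "i \<in> Basis"
  have dif: "f differentiable (at z)" "(\<lambda>z. D f z a) differentiable (at z)" if "z \<in> U" for z a
    using assms(2) that by (auto simp: numeral_2_eq_2)
  have "D (\<lambda>z. D f z a) x b \<bullet> i = D (\<lambda>z. D (\<lambda>z. f z \<bullet> i) z a) x b" for a b
  proof -
    have "D (\<lambda>z. D (\<lambda>z. f z \<bullet> i) z a) x = D (\<lambda>z. D f z a \<bullet> i) x"
      by (rule D_cong[OF assms(1,3)]) (simp add: dif D_bounded_linear[OF bounded_linear_inner_left])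
    then show ?thesis
      by (simp add: dif assms(3) D_bounded_linear[OF bounded_linear_inner_left])
  qed
  then show "D (\<lambda>z. D f z u) x v \<bullet> i = D (\<lambda>z. D f z v) x u \<bullet> i"
    using second_derivative_symmetric_real[OF assms(1) Ck_on_inner_const[OF assms(1,2), of i] assms(3)]
    by simp
qed

section \<open>Homogeneity in the fibre coordinates\<close>

text \<open>Points of a tangent chart and vectors at such a point are both pairs, so the dilation of the fibres
  and its derivative are the same linear map.\<close>

definition fibre_scale :: "real \<Rightarrow> 'a::real_vector \<times> 'b::real_vector \<Rightarrow> 'a \<times> 'b" where
  "fibre_scale t z = (fst z, t *\<^sub>R snd z)"

lemma fst_fibre_scale [simp]: "fst (fibre_scale t z) = fst z"
  and snd_fibre_scale [simp]: "snd (fibre_scale t z) = t *\<^sub>R snd z"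
  by (simp_all add: fibre_scale_def)

lemma linear_fibre_scale: "linear (fibre_scale t)"
  by (intro linearI) (simp_all add: fibre_scale_def scaleR_add_right)

text \<open>The image in a tangent chart of the nonzero vectors, when \<open>U\<close> is the image of the base chart.\<close>

definition slit :: "'a set \<Rightarrow> ('a \<times> 'b::zero) set" where
  "slit U = U \<times> (UNIV - {0})"

lemma open_slit: "open U \<Longrightarrow> open (slit U :: ('a::topological_space \<times> 'b::{zero,t1_space}) set)"
  unfolding slit_def by (intro open_Times open_Diff) auto

lemma slit_iff: "z \<in> slit U \<longleftrightarrow> fst z \<in> U \<and> snd z \<noteq> 0"
  by (cases z) (simp add: slit_def)

lemma fibre_scale_slit: "z \<in> slit U \<Longrightarrow> t > 0 \<Longrightarrow> fibre_scale t z \<in> slit U"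
  by (simp add: slit_iff)

text \<open>Homogeneity is the case \<open>m = fibre_scale t\<close>. Allowing two maps \<open>f\<close> and \<open>g\<close> lets the lemma apply
  again to directional derivatives, where the direction is scaled as well.\<close>

lemma D_equivariant:
  fixes f g :: "'a::euclidean_space \<Rightarrow> 'b::euclidean_space"
  assumes "open S" "z \<in> S" "linear m" "linear L" "\<And>z. z \<in> S \<Longrightarrow> f (m z) = L (g z)"
    and "f differentiable (at (m z))" "g differentiable (at z)"
  shows "D f (m z) (m w) = L (D g z w)"
proof -
  have m: "(m has_derivative m) (at z)" and L: "bounded_linear L"
    using assms(3,4) bounded_linear_imp_has_derivative linear_conv_bounded_linear by blast+
  have "D (\<lambda>z. f (m z)) z w = D f (m z) (m w)"
    using D_comp[OF differentiableI[OF m] assms(6)] by (simp add: D_eq[OF m])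
  moreover have "D (\<lambda>z. f (m z)) z = D (\<lambda>z. L (g z)) z"
    by (rule D_cong[OF assms(1,2,5)])
  ultimately show ?thesis
    by (simp add: D_bounded_linear[OF L assms(7)])
qed

lemma has_vector_derivative_fibre_ray:
  fixes f :: "'a::euclidean_space \<times> 'a \<Rightarrow> 'b::real_normed_vector"
  assumes "f differentiable (at (fibre_scale t z))"
  shows "((\<lambda>t. f (fibre_scale t z)) has_vector_derivative D f (fibre_scale t z) (0, snd z)) (at t)"
proof -
  have "((\<lambda>t. f (fibre_scale t z)) has_derivative (\<lambda>h. D f (fibre_scale t z) (0, h *\<^sub>R snd z))) (at t)"
  proof (rule has_derivative_compose[of "\<lambda>t. fibre_scale t z" _ t UNIV f, OF _ D_works[OF assms]])
    show "((\<lambda>t. fibre_scale t z) has_derivative (\<lambda>h. (0, h *\<^sub>R snd z))) (at t)"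
      unfolding fibre_scale_def
      by (intro has_derivative_Pair has_derivative_const has_derivative_scaleR_left has_derivative_ident)
  qed
  moreover have "D f (fibre_scale t z) (0, h *\<^sub>R snd z) = h *\<^sub>R D f (fibre_scale t z) (0, snd z)" for h
    using linear_scale[OF linear_D[OF assms], of h "(0, snd z)"] by simp
  ultimately show ?thesis
    by (simp add: has_vector_derivative_def)
qed

text \<open>By Euler's relation the function \<open>t \<mapsto> f (x, t y) / t\<^sup>2\<close> has derivative \<open>0\<close> for \<open>t > 0\<close>.\<close>

lemma euler_imp_homogeneous:
  fixes f :: "'a::euclidean_space \<times> 'a \<Rightarrow> 'b::real_normed_vector"
  assumes diff: "\<And>z. z \<in> slit U \<Longrightarrow> f differentiable (at z)"
    and euler: "\<And>z. z \<in> slit U \<Longrightarrow> D f z (0, snd z) = 2 *\<^sub>R f z"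
    and z: "z \<in> slit U" and t: "t > 0"
  shows "f (fibre_scale t z) = t\<^sup>2 *\<^sub>R f z"
proof -
  have "((\<lambda>t. inverse (t\<^sup>2) *\<^sub>R f (fibre_scale t z)) has_vector_derivative 0) (at t within {0<..})"
    if "t \<in> {0<..}" for t
  proof -
    have t: "t > 0" and tz: "fibre_scale t z \<in> slit U"
      using that z by (auto simp: fibre_scale_slit)
    have "(0, snd z) = inverse t *\<^sub>R (0 :: 'a, snd (fibre_scale t z))"
      using t by simp
    then have "D f (fibre_scale t z) (0, snd z) = (2 * inverse t) *\<^sub>R f (fibre_scale t z)"
      by (simp only: linear_scale[OF linear_D[OF diff[OF tz]]] euler[OF tz]) simp
    with has_vector_derivative_fibre_ray[OF diff[OF tz]]
    have 1: "((\<lambda>t. f (fibre_scale t z)) has_vector_derivative (2 * inverse t) *\<^sub>R f (fibre_scale t z)) (at t)"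
      by simp
    have 2: "((\<lambda>t. inverse (t\<^sup>2)) has_real_derivative - (2 * inverse (t ^ 3))) (at t)"
      using t by (auto intro!: derivative_eq_intros simp: divide_simps power2_eq_square power3_eq_cube)
    have "((\<lambda>t. inverse (t\<^sup>2) *\<^sub>R f (fibre_scale t z)) has_vector_derivative
       inverse (t\<^sup>2) *\<^sub>R ((2 * inverse t) *\<^sub>R f (fibre_scale t z)) + (- (2 * inverse (t ^ 3))) *\<^sub>R f (fibre_scale t z)) (at t)"
      by (rule has_vector_derivative_scaleR[OF 2 1])
    moreover have "inverse (t\<^sup>2) * (2 * inverse t) = 2 * inverse (t ^ 3)"
      by (simp add: power2_eq_square power3_eq_cube)
    ultimately show ?thesis
      by (simp add: has_vector_derivative_at_within)
  qed
  then obtain c where c: "\<And>t. t \<in> {0<..} \<Longrightarrow> inverse (t\<^sup>2) *\<^sub>R f (fibre_scale t z) = c"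
    by (rule has_vector_derivative_zero_constant[of "{0<..}", rotated]) (auto intro: convex_real_interval)
  have "f z = c"
    using c[of 1] by (simp add: fibre_scale_def)
  then have "t\<^sup>2 *\<^sub>R (inverse (t\<^sup>2) *\<^sub>R f (fibre_scale t z)) = t\<^sup>2 *\<^sub>R f z"
    using c[of t] t by simp
  then show ?thesis using t by simp
qed

text \<open>This is the homogeneity \<open>[C, X] = X\<close> of a vector field, whose two components have degrees 1 and 2. The
  point \<open>z\<close> may lie on the zero section.\<close>

lemma homogeneous_imp_euler:
  fixes X :: "'a::euclidean_space \<times> 'a \<Rightarrow> 'a \<times> 'a"
  assumes "X differentiable (at z)" "\<And>t. t > 0 \<Longrightarrow> X (fibre_scale t z) = t *\<^sub>R fibre_scale t (X z)"
  shows "D X z (0, snd z) = X z + (0, snd (X z))"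
proof -
  have one: "fibre_scale 1 z = z" by (simp add: fibre_scale_def)
  have "((\<lambda>t. X (fibre_scale t z)) has_vector_derivative D X z (0, snd z)) (at 1)"
    using has_vector_derivative_fibre_ray[of X 1 z] assms(1) by (simp add: one)
  moreover have "((\<lambda>t. X (fibre_scale t z)) has_vector_derivative X z + (0, snd (X z))) (at 1)"
  proof (rule has_vector_derivative_transform_within_open[of _ _ 1 "{0<..}"])
    have "((\<lambda>t::real. (t *\<^sub>R fst (X z), (t * t) *\<^sub>R snd (X z))) has_derivative
        (\<lambda>h. (h *\<^sub>R fst (X z), (1 * h + h * 1) *\<^sub>R snd (X z)))) (at 1)"
      by (intro has_derivative_Pair has_derivative_scaleR_left has_derivative_mult has_derivative_ident)
    moreover have "(\<lambda>h. (h *\<^sub>R fst (X z), (1 * h + h * 1) *\<^sub>R snd (X z)))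
      = (\<lambda>h. h *\<^sub>R (X z + (0, snd (X z))))"
      by (simp add: fun_eq_iff prod_eq_iff scaleR_2 scaleR_add_right flip: scaleR_scaleR)
    ultimately show "((\<lambda>t. t *\<^sub>R fibre_scale t (X z)) has_vector_derivative X z + (0, snd (X z))) (at 1)"
      by (simp add: has_vector_derivative_def fibre_scale_def)
  qed (auto simp: assms(2))
  ultimately show ?thesis
    by (rule vector_derivative_unique_at)
qed

text \<open>A homogeneous map is controlled by its values on unit vectors, which over a compact ball of the base
  form a compact set.\<close>

lemma slit_compact_bound:
  fixes x :: "'a::euclidean_space"
  assumes "open U" "x \<in> U"
  obtains r where "r > 0" "cball x r \<subseteq> U"
    "\<And>F :: 'a \<times> 'a \<Rightarrow> 'b::real_normed_vector. continuous_on (slit U) F \<Longrightarrow>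
      \<exists>C. \<forall>z. fst z \<in> cball x r \<longrightarrow> norm (snd z) = 1 \<longrightarrow> norm (F z) \<le> C"
proof -
  obtain r where r: "r > 0" "cball x r \<subseteq> U"
    using assms open_contains_cball by blast
  define K where "K = cball x r \<times> sphere (0::'a) 1"
  have K: "compact K" "K \<subseteq> slit U"
    using r by (auto simp: K_def slit_def intro: compact_Times)
  have "\<exists>C. \<forall>z. fst z \<in> cball x r \<longrightarrow> norm (snd z) = 1 \<longrightarrow> norm (F z) \<le> C"
    if "continuous_on (slit U) F" for F :: "'a \<times> 'a \<Rightarrow> 'b"
  proof -
    have "bounded (F ` K)"
      using continuous_on_subset[OF that K(2)] K(1) compact_continuous_image compact_imp_bounded by blast
    then obtain C where C: "\<And>z. z \<in> K \<Longrightarrow> norm (F z) \<le> C"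
      by (auto simp: bounded_iff)
    have "norm (F z) \<le> C" if "fst z \<in> cball x r" "norm (snd z) = 1" for z
      using that by (intro C) (cases z, simp add: K_def)
    then show ?thesis by blast
  qed
  with r show thesis by (rule that)
qed

lemma fibre_scale_unit:
  fixes z :: "'a::real_normed_vector \<times> 'b::real_normed_vector"
  assumes "snd z \<noteq> 0"
  obtains z' where "z = fibre_scale (norm (snd z)) z'" "norm (snd z') = 1" "fst z' = fst z"
  using assms by (intro that[of "fibre_scale (inverse (norm (snd z))) z"]) (auto simp: fibre_scale_def)

text \<open>Near \<open>(x, 0)\<close> the map is bounded by a multiple of \<open>|y|\<^sup>2\<close>.\<close>

lemma homogeneous_has_derivative_zero:
  fixes X :: "'a::euclidean_space \<times> 'a \<Rightarrow> 'b::real_normed_vector"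
  assumes "open U" "x \<in> U" "continuous_on (slit U) X"
    and zero: "\<And>x. x \<in> U \<Longrightarrow> X (x, 0) = 0"
    and homogeneous: "\<And>z t. z \<in> slit U \<Longrightarrow> t > 0 \<Longrightarrow> X (fibre_scale t z) = t\<^sup>2 *\<^sub>R X z"
  shows "(X has_derivative (\<lambda>_. 0)) (at (x, 0))"
proof -
  obtain r C where r: "r > 0" "cball x r \<subseteq> U"
    and C: "\<And>z. fst z \<in> cball x r \<Longrightarrow> norm (snd z) = 1 \<Longrightarrow> norm (X z) \<le> C"
    using slit_compact_bound[OF assms(1,2), where ?'b = 'b] assms(3) by metis
  have X_le: "norm (X z) \<le> \<bar>C\<bar> * (norm (z - (x, 0)))\<^sup>2" if "fst z \<in> cball x r" for z
  proof (cases "snd z = 0")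
    case True
    then show ?thesis using zero[of "fst z"] that r(2) by (cases z) auto
  next
    case False
    obtain z' where z': "z = fibre_scale (norm (snd z)) z'" "norm (snd z') = 1" "fst z' = fst z"
      by (rule fibre_scale_unit[OF False])
    have "z' \<in> slit U"
      using z' that r(2) by (auto simp: slit_iff)
    then have "X z = (norm (snd z))\<^sup>2 *\<^sub>R X z'"
      using homogeneous[of z' "norm (snd z)"] False z'(1) by simp
    then have "norm (X z) = norm (X z') * (norm (snd z))\<^sup>2" by (simp add: mult.commute)
    moreover have "norm (snd z) \<le> norm (z - (x, 0))"
      by (cases z) (simp add: norm_Pair)
    moreover have "norm (X z') \<le> \<bar>C\<bar>"
      using C[of z'] z' that by simp
    ultimately show ?thesis
      by (simp add: mult_mono power_mono)
  qed
  show ?thesis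
    unfolding has_derivative_at_within
  proof (intro conjI bounded_linear_zero)
    have "open (ball x r \<times> (UNIV :: 'a set))" "(x, 0) \<in> ball x r \<times> (UNIV :: 'a set)"
      using r(1) by (auto intro: open_Times)
    then have "\<forall>\<^sub>F z in at (x, 0). z \<in> ball x r \<times> (UNIV :: 'a set)"
      unfolding eventually_at_topological by blast
    then have "\<forall>\<^sub>F z in at (x, 0). norm ((X z - X (x, 0) - 0) /\<^sub>R norm (z - (x, 0))) \<le> \<bar>C\<bar> * norm (z - (x, 0))"
    proof eventually_elim
      case (elim z)
      then have "norm (X z) \<le> \<bar>C\<bar> * (norm (z - (x, 0)))\<^sup>2"
        by (intro X_le) auto
      then show ?case
        using zero[OF assms(2)] by (cases "z = (x, 0)") (auto simp: divide_simps power2_eq_square mult.assoc)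
    qed
    moreover have "((\<lambda>z. \<bar>C\<bar> * norm (z - (x, 0::'a))) \<longlongrightarrow> 0) (at (x, 0))"
      by (intro tendsto_mult_right_zero tendsto_norm_zero) (simp add: LIM_zero_iff tendsto_ident_at)
    ultimately show "((\<lambda>z. (X z - X (x, 0) - 0) /\<^sub>R norm (z - (x, 0))) \<longlongrightarrow> 0) (at (x, 0))"
      by (rule Lim_null_comparison)
  qed
qed

text \<open>Continuity of the derivative at the zero section: \<open>D X\<close> is homogeneous of degree 2 in base directions and
  of degree 1 in fibre directions, so it tends to \<open>0\<close> with \<open>y\<close>.\<close>

lemma homogeneous_Ck_1_at_zero:
  fixes X :: "'a::euclidean_space \<times> 'a \<Rightarrow> 'b::euclidean_space"
  assumes "open U" "Ck_on 1 X (slit U)"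
    and zero: "\<And>x. x \<in> U \<Longrightarrow> X (x, 0) = 0"
    and homogeneous: "\<And>z t. z \<in> slit U \<Longrightarrow> t > 0 \<Longrightarrow> X (fibre_scale t z) = t\<^sup>2 *\<^sub>R X z"
  shows "Ck_on 1 X (U \<times> UNIV)"
proof -
  have dX: "X differentiable (at z)" if "z \<in> slit U" for z
    using assms(2) that by simp
  have cDX: "continuous_on (slit U) (\<lambda>z. D X z v)" for v
    using assms(2) by (cases v) simp
  have DX: "D X (fibre_scale t z) (fibre_scale t w) = t\<^sup>2 *\<^sub>R D X z w" if "z \<in> slit U" "t > 0" for z t w
    using that
    by (intro D_equivariant[of "slit U" z "fibre_scale t" "\<lambda>w. t\<^sup>2 *\<^sub>R w"]
        open_slit assms(1) linear_fibre_scale homogeneous dX fibre_scale_slit) (auto intro: linearI simp: scaleR_add_right)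
  have at_zero: "(X has_derivative (\<lambda>_. 0)) (at (x, 0))" if "x \<in> U" for x
    using Ck_on_continuous_on[OF assms(2)]
    by (rule homogeneous_has_derivative_zero[OF assms(1) that _ zero homogeneous])
  have DX_zero: "D X (x, 0) = (\<lambda>_. 0)" if "x \<in> U" for x
    by (rule D_eq[OF at_zero[OF that]])
  have cont_zero: "continuous (at (x, 0)) (\<lambda>z. D X z v)" if x: "x \<in> U" for x v
  proof -
    obtain r where r: "r > 0" "cball x r \<subseteq> U"
      and bound: "\<And>F :: 'a \<times> 'a \<Rightarrow> 'b. continuous_on (slit U) F \<Longrightarrow>
        \<exists>C. \<forall>z. fst z \<in> cball x r \<longrightarrow> norm (snd z) = 1 \<longrightarrow> norm (F z) \<le> C"
      using slit_compact_bound[OF assms(1) x, where ?'b = 'b] by metis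
    obtain Ca where Ca: "\<And>z. fst z \<in> cball x r \<Longrightarrow> norm (snd z) = 1 \<Longrightarrow> norm (D X z (fst v, 0)) \<le> Ca"
      using bound[OF cDX[of "(fst v, 0)"]] by blast
    obtain Cb where Cb: "\<And>z. fst z \<in> cball x r \<Longrightarrow> norm (snd z) = 1 \<Longrightarrow> norm (D X z (0, snd v)) \<le> Cb"
      using bound[OF cDX[of "(0, snd v)"]] by blast
    have DX_le: "norm (D X z v) \<le> (norm (snd z))\<^sup>2 * Ca + norm (snd z) * Cb" if z: "fst z \<in> cball x r" for z
    proof (cases "snd z = 0")
      case True
      then show ?thesis using DX_zero[of "fst z"] z r(2) by (cases z) auto
    next
      case False
      define t where "t = norm (snd z)"
      have t: "t > 0" using False by (simp add: t_def)
      obtain z' where z': "z = fibre_scale t z'" "norm (snd z') = 1" "fst z' = fst z"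
        unfolding t_def by (rule fibre_scale_unit[OF False])
      then have zs: "z' \<in> slit U"
        using z r(2) by (auto simp: slit_iff)
      have lin: "linear (D X z)"
        unfolding z'(1) by (rule linear_D[OF dX[OF fibre_scale_slit[OF zs t]]])
      \<comment> \<open>Base and fibre directions scale differently, whence the factor \<open>1 / t\<close> in the second one.\<close>
      have "v = fibre_scale t (fst v, 0) + inverse t *\<^sub>R fibre_scale t (0, snd v)"
        using t by (cases v) (simp add: fibre_scale_def)
      then have "D X z v = D X z (fibre_scale t (fst v, 0) + inverse t *\<^sub>R fibre_scale t (0, snd v))"
        by simp
      also have "\<dots> = D X z (fibre_scale t (fst v, 0)) + inverse t *\<^sub>R D X z (fibre_scale t (0, snd v))"
        by (simp only: linear_add[OF lin] linear_scale[OF lin])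
      also have "\<dots> = t\<^sup>2 *\<^sub>R D X z' (fst v, 0) + t *\<^sub>R D X z' (0, snd v)"
        using t unfolding z'(1) DX[OF zs t] by (simp add: power2_eq_square)
      also have "norm \<dots> \<le> t\<^sup>2 * Ca + t * Cb"
      proof (rule norm_triangle_le)
        have "norm (D X z' (fst v, 0)) \<le> Ca" "norm (D X z' (0, snd v)) \<le> Cb"
          using Ca[of z'] Cb[of z'] z'(2,3) z by simp_all
        then show "norm (t\<^sup>2 *\<^sub>R D X z' (fst v, 0)) + norm (t *\<^sub>R D X z' (0, snd v)) \<le> t\<^sup>2 * Ca + t * Cb"
          using t by (simp add: add_mono mult_left_mono)
      qed
      finally show ?thesis by (simp add: t_def)
    qed
    have "open (ball x r \<times> (UNIV :: 'a set))" "(x, 0) \<in> ball x r \<times> (UNIV :: 'a set)"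
      using r(1) by (auto intro: open_Times)
    then have "\<forall>\<^sub>F z in at (x, 0). z \<in> ball x r \<times> (UNIV :: 'a set)"
      unfolding eventually_at_topological by blast
    then have "\<forall>\<^sub>F z in at (x, 0). norm (D X z v) \<le> (norm (snd z))\<^sup>2 * Ca + norm (snd z) * Cb"
      by eventually_elim (rule DX_le, auto)
    moreover have "((\<lambda>z. (norm (snd z))\<^sup>2 * Ca + norm (snd z) * Cb) \<longlongrightarrow>
        (norm (snd (x, 0::'a)))\<^sup>2 * Ca + norm (snd (x, 0::'a)) * Cb) (at (x, 0::'a))"
      by (intro tendsto_intros)
    then have "((\<lambda>z. (norm (snd z))\<^sup>2 * Ca + norm (snd z) * Cb) \<longlongrightarrow> 0) (at (x, 0::'a))"
      by simp
    ultimately have "((\<lambda>z. D X z v) \<longlongrightarrow> 0) (at (x, 0))"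
      by (rule Lim_null_comparison)
    then show ?thesis
      by (simp add: continuous_at DX_zero[OF x])
  qed
  have "X differentiable (at z)" "continuous (at z) (\<lambda>z. D X z v)" if "z \<in> U \<times> UNIV" for z v
  proof (atomize (full), cases "snd z = 0")
    case True
    then obtain x where x: "z = (x, 0)" "x \<in> U" using \<open>z \<in> U \<times> UNIV\<close> by (cases z) auto
    show "X differentiable (at z) \<and> continuous (at z) (\<lambda>z. D X z v)"
      unfolding x(1) using at_zero[OF x(2)] cont_zero[OF x(2)] by (auto intro: differentiableI)
  next
    case False
    then have z: "z \<in> slit U" using that by (cases z) (auto simp: slit_iff)
    then show "X differentiable (at z) \<and> continuous (at z) (\<lambda>z. D X z v)"
      using dX[OF z] cDX[of v] continuous_on_eq_continuous_at[OF open_slit[OF assms(1)]] by blast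
  qed
  then show ?thesis
    by (simp add: continuous_at_imp_continuous_on)
qed

section \<open>The fundamental form in fibre coordinates\<close>

text \<open>The vertical endomorphism in a tangent chart.\<close>

definition vert :: "'a::real_vector \<times> 'a \<Rightarrow> 'a \<times> 'a" where
  "vert u = (0, fst u)"

definition hess :: "('a::euclidean_space \<Rightarrow> real) \<Rightarrow> 'a \<Rightarrow> 'a \<Rightarrow> 'a \<Rightarrow> real" where
  "hess f z u v = D (\<lambda>z. D f z v) z u"

text \<open>The fundamental form \<open>d d\<^sub>J f\<close> in a tangent chart: the exterior derivative of the 1-form
  \<open>w \<mapsto> D f (vert w)\<close>.\<close>

definition fund :: "('a::euclidean_space \<times> 'a \<Rightarrow> real) \<Rightarrow> 'a \<times> 'a \<Rightarrow> 'a \<times> 'a \<Rightarrow> 'a \<times> 'a \<Rightarrow> real" where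
  "fund f z u w = hess f z u (vert w) - hess f z w (vert u)"

lemma linear_vert: "linear vert"
  by (intro linearI) (auto simp: vert_def)

lemma vert_vert [simp]: "vert (vert u) = 0"
  and fst_vert [simp]: "fst (vert u) = 0"
  and snd_vert [simp]: "snd (vert u) = fst u"
  by (simp_all add: vert_def prod_eq_iff)

lemma vert_fibre_scale: "t > 0 \<Longrightarrow> vert (fibre_scale t u) = inverse t *\<^sub>R fibre_scale t (vert u)"
  by (simp add: vert_def fibre_scale_def)

context
  fixes S :: "('a::euclidean_space) set" and f :: "'a \<Rightarrow> real"
  assumes S: "open S" and smooth: "\<And>k. Ck_on k f S"
begin

lemma smooth_differentiable: "z \<in> S \<Longrightarrow> f differentiable (at z)"
  using smooth[of 1] by simp

lemma smooth_D_Ck: "Ck_on k (\<lambda>z. D f z v) S"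
  using smooth[of "Suc k"] by simp

lemma smooth_D_differentiable: "z \<in> S \<Longrightarrow> (\<lambda>z. D f z v) differentiable (at z)"
  using smooth_D_Ck[of 1 v] by simp

lemma hess_Ck: "Ck_on k (\<lambda>z. hess f z u v) S"
  unfolding hess_def using smooth_D_Ck[of "Suc k"] by simp

lemma linear_hess_left: "z \<in> S \<Longrightarrow> linear (\<lambda>u. hess f z u v)"
  unfolding hess_def by (rule linear_D[OF smooth_D_differentiable])

lemma hess_symmetric: "z \<in> S \<Longrightarrow> hess f z u v = hess f z v u"
  unfolding hess_def by (rule second_derivative_symmetric[OF S smooth])

lemma linear_hess_right: "z \<in> S \<Longrightarrow> linear (hess f z u)"
  using linear_hess_left[of z u] by (simp add: hess_symmetric[of z _ u] flip: fun_eq_iff)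

end

context
  fixes S :: "('a::euclidean_space \<times> 'a) set" and f :: "'a \<times> 'a \<Rightarrow> real"
  assumes S: "open S" and smooth: "\<And>k. Ck_on k f S"
begin

lemma fund_Ck: "Ck_on k (\<lambda>z. fund f z u w) S"
proof -
  have "Ck_on k (\<lambda>z. hess f z u (vert w) + - hess f z w (vert u)) S"
    by (intro Ck_on_add S Ck_on_bounded_linear[OF bounded_linear_minus[OF bounded_linear_ident] S] hess_Ck[OF S smooth])
  then show ?thesis by (simp add: fund_def)
qed

lemma linear_fund:
  assumes "z \<in> S"
  shows "linear (\<lambda>u. fund f z u w)" "linear (fund f z u)"
  unfolding fund_def
  by (intro linear_compose_sub linear_hess_left[OF S smooth assms]
      linear_compose[OF linear_vert linear_hess_right[OF S smooth assms], unfolded o_def])+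

lemma fund_vertical:
  assumes "z \<in> S" shows "fund f z u (0, b) = - hess f z (0, b) (vert u)"
  using linear_0[OF linear_hess_right[OF S smooth assms]] by (simp add: fund_def vert_def flip: zero_prod_def)

text \<open>Applying \<open>vert\<close> after the dilation costs a factor \<open>1 / t\<close>; this turns the degree 2 of the Hessian
  into degree 1 of the fundamental form.\<close>

lemma fund_scale:
  assumes "t > 0" "z \<in> S" and cone: "\<And>z. z \<in> S \<Longrightarrow> fibre_scale t z \<in> S"
    and homogeneous: "\<And>z. z \<in> S \<Longrightarrow> f (fibre_scale t z) = t\<^sup>2 * f z"
  shows "D f (fibre_scale t z) (fibre_scale t w) = t\<^sup>2 * D f z w"
    and "fund f (fibre_scale t z) (fibre_scale t u) (fibre_scale t w) = t * fund f z u w"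
proof -
  have sq: "linear (\<lambda>r::real. t\<^sup>2 * r)" by (intro linearI) (auto simp: algebra_simps)
  have 1: "D f (fibre_scale t z) (fibre_scale t w) = t\<^sup>2 * D f z w" if "z \<in> S" for z w
    by (intro D_equivariant[OF S that linear_fibre_scale sq] homogeneous smooth_differentiable[OF S smooth] cone that)
  then show "D f (fibre_scale t z) (fibre_scale t w) = t\<^sup>2 * D f z w"
    using assms(2) by blast
  have 2: "hess f (fibre_scale t z) (fibre_scale t u) (fibre_scale t v) = t\<^sup>2 * hess f z u v" for u v
    unfolding hess_def
    by (intro D_equivariant[OF S assms(2) linear_fibre_scale sq, of "\<lambda>z. D f z (fibre_scale t v)"]
        1 smooth_D_differentiable[OF S smooth] cone assms(2))
  have 3: "hess f (fibre_scale t z) (fibre_scale t u) (vert (fibre_scale t w)) = t * hess f z u (vert w)" for u w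
    using assms(1) by (simp add: vert_fibre_scale linear_scale[OF linear_hess_right[OF S smooth cone[OF assms(2)]]] 2 power2_eq_square)
  show "fund f (fibre_scale t z) (fibre_scale t u) (fibre_scale t w) = t * fund f z u w"
    by (simp add: fund_def 3 right_diff_distrib)
qed

text \<open>The Hessian in the fibre directions is nondegenerate too: by symmetry a vector \<open>a\<close> in its kernel
  gives the vertical vector \<open>(0, a)\<close> in the kernel of the fundamental form, whose value at \<open>(0, a)\<close> and
  \<open>w\<close> is \<open>D\<^sup>2f ((0, a), vert w)\<close>.\<close>

lemma fund_nondegenerate_fibre:
  assumes "z \<in> S" and nondeg: "\<And>u. (\<And>w. fund f z u w = 0) \<Longrightarrow> u = 0"
    and "\<And>b. hess f z (0, b) (0, a) = 0"
  shows "a = 0"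
proof -
  have "fund f z (0, a) w = 0" for w
  proof -
    have "hess f z (0, a) (0, fst w) = 0"
      using assms(3)[of "fst w"] hess_symmetric[OF S smooth assms(1)] by simp
    then show ?thesis
      using linear_0[OF linear_hess_right[OF S smooth assms(1)]] by (simp add: fund_def vert_def flip: zero_prod_def)
  qed
  then show ?thesis using nondeg[of "(0, a)"] by (simp add: prod_eq_iff)
qed

lemma inner_basis_sum:
  "(\<Sum>i\<in>Basis. c i *\<^sub>R i) \<bullet> w = (\<Sum>i\<in>Basis. (w \<bullet> i) * c i)"
  unfolding inner_sum_left by (intro sum.cong refl) (simp add: inner_commute mult.commute)

text \<open>An injective linear endomorphism is surjective; the inner product turns the bilinear form into an
  endomorphism \<open>B\<close>.\<close>

lemma fund_solution_exists:
  assumes "z \<in> S" and nondeg: "\<And>u. (\<And>w. fund f z u w = 0) \<Longrightarrow> u = 0" and "linear b"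
  shows "\<exists>!u. \<forall>w. fund f z u w = b w"
proof (rule ex_ex1I)
  define B where "B u = (\<Sum>i\<in>Basis. fund f z u i *\<^sub>R i)" for u
  have B: "B u \<bullet> w = fund f z u w" for u w
    unfolding B_def using linear_expand[OF linear_fund(2)[OF assms(1)], of u w]
    by (simp add: inner_basis_sum)
  have "linear B"
    unfolding B_def by (intro linear_compose_sum ballI linear_compose[OF linear_fund(1)[OF assms(1)], unfolded o_def])
      (auto intro: linearI simp: scaleR_add_left)
  moreover have "inj B"
  proof (subst linear_injective_0[OF \<open>linear B\<close>], intro allI impI)
    fix u assume "B u = 0"
    then have "fund f z u w = 0" for w using B[of u w] by simp
    then show "u = 0" by (rule nondeg)
  qed
  ultimately obtain u where "B u = (\<Sum>i\<in>Basis. b i *\<^sub>R i)"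
    using linear_injective_imp_surjective by (metis surjD)
  then have "fund f z u w = b w" for w
    using linear_expand[OF assms(3), of w] B[of u w]
    by (simp add: inner_basis_sum)
  then show "\<exists>u. \<forall>w. fund f z u w = b w" by blast
next
  fix u u' assume "\<forall>w. fund f z u w = b w" "\<forall>w. fund f z u' w = b w"
  then have "fund f z u w = fund f z u' w" for w by metis
  then have "fund f z (u - u') w = 0" for w
    by (simp add: linear_diff[OF linear_fund(1)[OF assms(1)]])
  then show "u = u'" using nondeg[of "u - u'"] by simp
qed

lemma fund_solution_Ck:
  assumes nondeg: "\<And>z u. z \<in> S \<Longrightarrow> (\<And>w. fund f z u w = 0) \<Longrightarrow> u = 0"
    and "\<And>z w. z \<in> S \<Longrightarrow> fund f z (u z) w = b z w" "\<And>w. Ck_on k (\<lambda>z. b z w) S"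
  shows "Ck_on k u S"
proof (rule Ck_on_linear_system[OF S])
  define B where "B z u = (\<Sum>i\<in>Basis. fund f z u i *\<^sub>R i)" for z u
  have B: "B z u \<bullet> w = fund f z u w" if "z \<in> S" for z u w
    unfolding B_def using linear_expand[OF linear_fund(2)[OF that], of u w]
    by (simp add: inner_basis_sum)
  show lin: "linear (B z)" if "z \<in> S" for z
    unfolding B_def by (intro linear_compose_sum ballI linear_compose[OF linear_fund(1)[OF that], unfolded o_def])
      (auto intro: linearI simp: scaleR_add_left)
  show "inj (B z)" if "z \<in> S" for z
  proof (subst linear_injective_0[OF lin[OF that]], intro allI impI)
    fix u assume "B z u = 0"
    then have "fund f z u w = 0" for w using B[OF that, of u w] by simp
    then show "u = 0" by (rule nondeg[OF that])
  qed
  show "B z (u z) = (\<Sum>i\<in>Basis. b z i *\<^sub>R i)" if "z \<in> S" for z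
    by (simp add: B_def assms(2)[OF that])
  show "Ck_on k (\<lambda>z. B z u) S" for u
    unfolding B_def by (intro Ck_on_sum Ck_on_scaleR S fund_Ck) auto
  show "Ck_on k (\<lambda>z. \<Sum>i\<in>Basis. b z i *\<^sub>R i) S"
    by (intro Ck_on_sum Ck_on_scaleR S assms(3)) auto
qed

text \<open>A form \<open>b\<close> that vanishes on vertical vectors puts the base part of \<open>u\<close> into the kernel of the fibre Hessian.\<close>

lemma fund_solution_vertical:
  assumes "z \<in> S" and nondeg: "\<And>u. (\<And>w. fund f z u w = 0) \<Longrightarrow> u = 0"
    and "\<And>w. fund f z u w = b w" "\<And>c. b (0, c) = 0"
  shows "fst u = 0"
  using fund_nondegenerate_fibre[OF assms(1,2), of "fst u"] fund_vertical[OF assms(1), of u] assms(3,4)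
  by (simp add: vert_def)

text \<open>Differentiating Euler's relation along the fibre gives \<open>D\<^sup>2f ((0, b), (0, y)) = D f (0, b)\<close>. On the other
  hand the equation for \<open>u\<close> says \<open>D\<^sup>2f ((0, b), vert u) = - D f (0, b)\<close>. So \<open>y + fst u\<close> lies in the kernel
  of the fibre Hessian.\<close>

lemma fund_solution_spray:
  assumes "z \<in> S" and nondeg: "\<And>u. (\<And>w. fund f z u w = 0) \<Longrightarrow> u = 0"
    and euler: "\<And>z. z \<in> S \<Longrightarrow> D f z (0, snd z) = 2 * f z"
    and "\<And>w. fund f z u w = D f z w"
  shows "fst u = - snd z"
proof -
  have "hess f z (0, b) (0, snd z) = D f z (0, b)" for b
  proof -
    have "((\<lambda>z. D f z (0, snd z)) has_derivative (\<lambda>h. D (\<lambda>z'. D f z' (0, snd z)) z h + D f z (D (\<lambda>z. (0, snd z)) z h))) (at z)"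
    proof (rule has_derivative_linear_apply[OF S assms(1), of "D f" "\<lambda>z. (0, snd z)"])
      show "linear (D f x)" if "x \<in> S" for x
        by (rule linear_D[OF smooth_differentiable[OF S smooth that]])
      show "(\<lambda>z. D f z v) differentiable (at z)" for v
        by (rule smooth_D_differentiable[OF S smooth assms(1)])
      show "(\<lambda>z. (0::'a, snd z :: 'a)) differentiable (at z)"
        by (rule differentiableI[of _ "\<lambda>h. (0, snd h)"])
          (intro has_derivative_Pair has_derivative_const has_derivative_snd has_derivative_ident)
    qed
    moreover have "D (\<lambda>z. (0::'a, snd z :: 'a)) z = (\<lambda>h. (0, snd h))"
      by (rule D_eq) (intro has_derivative_Pair has_derivative_const has_derivative_snd has_derivative_ident)
    ultimately have "((\<lambda>z. D f z (0, snd z)) has_derivative (\<lambda>h. hess f z h (0, snd z) + D f z (0, snd h))) (at z)"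
      by (simp add: hess_def)
    then have "((\<lambda>z. 2 * f z) has_derivative (\<lambda>h. hess f z h (0, snd z) + D f z (0, snd h))) (at z)"
      by (rule has_derivative_transform_within_open[OF _ S assms(1)]) (rule euler)
    moreover have "((\<lambda>z. 2 * f z) has_derivative (\<lambda>h. 2 * D f z h)) (at z)"
      by (intro has_derivative_mult_right D_works smooth_differentiable[OF S smooth assms(1)])
    ultimately have "(\<lambda>h. hess f z h (0, snd z) + D f z (0, snd h)) = (\<lambda>h. 2 * D f z h)"
      by (rule has_derivative_unique)
    from fun_cong[OF this, of "(0, b)"] show ?thesis by simp
  qed
  then have "hess f z (0, b) ((0, snd z) + vert u) = 0" for b
    using fund_vertical[OF assms(1), of u b] assms(4)
    by (simp add: linear_add[OF linear_hess_right[OF S smooth assms(1)]] del: add_Pair)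
  then have "snd z + fst u = 0"
    by (intro fund_nondegenerate_fibre[OF assms(1,2)]) (simp_all add: vert_def)
  then show ?thesis by (simp add: eq_neg_iff_add_eq_0 add.commute)
qed

text \<open>Both sides solve the same linear system at the dilated point, by the scaling of the fundamental form.\<close>

lemma fund_solution_scale:
  assumes "t > 0" "z \<in> S" and cone: "\<And>z. z \<in> S \<Longrightarrow> fibre_scale t z \<in> S"
    and homogeneous: "\<And>z. z \<in> S \<Longrightarrow> f (fibre_scale t z) = t\<^sup>2 * f z"
    and nondeg: "\<And>z u. z \<in> S \<Longrightarrow> (\<And>w. fund f z u w = 0) \<Longrightarrow> u = 0"
    and "\<And>w. fund f z u w = b w" "\<And>w. fund f (fibre_scale t z) u' w = b' w"
    and "\<And>w. b' (fibre_scale t w) = t\<^sup>2 * b w"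
  shows "u' = t *\<^sub>R fibre_scale t u"
proof -
  have "fund f (fibre_scale t z) (u' - t *\<^sub>R fibre_scale t u) w = 0" for w
  proof -
    have w: "fibre_scale t (fibre_scale (inverse t) w) = w"
      using assms(1) by (simp add: fibre_scale_def)
    have "fund f (fibre_scale t z) (t *\<^sub>R fibre_scale t u) (fibre_scale t w') = b' (fibre_scale t w')" for w'
      using fund_scale(2)[OF assms(1-4)] assms(6,8)
      by (simp add: linear_scale[OF linear_fund(1)[OF cone[OF assms(2)]]] power2_eq_square)
    from this[of "fibre_scale (inverse t) w"] show ?thesis
      by (simp add: w assms(7) linear_diff[OF linear_fund(1)[OF cone[OF assms(2)]]])
  qed
  then show ?thesis
    using nondeg[OF cone[OF assms(2)], of "u' - t *\<^sub>R fibre_scale t u"] by simp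
qed

end

section \<open>Tangent vectors in charts\<close>

abbreviation transition :: "('p, 'e) chart \<Rightarrow> ('p, 'e) chart \<Rightarrow> 'e \<Rightarrow> 'e" where
  "transition c d \<equiv> snd d \<circ> chart_inv c"

text \<open>The tangent vector with component \<open>y\<close> in the chart \<open>c\<close>.\<close>

definition tvec_of :: "('p, 'e::euclidean_space) chart set \<Rightarrow> ('p, 'e) chart \<Rightarrow> 'p \<Rightarrow> 'e \<Rightarrow> ('p, 'e) tvec" where
  "tvec_of A c p y = (\<lambda>d. if d \<in> A \<and> p \<in> fst d then D (transition c d) (snd c p) y else 0)"

text \<open>The regularity needed to form a Lie bracket at \<open>p\<close>. The values must be tangent vectors on a whole
  neighbourhood, because the transformation rule for the components is differentiated at \<open>p\<close>.\<close>

definition field_differentiable_near :: "('p, 'e::euclidean_space) chart set \<Rightarrow> 'p \<Rightarrow> ('p, 'e) vfield \<Rightarrow> bool" where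
  "field_differentiable_near A p X \<longleftrightarrow> (\<exists>W. openin (atlas_topology A) W \<and> p \<in> W \<and>
     (\<forall>q\<in>W. X q \<in> tangent_space A q) \<and>
     (\<forall>c\<in>A. p \<in> fst c \<longrightarrow> (\<lambda>x. X (chart_inv c x) c) differentiable (at (snd c p))))"

lemma tangent_space_zero: "v \<in> tangent_space A p \<Longrightarrow> \<not> (c \<in> A \<and> p \<in> fst c) \<Longrightarrow> v c = 0"
  unfolding tangent_space_def by blast

lemma tangent_space_transition:
  "v \<in> tangent_space A p \<Longrightarrow> c \<in> A \<Longrightarrow> d \<in> A \<Longrightarrow> p \<in> fst c \<Longrightarrow> p \<in> fst d \<Longrightarrow>
    v d = D (transition c d) (snd c p) (v c)"
  unfolding tangent_space_def by blast

lemma tvec_eqI: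
  assumes "u \<in> tangent_space A p" "v \<in> tangent_space A p" "c \<in> A" "p \<in> fst c" "u c = v c"
  shows "u = v"
proof
  fix d
  show "u d = v d"
    using tangent_space_transition[OF assms(1,3) _ assms(4), of d] tangent_space_transition[OF assms(2,3) _ assms(4), of d]
      tangent_space_zero[OF assms(1), of d] tangent_space_zero[OF assms(2), of d] assms(5) by metis
qed

context
  fixes A :: "('p, 'e::euclidean_space) chart set"
  assumes A: "smooth_atlas A"
begin

lemma chart_inv_chart [simp]: "c \<in> A \<Longrightarrow> p \<in> fst c \<Longrightarrow> chart_inv c (snd c p) = p"
  using A by (simp add: smooth_atlas_def chart_inv_def)

lemma chart_inv_mem: "c \<in> A \<Longrightarrow> x \<in> snd c ` (fst c \<inter> W) \<Longrightarrow> chart_inv c x \<in> fst c \<inter> W"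
  by auto

lemma chart_chart_inv: "c \<in> A \<Longrightarrow> x \<in> snd c ` (fst c \<inter> W) \<Longrightarrow> snd c (chart_inv c x) = x"
  by auto

lemma open_chart_image:
  assumes "c \<in> A" "openin (atlas_topology A) W" shows "open (snd c ` (fst c \<inter> W))"
  using assms openin_atlas_topology[OF A] by blast

lemma openin_chart_domain:
  assumes "c \<in> A" shows "openin (atlas_topology A) (fst c)"
  unfolding openin_atlas_topology[OF A] using A assms by (auto simp: carrier_def smooth_atlas_def)

lemma open_overlap: "c \<in> A \<Longrightarrow> d \<in> A \<Longrightarrow> open (snd c ` (fst c \<inter> fst d))"
  by (intro open_chart_image openin_chart_domain)

lemma transition_Ck: "c \<in> A \<Longrightarrow> d \<in> A \<Longrightarrow> Ck_on k (transition c d) (snd c ` (fst c \<inter> fst d))"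
  using A by (simp add: smooth_atlas_def)

lemma transition_differentiable:
  assumes "c \<in> A" "d \<in> A" "p \<in> fst c" "p \<in> fst d"
  shows "transition c d differentiable (at (snd c p))"
  using transition_Ck[OF assms(1,2), of 1] assms(3,4) by simp

text \<open>The rule for changing charts in a derivative. The coordinate expressions \<open>h\<close> and \<open>g\<close> of a map need to agree
  only near \<open>p\<close>, which is how fields with a smaller domain are treated.\<close>

lemma D_transition_compose:
  fixes g :: "'e \<Rightarrow> 'b::real_normed_vector"
  assumes "c \<in> A" "d \<in> A" "p \<in> fst c" "p \<in> fst d"
    and "openin (atlas_topology A) W" "p \<in> W"
    and "\<And>q. q \<in> W \<Longrightarrow> q \<in> fst c \<Longrightarrow> q \<in> fst d \<Longrightarrow> h (snd c q) = g (snd d q)"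
    and "g differentiable (at (snd d p))"
  shows "h differentiable (at (snd c p))"
    and "D h (snd c p) v = D g (snd d p) (D (transition c d) (snd c p) v)"
proof -
  let ?O = "snd c ` (fst c \<inter> (W \<inter> fst d))"
  have O: "open ?O" "snd c p \<in> ?O"
    using assms by (auto intro!: open_chart_image openin_Int openin_chart_domain)
  have eq: "g (transition c d x) = h x" if "x \<in> ?O" for x
    using that assms(1,7) by auto
  have g: "g differentiable (at (transition c d (snd c p)))"
    using assms by simp
  show "h differentiable (at (snd c p))"
    by (rule differentiable_cong_open[OF O eq differentiable_comp[OF transition_differentiable[OF assms(1-4)] g]])
  have "D h (snd c p) = D (\<lambda>x. g (transition c d x)) (snd c p)"
    by (rule D_cong[OF O eq[symmetric]])
  then show "D h (snd c p) v = D g (snd d p) (D (transition c d) (snd c p) v)"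
    using D_comp[OF transition_differentiable[OF assms(1-4)] g] assms(1,3) by (simp add: o_def)
qed

lemma D_transition_cocycle:
  assumes "c \<in> A" "d \<in> A" "e \<in> A" "p \<in> fst c" "p \<in> fst d" "p \<in> fst e"
  shows "D (transition d e) (snd d p) (D (transition c d) (snd c p) v) = D (transition c e) (snd c p) v"
  by (rule D_transition_compose(2)[OF assms(1,2,4,5) openin_chart_domain[OF assms(3)] assms(6), symmetric])
    (use assms transition_differentiable in \<open>auto\<close>)

lemma D_transition_id:
  assumes "c \<in> A" "p \<in> fst c" shows "D (transition c c) (snd c p) v = v"
proof -
  have "D (transition c c) (snd c p) = D (\<lambda>x. x) (snd c p)"
    by (rule D_cong[OF open_overlap[OF assms(1) assms(1)]]) (use assms in auto)
  then show ?thesis by simp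
qed

lemma tvec_of_chart: "c \<in> A \<Longrightarrow> p \<in> fst c \<Longrightarrow> tvec_of A c p y c = y"
  by (simp add: tvec_of_def D_transition_id del: o_apply)

lemma tvec_of_tangent: "c \<in> A \<Longrightarrow> p \<in> fst c \<Longrightarrow> tvec_of A c p y \<in> tangent_space A p"
  unfolding tangent_space_def tvec_of_def by (clarsimp simp: D_transition_cocycle simp del: o_apply)

lemma tangent_space_linear:
  assumes "u \<in> tangent_space A p" "v \<in> tangent_space A p"
  shows "(\<lambda>d. a *\<^sub>R u d + b *\<^sub>R v d) \<in> tangent_space A p"
  unfolding tangent_space_def
proof (intro CollectI conjI allI ballI impI)
  fix c assume "\<not> (c \<in> A \<and> p \<in> fst c)"
  then show "a *\<^sub>R u c + b *\<^sub>R v c = 0"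
    by (simp add: tangent_space_zero[OF assms(1)] tangent_space_zero[OF assms(2)])
next
  fix c d assume cd: "c \<in> A" "d \<in> A" "p \<in> fst c \<inter> fst d"
  then have "linear (D (transition c d) (snd c p))"
    by (intro linear_D transition_differentiable) auto
  then show "a *\<^sub>R u d + b *\<^sub>R v d = D (transition c d) (snd c p) (a *\<^sub>R u c + b *\<^sub>R v c)"
    using tangent_space_transition[OF assms(1), of c d] tangent_space_transition[OF assms(2), of c d] cd
    by (simp add: linear_add linear_scale)
qed

lemma zero_tangent: "(\<lambda>_. 0) \<in> tangent_space A p"
  unfolding tangent_space_def by (auto simp: linear_0 linear_D[OF transition_differentiable])

lemma differential_chart:
  assumes "c \<in> A" "p \<in> fst c" "v \<in> tangent_space A p" "(\<lambda>x. f (chart_inv c x)) differentiable (at (snd c p))"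
  shows "differential A f p v = D (\<lambda>x. f (chart_inv c x)) (snd c p) (v c)"
proof -
  define c' where "c' = chart_at A p"
  have c': "c' \<in> A" "p \<in> fst c'"
    unfolding c'_def chart_at_def using someI[of "\<lambda>c. c \<in> A \<and> p \<in> fst c" c] assms by auto
  have "D (\<lambda>x. f (chart_inv c' x)) (snd c' p) (v c')
      = D (\<lambda>x. f (chart_inv c x)) (snd c p) (D (transition c' c) (snd c' p) (v c'))"
    by (rule D_transition_compose(2)[OF c'(1) assms(1) c'(2) assms(2) openin_chart_domain[OF c'(1)] c'(2)])
      (use assms c' in auto)
  then show ?thesis
    using tangent_space_transition[OF assms(3) c'(1) assms(1) c'(2) assms(2)]
    by (simp add: differential_def Let_def c'_def[symmetric] o_def)
qed

lemma field_transition: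
  assumes "c \<in> A" "d \<in> A" "q \<in> fst c" "q \<in> fst d" "X q \<in> tangent_space A q"
  shows "X (chart_inv d (snd d q)) d = D (transition c d) (snd c q) (X (chart_inv c (snd c q)) c)"
  using tangent_space_transition[OF assms(5,1,2,3,4)] assms by simp

text \<open>Differentiating the rule \<open>X\<^sub>d = D\<tau> X\<^sub>c\<close> for a coordinate change \<open>\<tau>\<close> produces, besides the transformed
  derivative, the term \<open>D\<^sup>2\<tau> (X, Y)\<close>. By symmetry it cancels in the bracket.\<close>

lemma lie_bracket_tangent:
  assumes X: "field_differentiable_near A p X" and Y: "field_differentiable_near A p Y"
  shows "lie_bracket A X Y p \<in> tangent_space A p"
proof -
  obtain W where W: "openin (atlas_topology A) W" "p \<in> W" "\<And>q. q \<in> W \<Longrightarrow> X q \<in> tangent_space A q"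
    and dX: "\<And>c. c \<in> A \<Longrightarrow> p \<in> fst c \<Longrightarrow> (\<lambda>x. X (chart_inv c x) c) differentiable (at (snd c p))"
    using X unfolding field_differentiable_near_def by blast
  obtain W' where W': "openin (atlas_topology A) W'" "p \<in> W'" "\<And>q. q \<in> W' \<Longrightarrow> Y q \<in> tangent_space A q"
    and dY: "\<And>c. c \<in> A \<Longrightarrow> p \<in> fst c \<Longrightarrow> (\<lambda>x. Y (chart_inv c x) c) differentiable (at (snd c p))"
    using Y unfolding field_differentiable_near_def by blast
  \<comment> \<open>The transformation rule of a field \<open>Z\<close>, differentiated in the direction \<open>v\<close>.\<close>
  have key: "D (\<lambda>x. Z (chart_inv d x) d) (snd d p) (D (transition c d) (snd c p) v)
      = D (\<lambda>x. D (transition c d) x (Z p c)) (snd c p) v + D (transition c d) (snd c p) (D (\<lambda>x. Z (chart_inv c x) c) (snd c p) v)"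
    if cd: "c \<in> A" "d \<in> A" "p \<in> fst c" "p \<in> fst d"
      and V: "openin (atlas_topology A) V" "p \<in> V" "\<And>q. q \<in> V \<Longrightarrow> Z q \<in> tangent_space A q"
      and dZ: "\<And>c. c \<in> A \<Longrightarrow> p \<in> fst c \<Longrightarrow> (\<lambda>x. Z (chart_inv c x) c) differentiable (at (snd c p))"
    for c d Z V v
  proof -
    let ?\<tau> = "transition c d" and ?U = "snd c ` (fst c \<inter> fst d)"
    have "D (\<lambda>x. D ?\<tau> x (Z (chart_inv c x) c)) (snd c p) v
        = D (\<lambda>x. Z (chart_inv d x) d) (snd d p) (D ?\<tau> (snd c p) v)"
      by (rule D_transition_compose(2)[OF cd V(1,2) _ dZ[OF cd(2,4)]])
        (use field_transition[of c d _ Z] cd V(3) in simp)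
    moreover have "((\<lambda>x. D ?\<tau> x (Z (chart_inv c x) c)) has_derivative
       (\<lambda>h. D (\<lambda>x. D ?\<tau> x (Z (chart_inv c (snd c p)) c)) (snd c p) h + D ?\<tau> (snd c p) (D (\<lambda>x. Z (chart_inv c x) c) (snd c p) h))) (at (snd c p))"
    proof (rule has_derivative_linear_apply[OF open_overlap[OF cd(1,2)]])
      show "snd c p \<in> ?U" using cd by auto
      show "linear (D ?\<tau> x)" if "x \<in> ?U" for x
        using that transition_differentiable[OF cd(1,2)] by (auto intro: linear_D)
      show "(\<lambda>x. D ?\<tau> x v) differentiable (at (snd c p))" for v
        using transition_Ck[OF cd(1,2), of 2] cd by (simp add: numeral_2_eq_2)
    qed (rule dZ[OF cd(1,3)])
    ultimately show ?thesis
      using cd by (simp add: D_eq)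
  qed
  show ?thesis
    unfolding tangent_space_def
  proof (intro CollectI conjI allI ballI impI)
    fix c d assume "c \<in> A" "d \<in> A" "p \<in> fst c \<inter> fst d"
    then have cd: "c \<in> A" "d \<in> A" "p \<in> fst c" "p \<in> fst d" by auto
    have XY: "X p d = D (transition c d) (snd c p) (X p c)" "Y p d = D (transition c d) (snd c p) (Y p c)"
      using tangent_space_transition[OF W(3)[OF W(2)] cd] tangent_space_transition[OF W'(3)[OF W'(2)] cd] by auto
    have "D (\<lambda>x. D (transition c d) x (Y p c)) (snd c p) (X p c) = D (\<lambda>x. D (transition c d) x (X p c)) (snd c p) (Y p c)"
      using cd by (intro second_derivative_symmetric[OF open_overlap[OF cd(1,2)] transition_Ck]) auto
    then show "lie_bracket A X Y p d = D (transition c d) (snd c p) (lie_bracket A X Y p c)"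
      using cd key[OF cd W' dY, of "X p c"] key[OF cd W dX, of "Y p c"]
      by (simp add: lie_bracket_def XY linear_diff[OF linear_D[OF transition_differentiable[OF cd]]] del: o_apply)
  qed (auto simp: lie_bracket_def)
qed

text \<open>The field with constant component in one chart is smooth in every chart, as coordinate changes are smooth.\<close>

lemma local_extension_exists:
  assumes "c \<in> A" "p \<in> fst c" "v \<in> tangent_space A p"
  shows "\<exists>X. local_extension A p v X"
proof -
  define X where "X q = tvec_of A c q (v c)" for q
  have "Ck_on k ((\<lambda>q. X q d) \<circ> chart_inv d) (snd d ` (fst d \<inter> fst c))" if d: "d \<in> A" for d k
  proof -
    have "Ck_on k (\<lambda>x. D (transition c d) (transition d c x) (v c)) (snd d ` (fst d \<inter> fst c))"
      using transition_Ck[OF assms(1) d, of "Suc k"] d assms(1)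
      by (intro Ck_on_compose[OF open_overlap[OF d assms(1)] open_overlap[OF assms(1) d] _ transition_Ck[OF d assms(1)]])
        (auto simp: o_def)
    then show ?thesis
      by (subst Ck_on_cong[OF open_overlap[OF d assms(1)]]) (use d assms(1) in \<open>auto simp: X_def tvec_of_def o_def\<close>)
  qed
  then have "smooth_vfield A (fst c) X"
    using assms by (auto simp: smooth_vfield_def Ck_vfield_def Ck_fun_def X_def tvec_of_tangent)
  moreover have "X p = v"
    using assms by (intro tvec_eqI[OF _ assms(3,1,2)]) (auto simp: X_def tvec_of_tangent tvec_of_chart)
  ultimately show ?thesis
    unfolding local_extension_def using openin_chart_domain[OF assms(1)] assms(2) by blast
qed

lemma smooth_field_differentiable_near:
  assumes "openin (atlas_topology A) W" "p \<in> W" "smooth_vfield A W X"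
  shows "field_differentiable_near A p X"
proof -
  have "Ck_vfield A 1 W X" using assms(3) by (simp add: smooth_vfield_def)
  then have "(\<lambda>x. X (chart_inv c x) c) differentiable (at (snd c p))" if "c \<in> A" "p \<in> fst c" for c
    using that assms(2) by (auto simp: Ck_vfield_def Ck_fun_def o_def)
  then show ?thesis
    using assms unfolding field_differentiable_near_def smooth_vfield_def Ck_vfield_def by blast
qed

lemma local_extension_differentiable:
  "local_extension A p v X \<Longrightarrow> field_differentiable_near A p X \<and> X p = v"
  unfolding local_extension_def using smooth_field_differentiable_near by blast

end

section \<open>The tangent manifold\<close>

text \<open>The inverse of a tangent chart, written explicitly: the point with coordinates \<open>x\<close> and the tangent vector
  with component \<open>y\<close>.\<close>

definition tpoint_of :: "('p, 'e::euclidean_space) chart set \<Rightarrow> ('p, 'e) chart \<Rightarrow> 'e \<times> 'e \<Rightarrow> ('p, 'e) tpoint" where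
  "tpoint_of A c z = (chart_inv c (fst z), tvec_of A c (chart_inv c (fst z)) (snd z))"

lemma tangent_chart_domain: "q \<in> fst (tangent_chart A c) \<longleftrightarrow> q \<in> TM A \<and> fst q \<in> fst c"
  by (simp add: tangent_chart_def)

lemma tangent_chart_map [simp]: "snd (tangent_chart A c) q = (snd c (fst q), snd q c)"
  by (simp add: tangent_chart_def)

lemma tangent_atlasE: "d \<in> tangent_atlas A \<Longrightarrow> (\<And>c. c \<in> A \<Longrightarrow> d = tangent_chart A c \<Longrightarrow> thesis) \<Longrightarrow> thesis"
  by (auto simp: tangent_atlas_def)

lemma tangent_chart_mem [simp]: "c \<in> A \<Longrightarrow> tangent_chart A c \<in> tangent_atlas A"
  by (simp add: tangent_atlas_def)

lemma slit_TM_subset: "slit_TM A \<subseteq> TM A"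
  by (auto simp: slit_TM_def)

context
  fixes A :: "('p, 'e::euclidean_space) chart set"
  assumes A: "smooth_atlas A"
begin

lemma tpoint_of_chart:
  assumes "c \<in> A" "q \<in> fst (tangent_chart A c)"
  shows "tpoint_of A c (snd c (fst q), snd q c) = q"
proof -
  have q: "fst q \<in> fst c" "snd q \<in> tangent_space A (fst q)"
    using assms by (auto simp: tangent_chart_domain TM_def)
  have "tvec_of A c (fst q) (snd q c) = snd q"
    by (rule tvec_eqI[OF tvec_of_tangent[OF A assms(1) q(1)] q(2) assms(1) q(1)])
      (rule tvec_of_chart[OF A assms(1) q(1)])
  then show ?thesis
    using q(1) assms(1) A by (simp add: tpoint_of_def prod_eq_iff)
qed

lemma tpoint_of_mem:
  assumes "c \<in> A" "fst z \<in> snd c ` fst c"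
  shows "tpoint_of A c z \<in> fst (tangent_chart A c)" "snd (tangent_chart A c) (tpoint_of A c z) = z"
proof -
  have x: "chart_inv c (fst z) \<in> fst c" "snd c (chart_inv c (fst z)) = fst z"
    using chart_inv_mem[OF A assms(1), of "fst z" UNIV] chart_chart_inv[OF A assms(1), of "fst z" UNIV] assms(2) by auto
  show "tpoint_of A c z \<in> fst (tangent_chart A c)"
    using x(1) assms(1) tvec_of_tangent[OF A assms(1) x(1)]
    by (auto simp: tangent_chart_domain tpoint_of_def TM_def carrier_def)
  show "snd (tangent_chart A c) (tpoint_of A c z) = z"
    using x by (simp add: tpoint_of_def tvec_of_chart[OF A assms(1)])
qed

lemma inj_on_tangent_chart: "c \<in> A \<Longrightarrow> inj_on (snd (tangent_chart A c)) (fst (tangent_chart A c))"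
  by (rule inj_on_inverseI[of _ "tpoint_of A c"]) (simp add: tpoint_of_chart)

lemma chart_inv_tangent_chart:
  assumes "c \<in> A" "fst z \<in> snd c ` fst c"
  shows "chart_inv (tangent_chart A c) z = tpoint_of A c z"
  unfolding chart_inv_def
  by (rule inv_into_f_eq[OF inj_on_tangent_chart[OF assms(1)] tpoint_of_mem[OF assms]])

lemma tangent_chart_image:
  assumes "c \<in> A"
  shows "snd (tangent_chart A c) ` (fst (tangent_chart A c) \<inter> Q) = {z. fst z \<in> snd c ` fst c \<and> tpoint_of A c z \<in> Q}"
proof (intro equalityI subsetI)
  fix z assume "z \<in> snd (tangent_chart A c) ` (fst (tangent_chart A c) \<inter> Q)"
  then obtain q where "q \<in> fst (tangent_chart A c)" "q \<in> Q" "z = (snd c (fst q), snd q c)" by auto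
  then show "z \<in> {z. fst z \<in> snd c ` fst c \<and> tpoint_of A c z \<in> Q}"
    using tpoint_of_chart[OF assms] by (auto simp: tangent_chart_domain)
next
  fix z assume "z \<in> {z. fst z \<in> snd c ` fst c \<and> tpoint_of A c z \<in> Q}"
  then show "z \<in> snd (tangent_chart A c) ` (fst (tangent_chart A c) \<inter> Q)"
    using tpoint_of_mem[OF assms, of z] by (metis (mono_tags, lifting) IntI image_eqI mem_Collect_eq)
qed

lemma tangent_overlap:
  assumes "c \<in> A" "d \<in> A"
  shows "snd (tangent_chart A c) ` (fst (tangent_chart A c) \<inter> fst (tangent_chart A d)) = snd c ` (fst c \<inter> fst d) \<times> UNIV"
proof -
  have "tpoint_of A c z \<in> fst (tangent_chart A d) \<longleftrightarrow> fst z \<in> snd c ` (fst c \<inter> fst d)" if z: "fst z \<in> snd c ` fst c" for z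
  proof -
    obtain p where p: "p \<in> fst c" "fst z = snd c p" using z by auto
    have "inj_on (snd c) (fst c)" using A assms(1) by (simp add: smooth_atlas_def)
    then have "snd c p \<in> snd c ` (fst c \<inter> fst d) \<longleftrightarrow> p \<in> fst d"
      using p(1) by (auto dest: inj_onD)
    then show ?thesis
      using tpoint_of_mem(1)[OF assms(1) z] p assms(1) A
      by (auto simp: tangent_chart_domain tpoint_of_def)
  qed
  then show ?thesis
    unfolding tangent_chart_image[OF assms(1)] by auto
qed

lemma tangent_chart_range:
  assumes "c \<in> A"
  shows "snd (tangent_chart A c) ` (fst (tangent_chart A c) \<inter> TM A) = snd c ` fst c \<times> UNIV"
  unfolding tangent_chart_image[OF assms]
  using tpoint_of_mem(1)[OF assms] by (auto simp: tangent_chart_domain)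

lemma zero_vector_iff:
  assumes "c \<in> A" "q \<in> fst (tangent_chart A c)"
  shows "snd q = (\<lambda>_. 0) \<longleftrightarrow> snd q c = 0"
  using tvec_eqI[of "snd q" A "fst q" "\<lambda>_. 0" c] assms zero_tangent[OF A]
  by (auto simp: tangent_chart_domain TM_def)

lemma tangent_chart_slit:
  assumes "c \<in> A"
  shows "snd (tangent_chart A c) ` (fst (tangent_chart A c) \<inter> slit_TM A) = slit (snd c ` fst c)"
proof -
  have "tpoint_of A c z \<in> slit_TM A \<longleftrightarrow> snd z \<noteq> 0" if "fst z \<in> snd c ` fst c" for z
    using zero_vector_iff[OF assms tpoint_of_mem(1)[OF assms that]] tpoint_of_mem[OF assms that]
    by (cases z) (auto simp: slit_TM_def tangent_chart_domain)
  then show ?thesis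
    unfolding tangent_chart_image[OF assms] by (auto simp: slit_iff)
qed

lemma slit_TM_chart:
  assumes "c \<in> A" "q \<in> slit_TM A" "fst q \<in> fst c"
  shows "q \<in> fst (tangent_chart A c)" "snd (tangent_chart A c) q \<in> slit (snd c ` fst c)"
  using assms zero_vector_iff[OF assms(1), of q]
  by (auto simp: tangent_chart_domain slit_TM_def slit_iff)

lemma open_chart_range: "c \<in> A \<Longrightarrow> open (snd c ` fst c)"
  using open_overlap[OF A, of c c] by simp

text \<open>The coordinate change is \<open>(x, y) \<mapsto> (\<tau> x, D\<tau> x y)\<close>; the tangent manifold is smooth because it is linear in
  \<open>y\<close> with smooth coefficients.\<close>

lemma tangent_transition:
  assumes "c \<in> A" "d \<in> A" "fst z \<in> snd c ` (fst c \<inter> fst d)"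
  shows "transition (tangent_chart A c) (tangent_chart A d) z =
    (transition c d (fst z), D (transition c d) (fst z) (snd z))"
proof -
  have "fst z \<in> snd c ` fst c" "chart_inv c (fst z) \<in> fst d" "snd c (chart_inv c (fst z)) = fst z"
    using assms A by auto
  then show ?thesis
    using assms(1,2) by (simp add: chart_inv_tangent_chart tpoint_of_def tvec_of_def)
qed

lemma smooth_tangent_atlas: "smooth_atlas (tangent_atlas A)"
  unfolding smooth_atlas_def
proof (intro conjI ballI allI)
  fix c assume "c \<in> tangent_atlas A"
  then show "inj_on (snd c) (fst c)"
    by (auto elim!: tangent_atlasE intro: inj_on_tangent_chart)
next
  fix c d assume "c \<in> tangent_atlas A" "d \<in> tangent_atlas A"
  then obtain c' d' where c: "c' \<in> A" "c = tangent_chart A c'" and d: "d' \<in> A" "d = tangent_chart A d'"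
    by (auto elim!: tangent_atlasE)
  let ?O = "snd c' ` (fst c' \<inter> fst d')"
  have O: "open ?O" "open (?O \<times> (UNIV :: 'e set))"
    using open_overlap[OF A c(1) d(1)] by (auto intro: open_Times)
  then show "open (snd c ` (fst c \<inter> fst d))"
    unfolding c(2) d(2) tangent_overlap[OF c(1) d(1)] by simp
  fix k
  have 1: "Ck_on k (\<lambda>z. transition c' d' (fst z)) (?O \<times> (UNIV :: 'e set))"
    by (intro Ck_on_compose[OF O(2,1) _ Ck_on_linear[OF O(2)], of fst k "transition c' d'"]
        transition_Ck[OF A c(1) d(1)]) (auto intro: linearI)
  have 2: "Ck_on k (\<lambda>z. D (transition c' d') (fst z) v) (?O \<times> (UNIV :: 'e set))" for v
    using transition_Ck[OF A c(1) d(1), of "Suc k"]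
    by (intro Ck_on_compose[OF O(2,1) _ Ck_on_linear[OF O(2)], of fst k "\<lambda>x. D (transition c' d') x v"])
      (auto intro: linearI)
  have "Ck_on k (\<lambda>z. (transition c' d' (fst z), D (transition c' d') (fst z) (snd z))) (?O \<times> UNIV)"
  proof (intro Ck_on_Pair[OF O(2) 1] Ck_on_linear_apply[OF O(2) _ 2 Ck_on_linear[OF O(2)]])
    fix z assume "z \<in> ?O \<times> (UNIV :: 'e set)"
    then show "linear (D (transition c' d') (fst z))"
      by (intro linear_D) (auto intro: transition_differentiable[OF A c(1) d(1)])
  qed (auto intro: linearI)
  then show "Ck_on k (snd d \<circ> chart_inv c) (snd c ` (fst c \<inter> fst d))"
    unfolding c(2) d(2) tangent_overlap[OF c(1) d(1)]
    by (subst Ck_on_cong[OF O(2)]) (auto simp: tangent_transition[OF c(1) d(1)] simp del: o_apply)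
qed

lemma carrier_tangent_atlas: "carrier (tangent_atlas A) = TM A"
proof -
  have "q \<in> (\<Union>c\<in>A. fst (tangent_chart A c)) \<longleftrightarrow> q \<in> TM A" for q
    unfolding UN_iff tangent_chart_domain TM_def carrier_def by blast
  then show ?thesis
    by (auto simp: carrier_def tangent_atlas_def)
qed

lemma openin_slit_TM: "openin (atlas_topology (tangent_atlas A)) (slit_TM A)"
  unfolding openin_atlas_topology[OF smooth_tangent_atlas] carrier_tangent_atlas
proof (intro conjI ballI slit_TM_subset)
  fix c assume "c \<in> tangent_atlas A"
  then obtain c' where c: "c' \<in> A" "c = tangent_chart A c'" by (rule tangent_atlasE)
  show "open (snd c ` (fst c \<inter> slit_TM A))"
    unfolding c(2) tangent_chart_slit[OF c(1)] by (intro open_slit open_chart_range c(1))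
qed

text \<open>The derivative of \<open>(x, y) \<mapsto> (\<tau> x, D\<tau> x y)\<close> maps base parts by \<open>D\<tau>\<close> and vertical vectors \<open>(0, b)\<close> to
  \<open>(0, D\<tau> b)\<close>. These two facts make \<open>J\<close> and the Liouville field well defined.\<close>

lemma D_tangent_transition:
  assumes "c \<in> A" "d \<in> A" "q \<in> TM A" "fst q \<in> fst c" "fst q \<in> fst d"
  shows "fst (D (transition (tangent_chart A c) (tangent_chart A d)) (snd c (fst q), snd q c) u)
      = D (transition c d) (snd c (fst q)) (fst u)"
    and "D (transition (tangent_chart A c) (tangent_chart A d)) (snd c (fst q), snd q c) (0, b)
      = (0, D (transition c d) (snd c (fst q)) b)"
proof -
  let ?f = "transition (tangent_chart A c) (tangent_chart A d)" and ?z = "(snd c (fst q), snd q c)"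
  let ?O = "snd c ` (fst c \<inter> fst d)"
  have O: "open ?O" "open (?O \<times> (UNIV :: 'e set))" "?z \<in> ?O \<times> UNIV" "snd c (fst q) \<in> ?O"
    using open_overlap[OF A assms(1,2)] assms(4,5) by (auto intro: open_Times)
  have df: "?f differentiable (at ?z)"
    using transition_differentiable[OF smooth_tangent_atlas, of "tangent_chart A c" "tangent_chart A d" q] assms
    by (simp add: tangent_chart_domain)
  have d\<tau>: "transition c d differentiable (at (snd c (fst q)))"
    by (rule transition_differentiable[OF A assms(1,2,4,5)])
  have "fst (D ?f ?z u) = D (\<lambda>z. fst (?f z)) ?z u"
    by (simp only: D_bounded_linear[OF bounded_linear_fst df])
  also have "D (\<lambda>z. fst (?f z)) ?z = D (\<lambda>z. transition c d (fst z)) ?z"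
    by (rule D_cong[OF O(2,3)]) (auto simp: tangent_transition[OF assms(1,2)] simp del: o_apply)
  also have "\<dots> = (\<lambda>u. D (transition c d) (snd c (fst q)) (fst u))"
  proof (rule D_eq, rule has_derivative_compose[of fst fst ?z UNIV "transition c d"])
    show "(fst has_derivative fst) (at ?z)"
      by (intro bounded_linear_imp_has_derivative bounded_linear_fst)
    show "(transition c d has_derivative D (transition c d) (snd c (fst q))) (at (fst ?z))"
      using D_works[OF d\<tau>] by simp
  qed
  finally show "fst (D ?f ?z u) = D (transition c d) (snd c (fst q)) (fst u)" .
  have ray: "((\<lambda>y. (snd c (fst q), y)) has_derivative (\<lambda>b. (0, b))) (at (snd q c))"
    by (intro has_derivative_Pair has_derivative_const has_derivative_ident)
  have "((\<lambda>y. ?f (snd c (fst q), y)) has_derivative (\<lambda>b. D ?f ?z (0, b))) (at (snd q c))"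
    by (rule has_derivative_compose[of "\<lambda>y. (snd c (fst q), y)" _ "snd q c" UNIV ?f, OF ray D_works[OF df]])
  moreover have "(\<lambda>y. ?f (snd c (fst q), y)) = (\<lambda>y. (transition c d (snd c (fst q)), D (transition c d) (snd c (fst q)) y))"
    using O(4) by (simp add: tangent_transition[OF assms(1,2)] del: o_apply)
  moreover have "((\<lambda>y. (transition c d (snd c (fst q)), D (transition c d) (snd c (fst q)) y)) has_derivative
      (\<lambda>b. (0, D (transition c d) (snd c (fst q)) b))) (at (snd q c))"
    by (intro has_derivative_Pair has_derivative_const bounded_linear_imp_has_derivative
        linear_conv_bounded_linear[THEN iffD1] linear_D d\<tau>)
  ultimately have "(\<lambda>b. D ?f ?z (0, b)) = (\<lambda>b. (0, D (transition c d) (snd c (fst q)) b))"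
    by (metis has_derivative_unique)
  then show "D ?f ?z (0, b) = (0, D (transition c d) (snd c (fst q)) b)"
    by (rule fun_cong)
qed

section \<open>The vertical endomorphism and the Liouville field in charts\<close>

lemma vertical_lift_chart:
  assumes "c \<in> A" "q \<in> fst (tangent_chart A c)"
  shows "vertical_lift A q v (tangent_chart A c) = (0, v c)"
proof -
  have "((\<lambda>t. snd (tangent_chart A c) (fst q, \<lambda>c. snd q c + t *\<^sub>R v c)) has_vector_derivative (0, 0 + 1 *\<^sub>R v c)) (at 0)"
    unfolding tangent_chart_map fst_conv snd_conv
    by (intro has_vector_derivative_Pair has_vector_derivative_const has_vector_derivative_add_const[THEN iffD2])
      (auto intro!: derivative_eq_intros)
  then show ?thesis
    using assms by (simp add: vertical_lift_def vector_derivative_at)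
qed

lemma vertical_lift_outside: "\<not> (d \<in> tangent_atlas A \<and> q \<in> fst d) \<Longrightarrow> vertical_lift A q v d = 0"
  unfolding vertical_lift_def by (rule if_not_P)

lemma liouville_chart:
  "c \<in> A \<Longrightarrow> q \<in> fst (tangent_chart A c) \<Longrightarrow> liouville A q (tangent_chart A c) = (0, snd q c)"
  by (simp add: liouville_def vertical_lift_chart)

text \<open>Here the chart chosen in \<open>differential\<close> is replaced by any given one.\<close>

lemma tangent_map_fst_chart:
  assumes "c \<in> A" "q \<in> fst (tangent_chart A c)" "u \<in> tangent_space (tangent_atlas A) q"
  shows "tangent_map (tangent_atlas A) A fst q u c = fst (u (tangent_chart A c))"
proof -
  let ?z = "snd (tangent_chart A c) q"
  have q: "fst q \<in> fst c" using assms(2) by (simp add: tangent_chart_domain)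
  have O: "open (snd c ` fst c \<times> (UNIV :: 'e set))" "?z \<in> snd c ` fst c \<times> UNIV"
    using open_chart_range[OF assms(1)] q by (auto intro: open_Times)
  have eq: "fst z = (snd c \<circ> fst) (chart_inv (tangent_chart A c) z)" if "z \<in> snd c ` fst c \<times> UNIV" for z
    using that tpoint_of_mem(2)[OF assms(1), of z] by (auto simp: chart_inv_tangent_chart[OF assms(1)])
  have fst: "(fst has_derivative fst) (at ?z)"
    by (intro bounded_linear_imp_has_derivative bounded_linear_fst)
  have d: "(\<lambda>z. (snd c \<circ> fst) (chart_inv (tangent_chart A c) z)) differentiable (at ?z)"
    by (rule differentiable_cong_open[OF O eq differentiableI[OF fst]])
  have "differential (tangent_atlas A) (snd c \<circ> fst) q u
      = D (\<lambda>z. (snd c \<circ> fst) (chart_inv (tangent_chart A c) z)) ?z (u (tangent_chart A c))"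
    by (rule differential_chart[OF smooth_tangent_atlas _ assms(2,3) d]) (simp add: assms(1))
  also have "\<dots> = fst (u (tangent_chart A c))"
  proof -
    have "D fst ?z = D (\<lambda>z. (snd c \<circ> fst) (chart_inv (tangent_chart A c) z)) ?z"
      by (rule D_cong[OF O eq])
    then show ?thesis by (simp only: D_eq[OF fst])
  qed
  finally show ?thesis
    using assms(1) q by (simp add: tangent_map_def)
qed

lemma vertical_endo_chart:
  assumes "c \<in> A" "q \<in> fst (tangent_chart A c)" "u \<in> tangent_space (tangent_atlas A) q"
  shows "vertical_endo A q u (tangent_chart A c) = vert (u (tangent_chart A c))"
  by (simp add: vertical_endo_def vertical_lift_chart[OF assms(1,2)] tangent_map_fst_chart[OF assms] vert_def)

lemma tangent_fun_eqI:
  assumes "\<And>d. \<not> (d \<in> tangent_atlas A \<and> q \<in> fst d) \<Longrightarrow> u d = v d"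
    and "\<And>c. c \<in> A \<Longrightarrow> q \<in> fst (tangent_chart A c) \<Longrightarrow> u (tangent_chart A c) = v (tangent_chart A c)"
  shows "u = v"
proof
  fix d
  show "u d = v d"
    using assms tangent_atlasE by (cases "d \<in> tangent_atlas A \<and> q \<in> fst d") blast+
qed

lemma tangent_memI:
  assumes "\<And>d. \<not> (d \<in> tangent_atlas A \<and> q \<in> fst d) \<Longrightarrow> u d = 0"
    and "\<And>c d. c \<in> A \<Longrightarrow> d \<in> A \<Longrightarrow> q \<in> TM A \<Longrightarrow> fst q \<in> fst c \<Longrightarrow> fst q \<in> fst d \<Longrightarrow> u (tangent_chart A d) =
        D (transition (tangent_chart A c) (tangent_chart A d)) (snd c (fst q), snd q c) (u (tangent_chart A c))"
  shows "u \<in> tangent_space (tangent_atlas A) q"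
  unfolding tangent_space_def
proof (intro CollectI conjI allI ballI impI)
  fix c d assume cd: "c \<in> tangent_atlas A" "d \<in> tangent_atlas A" "q \<in> fst c \<inter> fst d"
  obtain c' d' where c: "c' \<in> A" "c = tangent_chart A c'" and d: "d' \<in> A" "d = tangent_chart A d'"
    using cd(1,2) by (auto elim!: tangent_atlasE)
  show "u d = D (transition c d) (snd c q) (u c)"
    using assms(2)[OF c(1) d(1)] cd(3) unfolding c(2) d(2) tangent_chart_map
    by (simp add: tangent_chart_domain del: o_apply)
qed (rule assms(1))

lemma vertical_endo_tangent:
  assumes "u \<in> tangent_space (tangent_atlas A) q"
  shows "vertical_endo A q u \<in> tangent_space (tangent_atlas A) q"
proof (rule tangent_memI)
  fix c d assume cd: "c \<in> A" "d \<in> A" "q \<in> TM A" "fst q \<in> fst c" "fst q \<in> fst d"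
  then have q: "q \<in> fst (tangent_chart A c)" "q \<in> fst (tangent_chart A d)"
    by (auto simp: tangent_chart_domain)
  have "u (tangent_chart A d) = D (transition (tangent_chart A c) (tangent_chart A d)) (snd c (fst q), snd q c) (u (tangent_chart A c))"
    using tangent_space_transition[OF assms, of "tangent_chart A c" "tangent_chart A d"] cd q by simp
  then have "fst (u (tangent_chart A d)) = D (transition c d) (snd c (fst q)) (fst (u (tangent_chart A c)))"
    using D_tangent_transition(1)[OF cd] by simp
  then show "vertical_endo A q u (tangent_chart A d) =
      D (transition (tangent_chart A c) (tangent_chart A d)) (snd c (fst q), snd q c) (vertical_endo A q u (tangent_chart A c))"
    using vertical_endo_chart[OF cd(1) q(1) assms] vertical_endo_chart[OF cd(2) q(2) assms] D_tangent_transition(2)[OF cd]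
    by (simp add: vert_def)
qed (simp add: vertical_endo_def vertical_lift_outside)

end

section \<open>Coordinates on the tangent manifold\<close>

definition field_coords ::
    "('p, 'e::euclidean_space) chart set \<Rightarrow> ('p, 'e) chart \<Rightarrow> (('p, 'e) tpoint, 'e \<times> 'e) vfield \<Rightarrow> 'e \<times> 'e \<Rightarrow> 'e \<times> 'e" where
  "field_coords A c X z = X (chart_inv (tangent_chart A c) z) (tangent_chart A c)"

definition fun_coords ::
    "('p, 'e::euclidean_space) chart set \<Rightarrow> ('p, 'e) chart \<Rightarrow> (('p, 'e) tpoint \<Rightarrow> 'b) \<Rightarrow> 'e \<times> 'e \<Rightarrow> 'b" where
  "fun_coords A c f z = f (chart_inv (tangent_chart A c) z)"

abbreviation range_of :: "('p, 'e) chart \<Rightarrow> 'e set" where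
  "range_of c \<equiv> snd c ` fst c"

lemma Ck_vfield_coords:
  "Ck_vfield (tangent_atlas A) k W X \<longleftrightarrow> (\<forall>q\<in>W. X q \<in> tangent_space (tangent_atlas A) q) \<and>
     (\<forall>c\<in>A. Ck_on k (field_coords A c X) (snd (tangent_chart A c) ` (fst (tangent_chart A c) \<inter> W)))"
proof -
  have "(\<lambda>q. X q d) \<circ> chart_inv d = field_coords A c X" if "d = tangent_chart A c" for c d
    by (simp add: that fun_eq_iff field_coords_def)
  then show ?thesis
    unfolding Ck_vfield_def Ck_fun_def tangent_atlas_def by simp
qed

context
  fixes A :: "('p, 'e::euclidean_space) chart set"
  assumes A: "smooth_atlas A"
begin

lemma chart_inv_tangent [simp]:
  "c \<in> A \<Longrightarrow> q \<in> fst (tangent_chart A c) \<Longrightarrow> chart_inv (tangent_chart A c) (snd c (fst q), snd q c) = q"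
  using chart_inv_chart[OF smooth_tangent_atlas[OF A], of "tangent_chart A c" q] by simp

lemma field_coords_chart:
  "c \<in> A \<Longrightarrow> q \<in> fst (tangent_chart A c) \<Longrightarrow> field_coords A c X (snd c (fst q), snd q c) = X q (tangent_chart A c)"
  by (simp add: field_coords_def)

lemma fun_coords_chart:
  "c \<in> A \<Longrightarrow> q \<in> fst (tangent_chart A c) \<Longrightarrow> fun_coords A c f (snd c (fst q), snd q c) = f q"
  by (simp add: fun_coords_def)

lemma coords_point:
  assumes "c \<in> A" "z \<in> range_of c \<times> UNIV"
  obtains q where "q \<in> fst (tangent_chart A c)" "q \<in> TM A" "fst q \<in> fst c" "z = (snd c (fst q), snd q c)"
proof -
  have "fst z \<in> range_of c" using assms(2) by (auto simp: mem_Times_iff)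
  then show thesis
    using tpoint_of_mem[OF A assms(1), of z] that[of "tpoint_of A c z"]
    by (simp add: tangent_chart_domain)
qed

lemma coords_slit_point:
  assumes "c \<in> A" "z \<in> slit (range_of c)"
  obtains q where "q \<in> fst (tangent_chart A c)" "q \<in> slit_TM A" "fst q \<in> fst c" "z = (snd c (fst q), snd q c)"
proof -
  have "z \<in> snd (tangent_chart A c) ` (fst (tangent_chart A c) \<inter> slit_TM A)"
    unfolding tangent_chart_slit[OF A assms(1)] by (rule assms(2))
  then show thesis
    using that by (auto simp: tangent_chart_domain)
qed

lemma smooth_vfield_coords:
  "smooth_vfield (tangent_atlas A) (slit_TM A) X \<longleftrightarrow> (\<forall>q\<in>slit_TM A. X q \<in> tangent_space (tangent_atlas A) q) \<and>
     (\<forall>c\<in>A. \<forall>k. Ck_on k (field_coords A c X) (slit (range_of c)))"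
  unfolding smooth_vfield_def Ck_vfield_coords using tangent_chart_slit[OF A] by metis

lemma tangent_extension:
  assumes "c \<in> A" "q \<in> fst (tangent_chart A c)"
  obtains u where "u \<in> tangent_space (tangent_atlas A) q" "u (tangent_chart A c) = a"
  using assms tvec_of_tangent[OF smooth_tangent_atlas[OF A]] tvec_of_chart[OF smooth_tangent_atlas[OF A]]
    tangent_chart_mem by metis

lemma field_differentiable_coords:
  assumes "field_differentiable_near (tangent_atlas A) q X" "c \<in> A" "q \<in> fst (tangent_chart A c)"
  shows "field_coords A c X differentiable (at (snd c (fst q), snd q c))"
proof -
  have "(\<lambda>z. X (chart_inv (tangent_chart A c) z) (tangent_chart A c)) differentiable (at (snd (tangent_chart A c) q))"
    using assms(1) assms(2,3) unfolding field_differentiable_near_def by (metis tangent_chart_mem)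
  then show ?thesis
    by (simp add: field_coords_def[abs_def])
qed

lemma field_near_coords:
  assumes "field_differentiable_near (tangent_atlas A) q X" "c \<in> A" "q \<in> fst (tangent_chart A c)"
  obtains O' where "open O'" "(snd c (fst q), snd q c) \<in> O'"
    "\<And>z. z \<in> O' \<Longrightarrow> \<exists>q'\<in>fst (tangent_chart A c). z = (snd c (fst q'), snd q' c) \<and> X q' \<in> tangent_space (tangent_atlas A) q'"
proof -
  obtain W where W: "openin (atlas_topology (tangent_atlas A)) W" "q \<in> W" "\<And>q. q \<in> W \<Longrightarrow> X q \<in> tangent_space (tangent_atlas A) q"
    using assms(1) unfolding field_differentiable_near_def by blast
  let ?O = "snd (tangent_chart A c) ` (fst (tangent_chart A c) \<inter> W)"
  show thesis
  proof (rule that[of ?O])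
    show "open ?O"
      using assms(2) by (intro open_chart_image[OF smooth_tangent_atlas[OF A] _ W(1)]) simp
    show "(snd c (fst q), snd q c) \<in> ?O"
      using assms(3) W(2) by force
  qed (use W(3) in auto)
qed

section \<open>The bracket of the vertical endomorphism with a field\<close>

text \<open>The coordinate expression of \<open>J\<close> is constant, so \<open>J\<close> commutes with differentiation of components.\<close>

lemma vertical_endo_field:
  assumes X: "field_differentiable_near (tangent_atlas A) q X"
  shows "field_differentiable_near (tangent_atlas A) q (\<lambda>q. vertical_endo A q (X q))"
    and "\<lbrakk>c \<in> A; q \<in> fst (tangent_chart A c)\<rbrakk> \<Longrightarrow>
      D (field_coords A c (\<lambda>q. vertical_endo A q (X q))) (snd c (fst q), snd q c) v
        = vert (D (field_coords A c X) (snd c (fst q), snd q c) v)"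
proof -
  have bl: "bounded_linear (vert :: 'e \<times> 'e \<Rightarrow> 'e \<times> 'e)"
    using linear_vert linear_conv_bounded_linear by blast
  have d: "field_coords A c (\<lambda>q. vertical_endo A q (X q)) differentiable (at (snd c (fst q), snd q c)) \<and>
      D (field_coords A c (\<lambda>q. vertical_endo A q (X q))) (snd c (fst q), snd q c)
        = (\<lambda>v. vert (D (field_coords A c X) (snd c (fst q), snd q c) v))"
    if c: "c \<in> A" "q \<in> fst (tangent_chart A c)" for c
  proof -
    obtain O' where O': "open O'" "(snd c (fst q), snd q c) \<in> O'"
      "\<And>z. z \<in> O' \<Longrightarrow> \<exists>q'\<in>fst (tangent_chart A c). z = (snd c (fst q'), snd q' c) \<and> X q' \<in> tangent_space (tangent_atlas A) q'"
      using field_near_coords[OF X c] by metis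
    have eq: "vert (field_coords A c X z) = field_coords A c (\<lambda>q. vertical_endo A q (X q)) z" if "z \<in> O'" for z
    proof -
      obtain q' where q': "q' \<in> fst (tangent_chart A c)" "z = (snd c (fst q'), snd q' c)"
        "X q' \<in> tangent_space (tangent_atlas A) q'"
        using O'(3)[OF \<open>z \<in> O'\<close>] by metis
      show ?thesis
        unfolding q'(2) field_coords_chart[OF c(1) q'(1)] vertical_endo_chart[OF A c(1) q'(1,3)] ..
    qed
    have dX: "field_coords A c X differentiable (at (snd c (fst q), snd q c))"
      by (rule field_differentiable_coords[OF X c])
    have "D (\<lambda>z. vert (field_coords A c X z)) (snd c (fst q), snd q c)
        = D (field_coords A c (\<lambda>q. vertical_endo A q (X q))) (snd c (fst q), snd q c)"
      by (rule D_cong[OF O'(1,2) eq])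
    then show ?thesis
      using differentiable_cong_open[OF O'(1,2) eq differentiable_bounded_linear[OF bl dX]]
      by (simp add: D_bounded_linear[OF bl dX])
  qed
  then show "\<lbrakk>c \<in> A; q \<in> fst (tangent_chart A c)\<rbrakk> \<Longrightarrow>
      D (field_coords A c (\<lambda>q. vertical_endo A q (X q))) (snd c (fst q), snd q c) v
        = vert (D (field_coords A c X) (snd c (fst q), snd q c) v)"
    by simp
  obtain W where W: "openin (atlas_topology (tangent_atlas A)) W" "q \<in> W" "\<And>q. q \<in> W \<Longrightarrow> X q \<in> tangent_space (tangent_atlas A) q"
    using X unfolding field_differentiable_near_def by blast
  have "(\<lambda>z. vertical_endo A (chart_inv e z) (X (chart_inv e z)) e) differentiable (at (snd e q))"
    if e: "e \<in> tangent_atlas A" "q \<in> fst e" for e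
  proof -
    obtain c where c: "c \<in> A" "e = tangent_chart A c" using e(1) by (rule tangent_atlasE)
    have "field_coords A c (\<lambda>q. vertical_endo A q (X q)) differentiable (at (snd c (fst q), snd q c))"
      using d[OF c(1)] e(2) c(2) by blast
    then show ?thesis
      unfolding field_coords_def[abs_def] c(2) tangent_chart_map .
  qed
  then show "field_differentiable_near (tangent_atlas A) q (\<lambda>q. vertical_endo A q (X q))"
    unfolding field_differentiable_near_def using W vertical_endo_tangent[OF A] by blast
qed

lemma lie_bracket_chart:
  assumes "c \<in> A" "q \<in> fst (tangent_chart A c)"
  shows "lie_bracket (tangent_atlas A) X Y q (tangent_chart A c) =
    D (field_coords A c Y) (snd c (fst q), snd q c) (X q (tangent_chart A c))
    - D (field_coords A c X) (snd c (fst q), snd q c) (Y q (tangent_chart A c))"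
  using assms by (simp add: lie_bracket_def field_coords_def[abs_def])

text \<open>In \<open>[J X, Y] - J [X, Y]\<close> the derivative of \<open>X\<close> occurs as \<open>- J (DX Y)\<close> in the first bracket and cancels. The
  rest depends on the value \<open>u\<close> of \<open>X\<close> only, so all local extensions of \<open>u\<close> give the same vector.\<close>

lemma fn_bracket_vertical_endo:
  assumes Y: "field_differentiable_near (tangent_atlas A) q Y" and q: "q \<in> TM A"
    and u: "u \<in> tangent_space (tangent_atlas A) q"
  shows "fn_bracket (tangent_atlas A) (vertical_endo A) Y q u \<in> tangent_space (tangent_atlas A) q"
    and "\<lbrakk>c \<in> A; q \<in> fst (tangent_chart A c)\<rbrakk> \<Longrightarrow>
      fn_bracket (tangent_atlas A) (vertical_endo A) Y q u (tangent_chart A c) =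
        D (field_coords A c Y) (snd c (fst q), snd q c) (vert (u (tangent_chart A c)))
        - vert (D (field_coords A c Y) (snd c (fst q), snd q c) (u (tangent_chart A c)))"
proof -
  let ?T = "tangent_atlas A" and ?J = "vertical_endo A"
  note T = smooth_tangent_atlas[OF A]
  \<comment> \<open>The value computed with the extension \<open>X\<close>; it turns out to be the same for all extensions.\<close>
  define val where "val X = (\<lambda>d. lie_bracket ?T (\<lambda>q. ?J q (X q)) Y q d - ?J q (lie_bracket ?T X Y q) d)" for X
  have props: "field_differentiable_near ?T q X \<and> X q = u" if "local_extension ?T q u X" for X
    by (rule local_extension_differentiable[OF T that])
  have tan: "val X \<in> tangent_space ?T q" if "local_extension ?T q u X" for X
    unfolding val_def
    using tangent_space_linear[OF T lie_bracket_tangent[OF T vertical_endo_field(1) Y] vertical_endo_tangent[OF A lie_bracket_tangent[OF T _ Y]], of X X 1 "-1"]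
      props[OF that] by simp
  have chart: "val X (tangent_chart A c) = D (field_coords A c Y) (snd c (fst q), snd q c) (vert (u (tangent_chart A c)))
        - vert (D (field_coords A c Y) (snd c (fst q), snd q c) (u (tangent_chart A c)))"
    if X: "local_extension ?T q u X" and c: "c \<in> A" "q \<in> fst (tangent_chart A c)" for X c
  proof -
    have dX: "field_differentiable_near ?T q X" "X q = u" using props[OF X] by auto
    show ?thesis
      unfolding val_def vertical_endo_chart[OF A c lie_bracket_tangent[OF T dX(1) Y]] lie_bracket_chart[OF c]
        vertical_endo_field(2)[OF dX(1) c] dX(2) vertical_endo_chart[OF A c u]
      by (simp add: linear_diff[OF linear_vert])
  qed
  obtain d where "d \<in> ?T" "q \<in> fst d"
    using q carrier_tangent_atlas[OF A] by (metis UN_E carrier_def)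
  then obtain X where X: "local_extension ?T q u X"
    using local_extension_exists[OF T _ _ u] by blast
  have same: "val X' = val X" if "local_extension ?T q u X'" for X'
  proof (rule tangent_fun_eqI[OF A])
    show "val X' d = val X d" if "\<not> (d \<in> ?T \<and> q \<in> fst d)" for d
      using tangent_space_zero[OF tan[OF \<open>local_extension ?T q u X'\<close>] that] tangent_space_zero[OF tan[OF X] that] by simp
    show "val X' (tangent_chart A c) = val X (tangent_chart A c)" if "c \<in> A" "q \<in> fst (tangent_chart A c)" for c
      unfolding chart[OF \<open>local_extension ?T q u X'\<close> that] chart[OF X that] ..
  qed
  have "fn_bracket ?T ?J Y q u = val X"
    unfolding fn_bracket_def val_def[symmetric]
  proof (rule the_equality)
    show "\<forall>X'. local_extension ?T q u X' \<longrightarrow> val X = val X'"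
      using same by metis
    show "w = val X" if "\<forall>X. local_extension ?T q u X \<longrightarrow> w = val X" for w
      using that X by blast
  qed
  then show "fn_bracket ?T ?J Y q u \<in> tangent_space ?T q"
    and "\<lbrakk>c \<in> A; q \<in> fst (tangent_chart A c)\<rbrakk> \<Longrightarrow>
      fn_bracket ?T ?J Y q u (tangent_chart A c) =
        D (field_coords A c Y) (snd c (fst q), snd q c) (vert (u (tangent_chart A c)))
        - vert (D (field_coords A c Y) (snd c (fst q), snd q c) (u (tangent_chart A c)))"
    using tan[OF X] chart[OF X] by auto
qed

lemma slit_field_differentiable:
  "smooth_vfield (tangent_atlas A) (slit_TM A) X \<Longrightarrow> q \<in> slit_TM A \<Longrightarrow> field_differentiable_near (tangent_atlas A) q X"
  by (rule smooth_field_differentiable_near[OF smooth_tangent_atlas[OF A] openin_slit_TM[OF A]])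

section \<open>The fundamental form of an energy function\<close>

context
  fixes E :: "('p, 'e) tpoint \<Rightarrow> real"
  assumes E_smooth: "\<And>k. Ck_fun (tangent_atlas A) k (slit_TM A) E"
begin

lemma energy_Ck: "c \<in> A \<Longrightarrow> Ck_on k (fun_coords A c E) (slit (range_of c))"
proof -
  assume c: "c \<in> A"
  have "Ck_on k (E \<circ> chart_inv (tangent_chart A c)) (snd (tangent_chart A c) ` (fst (tangent_chart A c) \<inter> slit_TM A))"
    using E_smooth[of k] tangent_chart_mem[OF c] unfolding Ck_fun_def by blast
  then show ?thesis
    unfolding tangent_chart_slit[OF A c] by (simp add: o_def fun_coords_def[abs_def])
qed

lemmas energy_coords_differentiable = smooth_differentiable[OF open_slit[OF open_chart_range[OF A]] energy_Ck]

lemma differential_energy: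
  assumes "c \<in> A" "q \<in> slit_TM A" "fst q \<in> fst c" "u \<in> tangent_space (tangent_atlas A) q"
  shows "differential (tangent_atlas A) E q u = D (fun_coords A c E) (snd c (fst q), snd q c) (u (tangent_chart A c))"
proof -
  have q: "q \<in> fst (tangent_chart A c)" "(snd c (fst q), snd q c) \<in> slit (range_of c)"
    using slit_TM_chart[OF A assms(1-3)] by auto
  show ?thesis
    using differential_chart[OF smooth_tangent_atlas[OF A] tangent_chart_mem[OF assms(1)] q(1) assms(4), of E]
      energy_coords_differentiable[OF assms(1) assms(1) q(2)] by (simp add: fun_coords_def[abs_def])
qed

text \<open>The derivatives of the extensions \<open>X\<close> and \<open>Y\<close> enter \<open>X (\<beta> Y)\<close>, \<open>Y (\<beta> X)\<close> and \<open>\<beta> [X, Y]\<close> through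
  \<open>dE (J (DY X))\<close> and \<open>dE (J (DX Y))\<close>, and these cancel. The second derivatives of \<open>E\<close> remain.\<close>

lemma fundamental_form_chart:
  assumes c: "c \<in> A" "q \<in> slit_TM A" "fst q \<in> fst c"
    and u: "u \<in> tangent_space (tangent_atlas A) q" and w: "w \<in> tangent_space (tangent_atlas A) q"
  shows "fundamental_form A E q u w =
    fund (fun_coords A c E) (snd c (fst q), snd q c) (u (tangent_chart A c)) (w (tangent_chart A c))"
proof -
  let ?T = "tangent_atlas A" and ?J = "vertical_endo A" and ?tc = "tangent_chart A c"
  let ?z = "(snd c (fst q), snd q c)" and ?f = "fun_coords A c E" and ?S = "slit (range_of c) :: ('e \<times> 'e) set"
  let ?\<beta> = "d_K ?T ?J E"
  note T = smooth_tangent_atlas[OF A]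
  have q: "q \<in> fst ?tc" "?z \<in> ?S"
    using slit_TM_chart[OF A c] by auto
  have S: "open ?S" by (intro open_slit open_chart_range[OF A c(1)])
  have bl: "bounded_linear (vert :: 'e \<times> 'e \<Rightarrow> 'e \<times> 'e)"
    using linear_vert linear_conv_bounded_linear by blast
  have \<beta>: "?\<beta> q' v = D ?f (snd c (fst q'), snd q' c) (vert (v ?tc))"
    if "q' \<in> slit_TM A" "q' \<in> fst ?tc" "v \<in> tangent_space ?T q'" for q' v
    using differential_energy[OF c(1) that(1) _ vertical_endo_tangent[OF A that(3)]] that
    by (simp add: d_K_def vertical_endo_chart[OF A c(1) that(2,3)] tangent_chart_domain)
  have diff: "differential ?T (\<lambda>q. ?\<beta> q (Y q)) q v =
      hess ?f ?z (v ?tc) (vert (Y q ?tc)) + D ?f ?z (vert (D (field_coords A c Y) ?z (v ?tc)))"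
    if Y: "field_differentiable_near ?T q Y" and v: "v \<in> tangent_space ?T q" for Y v
  proof -
    obtain O' where O': "open O'" "?z \<in> O'"
      "\<And>z. z \<in> O' \<Longrightarrow> \<exists>q'\<in>fst ?tc. z = (snd c (fst q'), snd q' c) \<and> Y q' \<in> tangent_space ?T q'"
      using field_near_coords[OF Y c(1) q(1)] by metis
    have O2: "open (O' \<inter> ?S)" "?z \<in> O' \<inter> ?S" using O' S q(2) by auto
    have eq: "D ?f z (vert (field_coords A c Y z)) = fun_coords A c (\<lambda>q. ?\<beta> q (Y q)) z" if "z \<in> O' \<inter> ?S" for z
    proof -
      obtain q' where q': "q' \<in> fst ?tc" "z = (snd c (fst q'), snd q' c)" "Y q' \<in> tangent_space ?T q'"
        using O'(3) \<open>z \<in> O' \<inter> ?S\<close> by blast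
      obtain q'' where q'': "q'' \<in> fst ?tc" "q'' \<in> slit_TM A" "z = (snd c (fst q''), snd q'' c)"
        using coords_slit_point[OF c(1), of z] \<open>z \<in> O' \<inter> ?S\<close> by blast
      have "q'' = q'"
        using chart_inv_tangent[OF c(1) q'(1)] chart_inv_tangent[OF c(1) q''(1)] q'(2) q''(3) by simp
      then show ?thesis
        using q' q'' \<beta>[of q' "Y q'"] c(1) by (simp add: fun_coords_chart field_coords_chart)
    qed
    have dY: "field_coords A c Y differentiable (at ?z)"
      by (rule field_differentiable_coords[OF Y c(1) q(1)])
    have "((\<lambda>z. D ?f z (vert (field_coords A c Y z))) has_derivative
       (\<lambda>h. D (\<lambda>z. D ?f z (vert (field_coords A c Y ?z))) ?z h + D ?f ?z (D (\<lambda>z. vert (field_coords A c Y z)) ?z h))) (at ?z)"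
      by (rule has_derivative_linear_apply[OF S q(2), of "D ?f" "\<lambda>z. vert (field_coords A c Y z)"])
        (intro linear_D energy_coords_differentiable[OF c(1) c(1)] smooth_D_differentiable[OF S energy_Ck[OF c(1)] q(2)]
          differentiable_bounded_linear[OF bl dY]; assumption)+
    then have "((\<lambda>z. D ?f z (vert (field_coords A c Y z))) has_derivative
       (\<lambda>h. hess ?f ?z h (vert (Y q ?tc)) + D ?f ?z (vert (D (field_coords A c Y) ?z h)))) (at ?z)"
      by (simp add: hess_def D_bounded_linear[OF bl dY] field_coords_chart[OF c(1) q(1)])
    then have der: "(fun_coords A c (\<lambda>q. ?\<beta> q (Y q)) has_derivative
       (\<lambda>h. hess ?f ?z h (vert (Y q ?tc)) + D ?f ?z (vert (D (field_coords A c Y) ?z h)))) (at ?z)"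
      by (rule has_derivative_transform_within_open[OF _ O2]) (rule eq)
    show ?thesis
      using differential_chart[OF T tangent_chart_mem[OF c(1)] q(1) v, of "\<lambda>q. ?\<beta> q (Y q)"]
        differentiableI[OF der] D_eq[OF der] by (simp add: fun_coords_def[abs_def])
  qed
  have lin: "linear (D ?f ?z)" by (rule linear_D[OF energy_coords_differentiable[OF c(1) c(1) q(2)]])
  have val: "differential ?T (\<lambda>q. ?\<beta> q (Y q)) q (X q) - differential ?T (\<lambda>q. ?\<beta> q (X q)) q (Y q)
      - ?\<beta> q (lie_bracket ?T X Y q) = fund ?f ?z (u ?tc) (w ?tc)"
    if "local_extension ?T q u X" "local_extension ?T q w Y" for X Y
  proof -
    have X: "field_differentiable_near ?T q X" "X q = u" and Y: "field_differentiable_near ?T q Y" "Y q = w"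
      using local_extension_differentiable[OF T that(1)] local_extension_differentiable[OF T that(2)] by auto
    show ?thesis
      using diff[OF Y(1) u] diff[OF X(1) w] \<beta>[OF c(2) q(1) lie_bracket_tangent[OF T X(1) Y(1)]]
      by (simp add: X(2) Y(2) lie_bracket_chart[OF c(1) q(1)] linear_diff[OF linear_vert] linear_diff[OF lin] fund_def)
  qed
  obtain X where X: "local_extension ?T q u X"
    using local_extension_exists[OF T tangent_chart_mem[OF c(1)] q(1) u] by blast
  obtain Y where Y: "local_extension ?T q w Y"
    using local_extension_exists[OF T tangent_chart_mem[OF c(1)] q(1) w] by blast
  show ?thesis
    unfolding fundamental_form_def ext_deriv_def
  proof (rule the_equality)
    fix r assume "\<forall>X Y. local_extension ?T q u X \<and> local_extension ?T q w Y \<longrightarrow>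
       r = differential ?T (\<lambda>q. ?\<beta> q (Y q)) q (X q) - differential ?T (\<lambda>q. ?\<beta> q (X q)) q (Y q)
         - ?\<beta> q (lie_bracket ?T X Y q)"
    then show "r = fund ?f ?z (u ?tc) (w ?tc)"
      using X Y val[OF X Y] by simp
  qed (simp add: val)
qed

context
  assumes nondeg: "\<And>q u. \<lbrakk>q \<in> slit_TM A; u \<in> tangent_space (tangent_atlas A) q;
     \<And>w. w \<in> tangent_space (tangent_atlas A) q \<Longrightarrow> fundamental_form A E q u w = 0\<rbrakk> \<Longrightarrow> u = (\<lambda>_. 0)"
begin

lemma fund_nondegenerate:
  assumes "c \<in> A" "z \<in> slit (range_of c)" "\<And>w. fund (fun_coords A c E) z u w = 0"
  shows "u = 0"
proof -
  obtain q where q: "q \<in> fst (tangent_chart A c)" "q \<in> slit_TM A" "fst q \<in> fst c" "z = (snd c (fst q), snd q c)"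
    using coords_slit_point[OF assms(1,2)] by metis
  obtain u' where u': "u' \<in> tangent_space (tangent_atlas A) q" "u' (tangent_chart A c) = u"
    using tangent_extension[OF assms(1) q(1)] by metis
  have "fundamental_form A E q u' w = 0" if "w \<in> tangent_space (tangent_atlas A) q" for w
    using fundamental_form_chart[OF assms(1) q(2,3) u'(1) that] assms(3) u'(2) q(4) by simp
  then show ?thesis using nondeg[OF q(2) u'(1)] u'(2) by simp
qed

text \<open>Tangent vectors at \<open>q\<close> correspond to their components, so the defining equation of \<open>\<beta>\<^sup>#\<close> is the linear system of the chart.\<close>

lemma sharp_chart:
  assumes c: "c \<in> A" "q \<in> slit_TM A" "fst q \<in> fst c" and b: "linear b"
    and \<beta>: "\<And>w. w \<in> tangent_space (tangent_atlas A) q \<Longrightarrow> \<beta> q w = b (w (tangent_chart A c))"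
  shows "sharp A E \<beta> q \<in> tangent_space (tangent_atlas A) q"
    and "fund (fun_coords A c E) (snd c (fst q), snd q c) (sharp A E \<beta> q (tangent_chart A c)) w = b w"
proof -
  let ?T = "tangent_atlas A" and ?tc = "tangent_chart A c"
  let ?z = "(snd c (fst q), snd q c)" and ?f = "fun_coords A c E" and ?S = "slit (range_of c) :: ('e \<times> 'e) set"
  have q: "q \<in> fst ?tc" "?z \<in> ?S"
    using slit_TM_chart[OF A c] by auto
  have S: "open ?S" by (intro open_slit open_chart_range[OF A c(1)])
  obtain a where a: "\<And>w. fund ?f ?z a w = b w" "\<And>a'. (\<And>w. fund ?f ?z a' w = b w) \<Longrightarrow> a' = a"
    using fund_solution_exists[OF S energy_Ck[OF c(1)] q(2) fund_nondegenerate[OF c(1) q(2)] b] by metis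
  obtain u where u: "u \<in> tangent_space ?T q" "u ?tc = a"
    using tangent_extension[OF c(1) q(1)] by metis
  have iff: "(\<forall>w\<in>tangent_space ?T q. fundamental_form A E q u' w = \<beta> q w) \<longleftrightarrow> u' = u"
    if u': "u' \<in> tangent_space ?T q" for u'
  proof -
    have "(\<forall>w\<in>tangent_space ?T q. fundamental_form A E q u' w = \<beta> q w) \<longleftrightarrow> (\<forall>w. fund ?f ?z (u' ?tc) w = b w)"
      using fundamental_form_chart[OF c u'] \<beta> tangent_extension[OF c(1) q(1)] by metis
    also have "\<dots> \<longleftrightarrow> u' ?tc = u ?tc"
      using a u(2) by metis
    also have "\<dots> \<longleftrightarrow> u' = u"
      using tvec_eqI[OF u' u(1) tangent_chart_mem[OF c(1)] q(1)] by blast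
    finally show ?thesis .
  qed
  have "sharp A E \<beta> q = u"
    unfolding sharp_def if_P[OF c(2)] using iff u(1) by (intro the_equality) blast+
  then show "sharp A E \<beta> q \<in> tangent_space ?T q" "fund ?f ?z (sharp A E \<beta> q ?tc) w = b w"
    using u a(1) by simp_all
qed

lemma sharp_coords:
  assumes "c \<in> A" "z \<in> slit (range_of c)" "\<And>z. z \<in> slit (range_of c) \<Longrightarrow> linear (b z)"
    and "\<And>q w. \<lbrakk>q \<in> slit_TM A; fst q \<in> fst c; w \<in> tangent_space (tangent_atlas A) q\<rbrakk> \<Longrightarrow>
      \<beta> q w = b (snd c (fst q), snd q c) (w (tangent_chart A c))"
  shows "fund (fun_coords A c E) z (field_coords A c (sharp A E \<beta>) z) w = b z w"
proof -
  obtain q where q: "q \<in> fst (tangent_chart A c)" "q \<in> slit_TM A" "fst q \<in> fst c" "z = (snd c (fst q), snd q c)"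
    using coords_slit_point[OF assms(1,2)] by metis
  show ?thesis
    using sharp_chart(2)[OF assms(1) q(2,3), of "b z" \<beta>] assms q
    by (simp add: field_coords_chart)
qed

end

end

end

section \<open>Vertical fields\<close>

text \<open>\<open>b c z\<close> is the form \<open>\<beta>\<close> in the tangent chart over \<open>c\<close>. The form is evaluated at nonzero tangent vectors
  and on tangent arguments only, so nothing is said about \<open>\<beta>\<close> elsewhere.\<close>

definition form_coords ::
    "('p, 'e::euclidean_space) chart set \<Rightarrow> (('p, 'e) tpoint, 'e \<times> 'e) form1 \<Rightarrow>
     (('p, 'e) chart \<Rightarrow> 'e \<times> 'e \<Rightarrow> 'e \<times> 'e \<Rightarrow> real) \<Rightarrow> bool" where
  "form_coords A \<beta> b \<longleftrightarrow> (\<forall>c\<in>A. \<forall>z\<in>slit (range_of c). linear (b c z)) \<and>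
     (\<forall>c\<in>A. \<forall>q\<in>slit_TM A. fst q \<in> fst c \<longrightarrow> (\<forall>w\<in>tangent_space (tangent_atlas A) q.
        \<beta> q w = b c (snd c (fst q), snd q c) (w (tangent_chart A c))))"

context
  fixes A :: "('p, 'e::euclidean_space) chart set"
  assumes A: "smooth_atlas A"
begin

lemma open_coords_range: "c \<in> A \<Longrightarrow> open (range_of c \<times> (UNIV :: 'e set))"
  by (intro open_Times open_chart_range[OF A]) auto

lemma smooth_vfield_linear:
  assumes "smooth_vfield (tangent_atlas A) (slit_TM A) X" "smooth_vfield (tangent_atlas A) (slit_TM A) Y"
  shows "smooth_vfield (tangent_atlas A) (slit_TM A) (\<lambda>q d. a *\<^sub>R X q d + b *\<^sub>R Y q d)"
  unfolding smooth_vfield_coords[OF A]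
proof (intro conjI ballI allI)
  fix q assume "q \<in> slit_TM A"
  then show "(\<lambda>d. a *\<^sub>R X q d + b *\<^sub>R Y q d) \<in> tangent_space (tangent_atlas A) q"
    using assms by (intro tangent_space_linear[OF smooth_tangent_atlas[OF A]]) (auto simp: smooth_vfield_coords[OF A])
next
  fix c k assume c: "c \<in> A"
  have S: "open (slit (range_of c) :: ('e \<times> 'e) set)"
    by (intro open_slit open_chart_range[OF A c])
  have "Ck_on k (\<lambda>z. a *\<^sub>R field_coords A c X z + b *\<^sub>R field_coords A c Y z) (slit (range_of c))"
    using assms c unfolding smooth_vfield_coords[OF A]
    by (intro Ck_on_add[OF S] Ck_on_scaleR[OF S] Ck_on_const) auto
  then show "Ck_on k (field_coords A c (\<lambda>q d. a *\<^sub>R X q d + b *\<^sub>R Y q d)) (slit (range_of c))"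
    by (simp add: field_coords_def[abs_def])
qed

lemma liouville_tangent:
  assumes "q \<in> TM A" shows "liouville A q \<in> tangent_space (tangent_atlas A) q"
proof (rule tangent_memI[OF A])
  fix c d assume cd: "c \<in> A" "d \<in> A" "q \<in> TM A" "fst q \<in> fst c" "fst q \<in> fst d"
  then have q: "q \<in> fst (tangent_chart A c)" "q \<in> fst (tangent_chart A d)"
    by (simp_all add: tangent_chart_domain)
  have "snd q d = D (transition c d) (snd c (fst q)) (snd q c)"
    using cd by (intro tangent_space_transition[of "snd q" A]) (auto simp: TM_def)
  then show "liouville A q (tangent_chart A d) =
      D (transition (tangent_chart A c) (tangent_chart A d)) (snd c (fst q), snd q c) (liouville A q (tangent_chart A c))"
    unfolding liouville_chart[OF A cd(1) q(1)] liouville_chart[OF A cd(2) q(2)] D_tangent_transition(2)[OF A cd] by simp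
qed (simp add: liouville_def vertical_lift_outside[OF A])

text \<open>The Liouville field is \<open>(0, y)\<close> in a chart; its derivative is the projection to the fibre part.\<close>

lemma liouville_bracket_chart:
  assumes c: "c \<in> A" "q \<in> fst (tangent_chart A c)"
  shows "lie_bracket (tangent_atlas A) (liouville A) X q (tangent_chart A c) =
    D (field_coords A c X) (snd c (fst q), snd q c) (0, snd q c) - (0, snd (X q (tangent_chart A c)))"
proof -
  let ?z = "(snd c (fst q), snd q c)"
  have z: "?z \<in> range_of c \<times> UNIV"
    using c(2) by (simp add: tangent_chart_domain)
  have eq: "(0, snd z) = field_coords A c (liouville A) z" if z: "z \<in> range_of c \<times> UNIV" for z
  proof -
    obtain q where q: "q \<in> fst (tangent_chart A c)" "z = (snd c (fst q), snd q c)"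
      using coords_point[OF A c(1) z] by metis
    show ?thesis
      unfolding q(2) field_coords_chart[OF A c(1) q(1)] liouville_chart[OF A c(1) q(1)] by simp
  qed
  have "D (\<lambda>z. (0 :: 'e, snd z :: 'e)) ?z = D (field_coords A c (liouville A)) ?z"
    by (rule D_cong[OF open_coords_range[OF c(1)] z eq])
  moreover have "D (\<lambda>z. (0 :: 'e, snd z :: 'e)) ?z = (\<lambda>h. (0, snd h))"
    by (rule D_eq) (intro has_derivative_Pair has_derivative_const has_derivative_snd has_derivative_ident)
  ultimately show ?thesis
    unfolding lie_bracket_chart[OF A c] liouville_chart[OF A c] by metis
qed

context
  fixes V :: "(('p, 'e) tpoint, 'e \<times> 'e) vfield"
  assumes V: "vertical_field A V"
begin

lemma vertical_field_smooth: "smooth_vfield (tangent_atlas A) (slit_TM A) V"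
  using V by (simp add: vertical_field_def)

lemma vertical_field_tangent: "q \<in> TM A \<Longrightarrow> V q \<in> tangent_space (tangent_atlas A) q"
  using V by (simp add: vertical_field_def Ck_vfield_def)

lemma vertical_field_Ck_1: "c \<in> A \<Longrightarrow> Ck_on 1 (field_coords A c V) (range_of c \<times> UNIV)"
  using V tangent_chart_range[OF A] unfolding vertical_field_def Ck_vfield_coords by metis

lemma vertical_field_coords:
  assumes "c \<in> A" "z \<in> range_of c \<times> UNIV" shows "fst (field_coords A c V z) = 0"
proof -
  obtain q where q: "q \<in> fst (tangent_chart A c)" "q \<in> TM A" "fst q \<in> fst c" "z = (snd c (fst q), snd q c)"
    using coords_point[OF A assms] by metis
  have "tangent_map (tangent_atlas A) A fst q (V q) = (\<lambda>_. 0)"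
    using V q(2) by (simp add: vertical_field_def)
  then show ?thesis
    unfolding q(4) field_coords_chart[OF A assms(1) q(1)]
    using tangent_map_fst_chart[OF A assms(1) q(1) vertical_field_tangent[OF q(2)]] by simp
qed

lemma vertical_field_D_coords:
  assumes "c \<in> A" "z \<in> range_of c \<times> UNIV" shows "fst (D (field_coords A c V) z h) = 0"
proof -
  have "D (\<lambda>z. fst (field_coords A c V z)) z = D (\<lambda>_. 0) z"
    by (rule D_cong[OF open_coords_range[OF assms(1)] assms(2)]) (rule vertical_field_coords[OF assms(1)])
  moreover have "field_coords A c V differentiable (at z)"
    by (rule Ck_on_differentiable[OF vertical_field_Ck_1[OF assms(1), unfolded One_nat_def] assms(2)])
  ultimately show ?thesis
    by (metis D_bounded_linear[OF bounded_linear_fst] frechet_derivative_const)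
qed

text \<open>For vertical \<open>V\<close> the term \<open>J (DV u)\<close> of the bracket vanishes, as the base part of \<open>V\<close> is identically
  \<open>0\<close>. The value depends on the base part of \<open>u\<close> only: \<open>[J, V]\<close> is semibasic.\<close>

lemma J_bracket_vertical_field:
  assumes "q \<in> slit_TM A" "u \<in> tangent_space (tangent_atlas A) q"
  shows "J_bracket A V q u \<in> tangent_space (tangent_atlas A) q"
    and "\<lbrakk>c \<in> A; fst q \<in> fst c\<rbrakk> \<Longrightarrow> J_bracket A V q u (tangent_chart A c) =
      D (field_coords A c V) (snd c (fst q), snd q c) (vert (u (tangent_chart A c)))"
proof -
  note dV = slit_field_differentiable[OF A vertical_field_smooth assms(1)]
  have q: "q \<in> TM A" using assms(1) slit_TM_subset by blast
  show "J_bracket A V q u \<in> tangent_space (tangent_atlas A) q"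
    unfolding J_bracket_def by (rule fn_bracket_vertical_endo(1)[OF A dV q assms(2)])
  assume c: "c \<in> A" "fst q \<in> fst c"
  then have qc: "q \<in> fst (tangent_chart A c)"
    using q by (simp add: tangent_chart_domain)
  have "vert (D (field_coords A c V) (snd c (fst q), snd q c) (u (tangent_chart A c))) = 0"
    using vertical_field_D_coords[OF c(1), of "(snd c (fst q), snd q c)"] c(2) by (simp add: vert_def prod_eq_iff)
  then show "J_bracket A V q u (tangent_chart A c) =
      D (field_coords A c V) (snd c (fst q), snd q c) (vert (u (tangent_chart A c)))"
    unfolding J_bracket_def fn_bracket_vertical_endo(2)[OF A dV q assms(2) c(1) qc] by simp
qed

text \<open>For a vertical field \<open>[C, V] = V\<close> reads \<open>DV (0, y) = 2 V\<close>. On the zero section the left-hand side is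
  \<open>0\<close>, hence so is \<open>V\<close>.\<close>

lemma homogeneous_vertical_field:
  assumes "homogeneous2 A V" "c \<in> A"
  shows "z \<in> slit (range_of c) \<Longrightarrow> t > 0 \<Longrightarrow> field_coords A c V (fibre_scale t z) = t\<^sup>2 *\<^sub>R field_coords A c V z"
    and "x \<in> range_of c \<Longrightarrow> field_coords A c V (x, 0) = 0"
proof -
  have diff: "field_coords A c V differentiable (at z)" if "z \<in> range_of c \<times> UNIV" for z
    by (rule Ck_on_differentiable[OF vertical_field_Ck_1[OF assms(2), unfolded One_nat_def] that])
  have euler: "D (field_coords A c V) z (0, snd z) = 2 *\<^sub>R field_coords A c V z"
    if z: "z \<in> range_of c \<times> UNIV" for z
  proof -
    obtain q where q: "q \<in> fst (tangent_chart A c)" "q \<in> TM A" "z = (snd c (fst q), snd q c)"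
      using coords_point[OF A assms(2) z] by metis
    have "D (field_coords A c V) z (0, snd z) - (0, snd (field_coords A c V z)) = field_coords A c V z"
      using liouville_bracket_chart[OF assms(2) q(1), of V] assms(1) q(2)
      unfolding q(3) field_coords_chart[OF A assms(2) q(1)] homogeneous2_def by simp
    moreover have "field_coords A c V z = (0, snd (field_coords A c V z))"
      using vertical_field_coords[OF assms(2) z] by (simp add: prod_eq_iff)
    ultimately show ?thesis
      by (metis diff_add_cancel scaleR_2)
  qed
  have sub: "z \<in> range_of c \<times> UNIV" if "z \<in> slit (range_of c)" for z :: "'e \<times> 'e"
    using that by (simp add: slit_iff mem_Times_iff)
  show "z \<in> slit (range_of c) \<Longrightarrow> t > 0 \<Longrightarrow> field_coords A c V (fibre_scale t z) = t\<^sup>2 *\<^sub>R field_coords A c V z"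
    by (rule euler_imp_homogeneous[OF diff[OF sub] euler[OF sub]])
  assume x: "x \<in> range_of c"
  then have "D (field_coords A c V) (x, 0) 0 = 2 *\<^sub>R field_coords A c V (x, 0)"
    using euler[of "(x, 0)"] by (simp flip: zero_prod_def)
  then show "field_coords A c V (x, 0) = 0"
    using linear_0[OF linear_D[OF diff[of "(x, 0)"]]] x by simp
qed

end

section \<open>Sharp fields of a Finsler energy\<close>

context
  fixes E :: "('p, 'e) tpoint \<Rightarrow> real"
  assumes E: "finsler_energy A E"
begin

lemma finsler_smooth: "Ck_fun (tangent_atlas A) k (slit_TM A) E"
  using E by (simp add: finsler_energy_def)

lemma finsler_nondegenerate:
  "\<lbrakk>q \<in> slit_TM A; u \<in> tangent_space (tangent_atlas A) q;
     \<And>w. w \<in> tangent_space (tangent_atlas A) q \<Longrightarrow> fundamental_form A E q u w = 0\<rbrakk> \<Longrightarrow> u = (\<lambda>_. 0)"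
  using E unfolding finsler_energy_def by blast

lemma finsler_energy_Ck: "c \<in> A \<Longrightarrow> Ck_on k (fun_coords A c E) (slit (range_of c))"
  by (rule energy_Ck[OF A finsler_smooth])

lemma finsler_energy_differentiable:
  "c \<in> A \<Longrightarrow> z \<in> slit (range_of c) \<Longrightarrow> fun_coords A c E differentiable (at z)"
  using finsler_energy_Ck[of c 1] by simp

lemma finsler_fund_nondegenerate:
  "\<lbrakk>c \<in> A; z \<in> slit (range_of c); \<And>w. fund (fun_coords A c E) z u w = 0\<rbrakk> \<Longrightarrow> u = 0"
  by (rule fund_nondegenerate[OF A finsler_smooth finsler_nondegenerate])

lemma finsler_euler:
  assumes "c \<in> A" "z \<in> slit (range_of c)"
  shows "D (fun_coords A c E) z (0, snd z) = 2 * fun_coords A c E z"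
proof -
  obtain q where q: "q \<in> fst (tangent_chart A c)" "q \<in> slit_TM A" "fst q \<in> fst c" "z = (snd c (fst q), snd q c)"
    using coords_slit_point[OF A assms] by metis
  have qT: "q \<in> TM A" using q(2) slit_TM_subset by blast
  have "differential (tangent_atlas A) E q (liouville A q) = 2 * E q"
    using E qT by (simp add: finsler_energy_def)
  then show ?thesis
    using differential_energy[OF A finsler_smooth assms(1) q(2,3) liouville_tangent[OF qT]]
    unfolding liouville_chart[OF A assms(1) q(1)] q(4) fun_coords_chart[OF A assms(1) q(1)] by simp
qed

lemma finsler_homogeneous:
  assumes "c \<in> A" "z \<in> slit (range_of c)" "t > 0"
  shows "fun_coords A c E (fibre_scale t z) = t\<^sup>2 * fun_coords A c E z"
  using euler_imp_homogeneous[of "range_of c" "fun_coords A c E" z t] finsler_euler[OF assms(1)]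
    finsler_energy_differentiable[OF assms(1)] assms by simp

lemma sharp_zero_section: "q \<notin> slit_TM A \<Longrightarrow> sharp A E \<beta> q = (\<lambda>_. 0)"
  by (simp add: sharp_def)

lemma sharp_coords_zero:
  assumes "c \<in> A" "x \<in> range_of c" shows "field_coords A c (sharp A E \<beta>) (x, 0) = 0"
proof -
  obtain q where q: "q \<in> fst (tangent_chart A c)" "q \<in> TM A" "fst q \<in> fst c" "(x, 0) = (snd c (fst q), snd q c)"
    using coords_point[OF A assms(1), of "(x, 0)"] assms(2) by auto
  have "q \<notin> slit_TM A"
    using slit_TM_chart(2)[OF A assms(1) _ q(3)] q(4) by (auto simp: slit_iff)
  then show ?thesis
    unfolding q(4) field_coords_chart[OF A assms(1) q(1)] by (simp add: sharp_zero_section)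
qed

context
  fixes \<beta> :: "(('p, 'e) tpoint, 'e \<times> 'e) form1" and b :: "('p, 'e) chart \<Rightarrow> 'e \<times> 'e \<Rightarrow> 'e \<times> 'e \<Rightarrow> real"
  assumes b: "form_coords A \<beta> b"
begin

lemma form_coords_linear: "c \<in> A \<Longrightarrow> z \<in> slit (range_of c) \<Longrightarrow> linear (b c z)"
  and form_coords_eq: "\<lbrakk>c \<in> A; q \<in> slit_TM A; fst q \<in> fst c; w \<in> tangent_space (tangent_atlas A) q\<rbrakk> \<Longrightarrow>
      \<beta> q w = b c (snd c (fst q), snd q c) (w (tangent_chart A c))"
  using b unfolding form_coords_def by blast+

lemma sharp_tangent: "q \<in> TM A \<Longrightarrow> sharp A E \<beta> q \<in> tangent_space (tangent_atlas A) q"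
proof (cases "q \<in> slit_TM A")
  case True
  then obtain c where c: "c \<in> A" "fst q \<in> fst c"
    using slit_TM_subset by (fastforce simp: TM_def carrier_def)
  have "(snd c (fst q), snd q c) \<in> slit (range_of c)"
    using slit_TM_chart(2)[OF A c(1) True c(2)] by simp
  then have linear: "linear (b c (snd c (fst q), snd q c))"
    by (rule form_coords_linear[OF c(1)])
  show ?thesis
  proof (rule sharp_chart(1)[OF A finsler_smooth _ c(1) True c(2) linear])
    show "u = (\<lambda>_. 0)" if "q \<in> slit_TM A" "u \<in> tangent_space (tangent_atlas A) q"
      "\<And>w. w \<in> tangent_space (tangent_atlas A) q \<Longrightarrow> fundamental_form A E q u w = 0" for q u
      by (rule finsler_nondegenerate[OF that])
  qed (rule form_coords_eq[OF c(1) True c(2)])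
next
  case False
  then show ?thesis
    by (simp add: sharp_zero_section zero_tangent[OF smooth_tangent_atlas[OF A]])
qed

lemma sharp_solution:
  assumes "c \<in> A" "z \<in> slit (range_of c)"
  shows "fund (fun_coords A c E) z (field_coords A c (sharp A E \<beta>) z) w = b c z w"
  using assms by (intro sharp_coords[OF A finsler_smooth finsler_nondegenerate] form_coords_linear form_coords_eq)

lemma sharp_smooth:
  assumes "\<And>c k w. c \<in> A \<Longrightarrow> Ck_on k (\<lambda>z. b c z w) (slit (range_of c))"
  shows "smooth_vfield (tangent_atlas A) (slit_TM A) (sharp A E \<beta>)"
  unfolding smooth_vfield_coords[OF A]
proof (intro conjI ballI allI)
  show "sharp A E \<beta> q \<in> tangent_space (tangent_atlas A) q" if "q \<in> slit_TM A" for q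
    using that slit_TM_subset sharp_tangent by blast
  fix c k assume c: "c \<in> A"
  show "Ck_on k (field_coords A c (sharp A E \<beta>)) (slit (range_of c))"
    by (rule fund_solution_Ck[OF open_slit[OF open_chart_range[OF A c]] finsler_energy_Ck[OF c]
          finsler_fund_nondegenerate[OF c] sharp_solution[OF c] assms[OF c]])
qed

lemma sharp_homogeneous:
  assumes c: "c \<in> A" and z: "z \<in> slit (range_of c)" and t: "t > 0"
    and "\<And>w. b c (fibre_scale t z) (fibre_scale t w) = t\<^sup>2 * b c z w"
  shows "field_coords A c (sharp A E \<beta>) (fibre_scale t z) = t *\<^sub>R fibre_scale t (field_coords A c (sharp A E \<beta>) z)"
  by (rule fund_solution_scale[OF open_slit[OF open_chart_range[OF A c]] finsler_energy_Ck[OF c] t z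
        fibre_scale_slit[OF _ t] finsler_homogeneous[OF c _ t] finsler_fund_nondegenerate[OF c]
        sharp_solution[OF c z] sharp_solution[OF c fibre_scale_slit[OF z t]] assms(4)])

lemma sharp_vertical:
  assumes c: "c \<in> A" and z: "z \<in> slit (range_of c)" and "\<And>y. b c z (0, y) = 0"
  shows "fst (field_coords A c (sharp A E \<beta>) z) = 0"
  by (rule fund_solution_vertical[OF open_slit[OF open_chart_range[OF A c]] finsler_energy_Ck[OF c] z
        finsler_fund_nondegenerate[OF c z] sharp_solution[OF c z] assms(3)])

end

section \<open>The canonical spray\<close>

lemma linear_D_energy:
  assumes "c \<in> A" "z \<in> slit (range_of c)"
  shows "linear (D (fun_coords A c E) z)"
  by (rule linear_D[OF finsler_energy_differentiable[OF assms]])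

lemmas differential_energy_chart = differential_energy[OF A finsler_smooth]

lemma differential_form_coords:
  "form_coords A (differential (tangent_atlas A) E) (\<lambda>c. D (fun_coords A c E))"
  unfolding form_coords_def using linear_D_energy differential_energy_chart by blast

lemma sharp_differential_solution:
  assumes "c \<in> A" "z \<in> slit (range_of c)"
  shows "fund (fun_coords A c E) z (field_coords A c (sharp A E (differential (tangent_atlas A) E)) z) w
    = D (fun_coords A c E) z w"
  by (rule sharp_solution[OF differential_form_coords assms])

lemma canonical_spray_smooth: "smooth_vfield (tangent_atlas A) (slit_TM A) (canonical_spray A E)"
proof -
  have "smooth_vfield (tangent_atlas A) (slit_TM A) (sharp A E (differential (tangent_atlas A) E))"
    by (rule sharp_smooth[OF differential_form_coords Ck_on_D[OF finsler_energy_Ck]])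
  from smooth_vfield_linear[OF this this, of "-1" 0] show ?thesis
    by (simp add: canonical_spray_def[abs_def])
qed

lemma canonical_spray_tangent: "q \<in> TM A \<Longrightarrow> canonical_spray A E q \<in> tangent_space (tangent_atlas A) q"
  using tangent_space_linear[OF smooth_tangent_atlas[OF A], of "sharp A E (differential (tangent_atlas A) E) q" q
      "sharp A E (differential (tangent_atlas A) E) q" "-1" 0]
    sharp_tangent[OF differential_form_coords]
  by (simp add: canonical_spray_def)

lemma canonical_spray_coords:
  "field_coords A c (canonical_spray A E) z = - field_coords A c (sharp A E (differential (tangent_atlas A) E)) z"
  by (simp add: field_coords_def canonical_spray_def)

lemma canonical_spray_coords_zero:
  "c \<in> A \<Longrightarrow> x \<in> range_of c \<Longrightarrow> field_coords A c (canonical_spray A E) (x, 0) = 0"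
  by (simp add: canonical_spray_coords sharp_coords_zero)

text \<open>This is \<open>J S0 = C\<close> away from the zero section.\<close>

lemma canonical_spray_coords_fst:
  assumes "c \<in> A" "z \<in> slit (range_of c)"
  shows "fst (field_coords A c (canonical_spray A E) z) = snd z"
proof -
  have "fst (field_coords A c (sharp A E (differential (tangent_atlas A) E)) z) = - snd z"
    by (rule fund_solution_spray[OF open_slit[OF open_chart_range[OF A assms(1)]] finsler_energy_Ck[OF assms(1)] assms(2)
      finsler_fund_nondegenerate[OF assms] finsler_euler[OF assms(1)]
      sharp_differential_solution[OF assms]])
  then show ?thesis by (simp add: canonical_spray_coords)
qed

lemma finsler_D_homogeneous:
  assumes "c \<in> A" "z \<in> slit (range_of c)" "t > 0"
  shows "D (fun_coords A c E) (fibre_scale t z) (fibre_scale t w) = t\<^sup>2 * D (fun_coords A c E) z w"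
  by (rule fund_scale(1)[OF open_slit[OF open_chart_range[OF A assms(1)]] finsler_energy_Ck[OF assms(1)] assms(3,2)
        fibre_scale_slit[OF _ assms(3)] finsler_homogeneous[OF assms(1) _ assms(3)]])

lemma canonical_spray_coords_homogeneous:
  assumes "c \<in> A" "z \<in> slit (range_of c)" "t > 0"
  shows "field_coords A c (canonical_spray A E) (fibre_scale t z)
    = t *\<^sub>R fibre_scale t (field_coords A c (canonical_spray A E) z)"
proof -
  have "field_coords A c (sharp A E (differential (tangent_atlas A) E)) (fibre_scale t z)
      = t *\<^sub>R fibre_scale t (field_coords A c (sharp A E (differential (tangent_atlas A) E)) z)"
    by (rule sharp_homogeneous[OF differential_form_coords assms finsler_D_homogeneous[OF assms]])
  then show ?thesis
    by (simp add: canonical_spray_coords linear_neg[OF linear_fibre_scale])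
qed

section \<open>The semispray of a vertical field\<close>

context
  fixes V :: "(('p, 'e) tpoint, 'e \<times> 'e) vfield"
  assumes V: "vertical_field A V"
begin

text \<open>The field \<open>(d\<^bsub>[J,V]\<^esub>E)\<^sup>#\<close>.\<close>

definition correction :: "(('p, 'e) tpoint, 'e \<times> 'e) vfield" where
  "correction = sharp A E (d_K (tangent_atlas A) (J_bracket A V) E)"

text \<open>The form \<open>d\<^bsub>[J,V]\<^esub>E\<close> in a tangent chart.\<close>

definition bracket_form :: "('p, 'e) chart \<Rightarrow> 'e \<times> 'e \<Rightarrow> 'e \<times> 'e \<Rightarrow> real" where
  "bracket_form c z w = D (fun_coords A c E) z (D (field_coords A c V) z (vert w))"

lemma vertical_field_differentiable: "c \<in> A \<Longrightarrow> z \<in> slit (range_of c) \<Longrightarrow> field_coords A c V differentiable (at z)"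
  by (rule Ck_on_differentiable[OF vertical_field_Ck_1[OF V, unfolded One_nat_def]]) (auto simp: slit_iff mem_Times_iff)

lemma linear_bracket_form:
  assumes "c \<in> A" "z \<in> slit (range_of c)" shows "linear (bracket_form c z)"
  unfolding bracket_form_def
  using linear_compose[OF linear_compose[OF linear_vert linear_D[OF vertical_field_differentiable[OF assms]]] linear_D_energy[OF assms]]
  by (simp add: o_def)

lemma bracket_form_eq:
  assumes "c \<in> A" "q \<in> slit_TM A" "fst q \<in> fst c" "w \<in> tangent_space (tangent_atlas A) q"
  shows "d_K (tangent_atlas A) (J_bracket A V) E q w = bracket_form c (snd c (fst q), snd q c) (w (tangent_chart A c))"
  unfolding d_K_def differential_energy_chart[OF assms(1-3) J_bracket_vertical_field(1)[OF V assms(2,4)]]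
    J_bracket_vertical_field(2)[OF V assms(2,4,1,3)] bracket_form_def ..

lemma bracket_form_coords: "form_coords A (d_K (tangent_atlas A) (J_bracket A V) E) bracket_form"
  unfolding form_coords_def using linear_bracket_form bracket_form_eq by blast

lemma bracket_form_Ck:
  assumes c: "c \<in> A"
  shows "Ck_on k (\<lambda>z. bracket_form c z w) (slit (range_of c))"
  unfolding bracket_form_def
proof (rule Ck_on_linear_apply[where B = "D (fun_coords A c E)"])
  show "open (slit (range_of c) :: ('e \<times> 'e) set)"
    by (intro open_slit open_chart_range[OF A c])
  show "linear (D (fun_coords A c E) z)" if "z \<in> slit (range_of c)" for z
    by (rule linear_D_energy[OF c that])
  show "Ck_on k (\<lambda>z. D (fun_coords A c E) z v) (slit (range_of c))" for v
    by (rule Ck_on_D[OF finsler_energy_Ck[OF c]])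
  have "Ck_on (Suc k) (field_coords A c V) (slit (range_of c))"
    using vertical_field_smooth[OF V] c unfolding smooth_vfield_coords[OF A] by blast
  then show "Ck_on k (\<lambda>z. D (field_coords A c V) z (vert w)) (slit (range_of c))"
    by (rule Ck_on_D)
qed

lemma correction_smooth: "smooth_vfield (tangent_atlas A) (slit_TM A) correction"
  unfolding correction_def by (rule sharp_smooth[OF bracket_form_coords bracket_form_Ck])

lemma correction_tangent: "q \<in> TM A \<Longrightarrow> correction q \<in> tangent_space (tangent_atlas A) q"
  unfolding correction_def by (rule sharp_tangent[OF bracket_form_coords])

lemma correction_coords_zero: "c \<in> A \<Longrightarrow> x \<in> range_of c \<Longrightarrow> field_coords A c correction (x, 0) = 0"
  unfolding correction_def by (rule sharp_coords_zero)

text \<open>The form \<open>d\<^bsub>[J,V]\<^esub>E\<close> vanishes on vertical vectors because \<open>[J, V]\<close> is semibasic.\<close>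

lemma correction_coords_fst:
  assumes "c \<in> A" "z \<in> slit (range_of c)"
  shows "fst (field_coords A c correction z) = 0"
  unfolding correction_def
proof (rule sharp_vertical[OF bracket_form_coords assms])
  show "bracket_form c z (0, y) = 0" for y
    using linear_0[OF linear_bracket_form[OF assms]] by (simp add: bracket_form_def vert_def)
qed

text \<open>In \<open>dE (DV (J w))\<close> the dilation contributes the factor \<open>t\<close> from \<open>DV\<close>, \<open>1 / t\<close> from \<open>J\<close> and \<open>t\<^sup>2\<close> from
  \<open>dE\<close>, so the form scales like \<open>dE\<close> itself.\<close>

lemma correction_coords_homogeneous:
  assumes "homogeneous2 A V" "c \<in> A" "z \<in> slit (range_of c)" "t > 0"
  shows "field_coords A c correction (fibre_scale t z) = t *\<^sub>R fibre_scale t (field_coords A c correction z)"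
  unfolding correction_def
proof (rule sharp_homogeneous[OF bracket_form_coords assms(2-4)])
  fix w
  let ?V = "field_coords A c V"
  have vertical: "t\<^sup>2 *\<^sub>R v = t *\<^sub>R fibre_scale t v" if "fst v = 0" for v :: "'e \<times> 'e"
    using that by (simp add: prod_eq_iff power2_eq_square)
  have L: "linear (\<lambda>v :: 'e \<times> 'e. t *\<^sub>R fibre_scale t v)"
    by (intro linear_compose_scale_right linear_fibre_scale)
  have "?V (fibre_scale t z) = t *\<^sub>R fibre_scale t (?V z)" if "z \<in> slit (range_of c)" for z
    using homogeneous_vertical_field(1)[OF V assms(1,2) that assms(4)] vertical[OF vertical_field_coords[OF V assms(2), of z]] that
    by (simp add: slit_iff mem_Times_iff)
  then have DV: "D ?V (fibre_scale t z) (fibre_scale t w) = t *\<^sub>R fibre_scale t (D ?V z w)" for w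
    by (intro D_equivariant[OF open_slit[OF open_chart_range[OF A assms(2)]] assms(3) linear_fibre_scale L]
        vertical_field_differentiable[OF assms(2)] assms fibre_scale_slit)
  have "D ?V (fibre_scale t z) (vert (fibre_scale t w)) = fibre_scale t (D ?V z (vert w))"
    unfolding vert_fibre_scale[OF assms(4)]
    using linear_scale[OF linear_D[OF vertical_field_differentiable[OF assms(2) fibre_scale_slit[OF assms(3,4)]]]] assms(4)
    by (simp add: DV)
  then show "bracket_form c (fibre_scale t z) (fibre_scale t w) = t\<^sup>2 * bracket_form c z w"
    by (simp add: bracket_form_def finsler_D_homogeneous[OF assms(2-4)])
qed

text \<open>Binary linear combinations with explicit coefficients match the closure lemmas for smooth fields and for
  tangent vectors.\<close>

lemma V_semispray_eq:
  "V_semispray A E V = (\<lambda>q d. 1 *\<^sub>R (1 *\<^sub>R canonical_spray A E q d + 2 *\<^sub>R V q d) + 2 *\<^sub>R correction q d)"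
  by (simp add: V_semispray_def[abs_def] correction_def)

lemma V_semispray_smooth: "smooth_vfield (tangent_atlas A) (slit_TM A) (V_semispray A E V)"
  unfolding V_semispray_eq
  by (intro smooth_vfield_linear canonical_spray_smooth vertical_field_smooth[OF V] correction_smooth)

lemma V_semispray_tangent: "q \<in> TM A \<Longrightarrow> V_semispray A E V q \<in> tangent_space (tangent_atlas A) q"
  unfolding V_semispray_eq
  by (intro tangent_space_linear[OF smooth_tangent_atlas[OF A]] canonical_spray_tangent vertical_field_tangent[OF V] correction_tangent)

lemma V_semispray_coords:
  "field_coords A c (V_semispray A E V) = (\<lambda>z. field_coords A c (canonical_spray A E) z
    + 2 *\<^sub>R field_coords A c V z + 2 *\<^sub>R field_coords A c correction z)"
  by (simp add: V_semispray_eq field_coords_def[abs_def])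

lemma V_semispray_coords_fst:
  assumes "c \<in> A" "z \<in> range_of c \<times> UNIV"
  shows "fst (field_coords A c (V_semispray A E V) z) = snd z"
proof (cases "snd z = 0")
  case True
  then obtain x where "z = (x, 0)" "x \<in> range_of c"
    using assms(2) by (metis mem_Times_iff prod.collapse)
  then show ?thesis
    using assms by (simp add: V_semispray_coords vertical_field_coords[OF V assms] canonical_spray_coords_zero correction_coords_zero
        vertical_field_coords[OF V])
next
  case False
  then have "z \<in> slit (range_of c)" using assms(2) by (simp add: slit_iff mem_Times_iff)
  then show ?thesis
    using assms by (simp add: V_semispray_coords vertical_field_coords[OF V] canonical_spray_coords_fst correction_coords_fst)
qed

lemma V_semispray_slit_semispray: "slit_semispray A (V_semispray A E V)"
  unfolding slit_semispray_def
proof (intro conjI ballI V_semispray_tangent V_semispray_smooth)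
  fix q assume q: "q \<in> TM A"
  show "vertical_endo A q (V_semispray A E V q) = liouville A q"
  proof (rule tangent_fun_eqI[OF A])
    show "vertical_endo A q (V_semispray A E V q) d = liouville A q d" if "\<not> (d \<in> tangent_atlas A \<and> q \<in> fst d)" for d
      unfolding vertical_endo_def liouville_def by (simp only: vertical_lift_outside[OF A that])
  next
    fix c assume c: "c \<in> A" "q \<in> fst (tangent_chart A c)"
    have "fst (V_semispray A E V q (tangent_chart A c)) = snd q c"
      using V_semispray_coords_fst[OF c(1), of "(snd c (fst q), snd q c)"] c
      by (simp add: field_coords_chart[OF A] tangent_chart_domain)
    then show "vertical_endo A q (V_semispray A E V q) (tangent_chart A c) = liouville A q (tangent_chart A c)"
      unfolding vertical_endo_chart[OF A c V_semispray_tangent[OF q]] liouville_chart[OF A c] by (simp add: vert_def)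
  qed
qed

text \<open>Both sides are the same linear combination of \<open>u\<close> and the brackets of \<open>J\<close> with \<open>S0\<close>, \<open>V\<close> and the
  correction, as the bracket is linear in the field.\<close>

lemma V_semispray_ehresmann:
  assumes q: "q \<in> slit_TM A" and u: "u \<in> tangent_space (tangent_atlas A) q"
  shows "ehresmann_generated A (V_semispray A E V) q u = L_ehresmann A E (J_bracket A V) q u"
proof -
  let ?T = "tangent_atlas A" and ?J = "vertical_endo A"
  have qT: "q \<in> TM A" using q slit_TM_subset by blast
  note diff = slit_field_differentiable[OF A _ q]
  note dS = diff[OF V_semispray_smooth] and d0 = diff[OF canonical_spray_smooth]
    and dV = diff[OF vertical_field_smooth[OF V]] and dW = diff[OF correction_smooth]
  note fn_tangent = fn_bracket_vertical_endo(1)[OF A _ qT u]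
  have fn: "fn_bracket ?T ?J (V_semispray A E V) q u = (\<lambda>d. fn_bracket ?T ?J (canonical_spray A E) q u d
     + 2 *\<^sub>R fn_bracket ?T ?J V q u d + 2 *\<^sub>R fn_bracket ?T ?J correction q u d)" (is "?l = ?r")
  proof (rule tangent_fun_eqI[OF A])
    show "?l d = ?r d" if "\<not> (d \<in> ?T \<and> q \<in> fst d)" for d
      by (simp add: tangent_space_zero[OF fn_tangent that] dS d0 dV dW)
  next
    fix c assume c: "c \<in> A" "q \<in> fst (tangent_chart A c)"
    let ?z = "(snd c (fst q), snd q c)"
    note fn_chart = fn_bracket_vertical_endo(2)[OF A _ qT u c]
    note dd = field_differentiable_coords[OF A _ c]
    have scale: "((\<lambda>z. 2 *\<^sub>R field_coords A c X z) has_derivative (\<lambda>h. 2 *\<^sub>R D (field_coords A c X) ?z h)) (at ?z)"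
      if "field_differentiable_near ?T q X" for X
      by (intro has_derivative_scaleR_right D_works dd that)
    have "D (field_coords A c (V_semispray A E V)) ?z = (\<lambda>h. D (field_coords A c (canonical_spray A E)) ?z h
      + 2 *\<^sub>R D (field_coords A c V) ?z h + 2 *\<^sub>R D (field_coords A c correction) ?z h)"
      unfolding V_semispray_coords
      by (intro D_eq has_derivative_add scale dV dW D_works dd d0)
    then show "?l (tangent_chart A c) = ?r (tangent_chart A c)"
      unfolding fn_chart[OF dS] fn_chart[OF d0] fn_chart[OF dV] fn_chart[OF dW]
      by (simp add: linear_add[OF linear_vert] linear_scale[OF linear_vert] scaleR_diff_right)
  qed
  show ?thesis
    unfolding ehresmann_generated_def L_ehresmann_def berwald_connection_def fn J_bracket_def correction_def[symmetric, unfolded J_bracket_def]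
    by (simp add: scaleR_add_right add.assoc)
qed

text \<open>The canonical spray is \<open>(y, 0)\<close> plus a vertical part. That part and the correction are homogeneous maps of
  degree 2, so they are \<open>C\<^sup>1\<close> at the zero section, whereas \<open>V\<close> is so by assumption. The homogeneity of the
  sum is then Euler's relation.\<close>

lemma V_semispray_spray:
  assumes hom: "homogeneous2 A V"
  shows "spray A (V_semispray A E V)"
proof -
  let ?S = "\<lambda>c. field_coords A c (V_semispray A E V)"
  have homogeneous: "?S c (fibre_scale t z) = t *\<^sub>R fibre_scale t (?S c z)"
    if c: "c \<in> A" and z: "z \<in> range_of c \<times> UNIV" and t: "t > 0" for c z t
  proof (cases "snd z = 0")
    case True
    then obtain x where x: "z = (x, 0)" "x \<in> range_of c"
      using z by (metis mem_Times_iff prod.collapse)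
    then show ?thesis
      using c by (simp add: V_semispray_coords canonical_spray_coords_zero correction_coords_zero
          homogeneous_vertical_field(2)[OF V hom] fibre_scale_def zero_prod_def)
  next
    case False
    then have s: "z \<in> slit (range_of c)" using z by (simp add: slit_iff mem_Times_iff)
    have "t\<^sup>2 *\<^sub>R field_coords A c V z = t *\<^sub>R fibre_scale t (field_coords A c V z)"
      using vertical_field_coords[OF V c z] by (simp add: prod_eq_iff power2_eq_square)
    then show ?thesis
      by (simp add: V_semispray_coords canonical_spray_coords_homogeneous[OF c s t] correction_coords_homogeneous[OF hom c s t]
          homogeneous_vertical_field(1)[OF V hom c s t] linear_add[OF linear_fibre_scale] linear_scale[OF linear_fibre_scale]
          scaleR_add_right mult.commute)
  qed
  have C1: "Ck_on 1 (?S c) (range_of c \<times> UNIV)" if c: "c \<in> A" for c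
  proof -
    have U: "open (range_of c)" by (rule open_chart_range[OF A c])
    note S = open_slit[OF U, where ?'b = 'e] and R = open_coords_range[OF c]
    have l: "linear (\<lambda>z :: 'e \<times> 'e. (snd z, 0 :: 'e))" by (intro linearI) auto
    \<comment> \<open>The vertical part of the canonical spray.\<close>
    let ?G = "\<lambda>z. field_coords A c (canonical_spray A E) z + - (snd z, 0)"
    have G: "Ck_on 1 ?G (range_of c \<times> UNIV)"
    proof (rule homogeneous_Ck_1_at_zero[OF U])
      show "Ck_on 1 ?G (slit (range_of c))"
        using canonical_spray_smooth c unfolding smooth_vfield_coords[OF A]
        by (intro Ck_on_add[OF S] Ck_on_bounded_linear[OF bounded_linear_minus[OF bounded_linear_ident] S] Ck_on_linear[OF S l]) blast
      show "?G (x, 0) = 0" if "x \<in> range_of c" for x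
        using canonical_spray_coords_zero[OF c that] by (simp add: zero_prod_def)
      show "?G (fibre_scale t z) = t\<^sup>2 *\<^sub>R ?G z" if "z \<in> slit (range_of c)" "t > 0" for z t
        using canonical_spray_coords_fst[OF c that(1)]
        by (simp add: canonical_spray_coords_homogeneous[OF c that] prod_eq_iff power2_eq_square)
    qed
    moreover have "Ck_on 1 (field_coords A c correction) (range_of c \<times> UNIV)"
    proof (rule homogeneous_Ck_1_at_zero[OF U])
      show "field_coords A c correction (x, 0) = 0" if "x \<in> range_of c" for x
        by (rule correction_coords_zero[OF c that])
      show "Ck_on 1 (field_coords A c correction) (slit (range_of c))"
        using correction_smooth c unfolding smooth_vfield_coords[OF A] by blast
      show "field_coords A c correction (fibre_scale t z) = t\<^sup>2 *\<^sub>R field_coords A c correction z"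
        if "z \<in> slit (range_of c)" "t > 0" for z t
        using correction_coords_fst[OF c that(1)]
        by (simp add: correction_coords_homogeneous[OF hom c that] prod_eq_iff power2_eq_square)
    qed
    moreover have "Ck_on 1 (\<lambda>z. ?G z + (snd z, 0)) (range_of c \<times> UNIV)"
      by (rule Ck_on_add[OF R G Ck_on_linear[OF R l]])
    then have "Ck_on 1 (field_coords A c (canonical_spray A E)) (range_of c \<times> UNIV)"
      by (simp only: add.assoc left_minus add_0_right)
    ultimately show ?thesis
      unfolding V_semispray_coords
      by (intro Ck_on_add[OF R] Ck_on_scaleR[OF R] Ck_on_const vertical_field_Ck_1[OF V c])
  qed
  have "Ck_vfield (tangent_atlas A) 1 (TM A) (V_semispray A E V)"
    unfolding Ck_vfield_coords using V_semispray_tangent C1 tangent_chart_range[OF A] by metis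
  moreover have "homogeneous2 A (V_semispray A E V)"
    unfolding homogeneous2_def
  proof (intro ballI tangent_fun_eqI[OF A])
    fix q d assume "q \<in> TM A" "\<not> (d \<in> tangent_atlas A \<and> q \<in> fst d)"
    then show "lie_bracket (tangent_atlas A) (liouville A) (V_semispray A E V) q d = V_semispray A E V q d"
      using tangent_space_zero[OF V_semispray_tangent, of q d] by (auto simp: lie_bracket_def)
  next
    fix q c assume q: "q \<in> TM A" and c: "c \<in> A" "q \<in> fst (tangent_chart A c)"
    let ?z = "(snd c (fst q), snd q c)"
    have z: "?z \<in> range_of c \<times> UNIV" using c(2) by (simp add: tangent_chart_domain)
    have "D (?S c) ?z (0, snd ?z) = ?S c ?z + (0, snd (?S c ?z))"
      by (rule homogeneous_imp_euler[OF Ck_on_differentiable[OF C1[OF c(1), unfolded One_nat_def] z] homogeneous[OF c(1) z]])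
    then show "lie_bracket (tangent_atlas A) (liouville A) (V_semispray A E V) q (tangent_chart A c) =
        V_semispray A E V q (tangent_chart A c)"
      unfolding liouville_bracket_chart[OF c] field_coords_chart[OF A c] by simp
  qed
  ultimately show ?thesis
    by (simp add: spray_def semispray_def V_semispray_slit_semispray)
qed

end

end

end

theorem proposition7:
  fixes A :: "('m, 'e::euclidean_space) chart set"
    and E :: "('m, 'e) tpoint \<Rightarrow> real"
    and V :: "(('m, 'e) tpoint, 'e \<times> 'e) vfield"
  assumes "smooth_manifold A"
    and "connected_space (atlas_topology A)"
    and "finsler_energy A E"
    and "vertical_field A V"
  shows "slit_semispray A (V_semispray A E V) \<and>
    (\<forall>q\<in>slit_TM A. \<forall>u\<in>tangent_space (tangent_atlas A) q.
       ehresmann_generated A (V_semispray A E V) q u = L_ehresmann A E (J_bracket A V) q u) \<and>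
    (homogeneous2 A V \<longrightarrow> spray A (V_semispray A E V))"
proof -
  have A: "smooth_atlas A"
    using assms(1) by (simp add: smooth_manifold_def)
  show ?thesis
    using V_semispray_slit_semispray[OF A assms(3,4)] V_semispray_ehresmann[OF A assms(3,4)]
      V_semispray_spray[OF A assms(3,4)] by blast
qed

end
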